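(* Let $(M,L)$ be a Finsler manifold and $g$ the Finsler metric defined by $L$. Let $\nabla$ be a regular connection on $\pi^{-1}(TM)$ such that: (a) $\nabla$ is metric: $\nabla g=0$; (b) the horizontal torsion of $\nabla$ vanishes: $Q=0$; (c) the mixed torsion $T$ of $\nabla$ satisfies $g(T(\overline{X},\overline{Y}),\overline{Z})=g(T(\overline{X},\overline{Z}),\overline{Y})$ for all $\overline{X},\overline{Y},\overline{Z}\in\mathfrak{X}(\pi(M))$. Then the semispray $S=\beta\circ\overline{\eta}$ associated with $\nabla$ is a spray, and it coincides with the canonical spray $G$ of $(M,L)$.
   Context: Pullback formalism. $M$ is a real $C^\infty$ manifold of finite dimension; all objects are $C^\infty$. $\pi_M:TM\to M$ is the tangent bundle, $\pi:\mathcal{T}M\to M$ its open subbundle of nonzero tangent vectors, and $\pi^{-1}(TM)\to\mathcal{T}M$ is the pullback of $TM$ by $\pi$ (fibre over $u$: pairs $(u,v)$ with $v\in T_{\pi(u)}M$). $\mathfrak{X}(\mathcal{T}M)$ denotes the vector fields on $\mathcal{T}M$, and $\mathfrak{X}(\pi(M))$ the smooth sections of $\pi^{-1}(TM)$, written with bars. The fundamental section is $\overline{\eta}(u)=(u,u)$. The bundle morphisms $\rho:T(\mathcal{T}M)\to\pi^{-1}(TM)$ and $\gamma:\pi^{-1}(TM)\to T(\mathcal{T}M)$ are $\rho(X)=(u,d\pi(X))$ for $X\in T_u(\mathcal{T}M)$ and $\gamma(u,v)=\frac{d}{dt}\big|_{t=0}(u+tv)$; the image of $\gamma$ is $\ker\rho=V(\mathcal{T}M)$,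 the vertical bundle. Put $J:=\gamma\circ\rho$ and $\mathcal{C}:=\gamma\circ\overline{\eta}$ (the Liouville field). A semispray is a vector field $X$ on $TM$, $C^\infty$ on $\mathcal{T}M$ and $C^1$ on $TM$, with $\rho\circ X=\overline{\eta}$; it is a spray if moreover $[\mathcal{C},X]=X$. Regular connections. For a linear connection $D$ on the vector bundle $\pi^{-1}(TM)$, the connection map is $K(X)=D_X\overline{\eta}$, and the horizontal space at $u$ is $H_u(\mathcal{T}M)=\{X\in T_u(\mathcal{T}M):K(X)=0\}$. $D$ is regular if $T_u(\mathcal{T}M)=V_u(\mathcal{T}M)\oplus H_u(\mathcal{T}M)$ for all $u\in\mathcal{T}M$. Then $\rho|_{H(\mathcal{T}M)}$ is an isomorphism onto $\pi^{-1}(TM)$, and its inverse $\beta:=(\rho|_{H(\mathcal{T}M)})^{-1}$ is the horizontal map of $D$. The vector field $\beta\circ\overline{\eta}$ is called the semispray associated with $D$. Torsions. $\mathbf{T}(X,Y)=D_X\rho Y-D_Y\rho X-\rho[X,Y]$ for $X,Y\in\mathfrak{X}(\mathcal{T}M)$; the horizontal torsion is $Q(\overline{X},\overline{Y})=\mathbf{T}(\beta\overline{X},\beta\overline{Y})$ and the mixed ((h)hv-) torsion is $T(\overline{X},\overline{Y})=\mathbf{T}(\gamma\overline{X},\beta\overline{Y})$. Finsler structure. $(M,L)$ is a Finsler manifold: $L:TM\to\mathbb{R}$ is continuous, $C^\infty$ and positive on $\mathcal{T}M$, positively homogeneous of degree 1 on fibres, and with $E:=\frac12L^2$ the fibrewise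 Hessian of $E$ on $\mathcal{T}M$ is positive definite. The Finsler metric $g$ on $\pi^{-1}(TM)$ is this Hessian, i.e. $g(\rho X,\rho Y)=\Omega(JX,Y)$ with $\Omega:=dd_JE$, $d_JE:=dE\circ J$. The canonical spray $G$ is the vector field with $i_G\Omega=-dE$ (known to be a spray). *)

theory Defs
  imports "HOL-Analysis.Analysis"
begin

section \<open>Functions of class C^k on open subsets of normed spaces\<close>

text \<open>For maps from Euclidean spaces this is the usual notion: all iterated directional
  derivatives up to order \<open>n\<close> exist (as directional values of Frechet derivatives) and are
  continuous.\<close>

fun Cn_on :: "nat \<Rightarrow> 'a::real_normed_vector set \<Rightarrow> ('a \<Rightarrow> 'b::real_normed_vector) \<Rightarrow> bool" where
  "Cn_on 0 S f \<longleftrightarrow> continuous_on S f"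
| "Cn_on (Suc n) S f \<longleftrightarrow>
     (\<forall>x\<in>S. f differentiable (at x)) \<and> (\<forall>v. Cn_on n S (\<lambda>x. frechet_derivative f (at x) v))"

definition Ck_on :: "enat \<Rightarrow> 'a::real_normed_vector set \<Rightarrow> ('a \<Rightarrow> 'b::real_normed_vector) \<Rightarrow> bool"
  where "Ck_on k S f \<longleftrightarrow> (\<forall>n. enat n \<le> k \<longrightarrow> Cn_on n S f)"


section \<open>Manifolds given by an atlas\<close>

text \<open>A chart is a pair (domain, coordinate map); the values of the coordinate map outside the
  domain are irrelevant. The underlying set of the manifold is the union of the chart domains.\<close>

type_synonym ('m, 'e) chart = "'m set \<times> ('m \<Rightarrow> 'e)"

abbreviation cdom :: "('m, 'e) chart \<Rightarrow> 'm set" where "cdom \<equiv> fst"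
abbreviation cmap :: "('m, 'e) chart \<Rightarrow> 'm \<Rightarrow> 'e" where "cmap \<equiv> snd"

definition cinv :: "('m, 'e) chart \<Rightarrow> 'e \<Rightarrow> 'm"
  where "cinv c = inv_into (cdom c) (cmap c)"

definition carrier_of :: "('m, 'e) chart set \<Rightarrow> 'm set"
  where "carrier_of A = (\<Union>c\<in>A. cdom c)"

definition smooth_atlas :: "('m, 'e::euclidean_space) chart set \<Rightarrow> bool"
  where "smooth_atlas A \<longleftrightarrow>
    (\<forall>c\<in>A. inj_on (cmap c) (cdom c) \<and> open (cmap c ` cdom c)) \<and>
    (\<forall>c\<in>A. \<forall>d\<in>A. open (cmap c ` (cdom c \<inter> cdom d)) \<and>
       Ck_on \<infinity> (cmap c ` (cdom c \<inter> cdom d)) (cmap d \<circ> cinv c))"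

definition atlas_open :: "('m, 'e::euclidean_space) chart set \<Rightarrow> 'm set \<Rightarrow> bool"
  where "atlas_open A W \<longleftrightarrow> W \<subseteq> carrier_of A \<and> (\<forall>c\<in>A. open (cmap c ` (W \<inter> cdom c)))"

definition atlas_topology :: "('m, 'e::euclidean_space) chart set \<Rightarrow> 'm topology"
  where "atlas_topology A = topology (atlas_open A)"

lemma istopology_atlas_open:
  assumes "smooth_atlas A"
  shows "istopology (atlas_open A)"
proof -
  have "atlas_open A (S \<inter> T)" if "atlas_open A S" "atlas_open A T" for S T
  proof -
    have "cmap c ` (S \<inter> T \<inter> cdom c) = cmap c ` (S \<inter> cdom c) \<inter> cmap c ` (T \<inter> cdom c)" if "c \<in> A" for c
    proof -
      have "inj_on (cmap c) (cdom c)"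
        using assms that by (simp add: smooth_atlas_def)
      then show ?thesis by (auto simp: inj_on_def)
    qed
    then show ?thesis using that by (auto simp: atlas_open_def)
  qed
  moreover have "atlas_open A (\<Union>K)" if "\<forall>S\<in>K. atlas_open A S" for K
  proof -
    have "cmap c ` (\<Union>K \<inter> cdom c) = (\<Union>S\<in>K. cmap c ` (S \<inter> cdom c))" for c by auto
    then have "open (cmap c ` (\<Union>K \<inter> cdom c))" if "c \<in> A" for c
      using \<open>\<forall>S\<in>K. atlas_open A S\<close> that by (metis (no_types, lifting) atlas_open_def open_UN)
    moreover have "\<Union>K \<subseteq> carrier_of A"
      using that by (auto simp: atlas_open_def)
    ultimately show ?thesis by (simp add: atlas_open_def)
  qed
  ultimately show ?thesis by (auto simp: istopology_def)
qed

lemma openin_atlas_topology: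
  "smooth_atlas A \<Longrightarrow> openin (atlas_topology A) W \<longleftrightarrow> atlas_open A W"
  by (simp add: atlas_topology_def istopology_atlas_open topology_inverse')

definition smooth_manifold :: "('m, 'e::euclidean_space) chart set \<Rightarrow> bool"
  where "smooth_manifold A \<longleftrightarrow> smooth_atlas A \<and>
    Hausdorff_space (atlas_topology A) \<and> second_countable (atlas_topology A)"

text \<open>Real functions and maps of class C^k on an open subset \<open>W\<close> of a manifold. The openness
  condition in \<open>Ck_map\<close> expresses continuity of \<open>f\<close> on \<open>W\<close>.\<close>

definition Ck_fun :: "enat \<Rightarrow> ('m, 'e::euclidean_space) chart set \<Rightarrow> 'm set \<Rightarrow> ('m \<Rightarrow> real) \<Rightarrow> bool"
  where "Ck_fun k A W f \<longleftrightarrow> (\<forall>c\<in>A. Ck_on k (cmap c ` (W \<inter> cdom c)) (f \<circ> cinv c))"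

definition Ck_map :: "enat \<Rightarrow> ('m, 'e::euclidean_space) chart set \<Rightarrow> 'm set \<Rightarrow>
    ('n, 'f::euclidean_space) chart set \<Rightarrow> ('m \<Rightarrow> 'n) \<Rightarrow> bool"
  where "Ck_map k A W B f \<longleftrightarrow> f ` W \<subseteq> carrier_of B \<and>
    (\<forall>c\<in>A. \<forall>d\<in>B. open (cmap c ` (W \<inter> cdom c \<inter> f -` cdom d)) \<and>
       Ck_on k (cmap c ` (W \<inter> cdom c \<inter> f -` cdom d)) (cmap d \<circ> f \<circ> cinv c))"


section \<open>The tangent bundle\<close>

text \<open>A tangent vector at \<open>p\<close> is the family of its components in all charts around \<open>p\<close>, related by
  the Jacobians of the coordinate changes (and 0 by convention at all other indices). Points of
  the tangent bundle are pairs (base point, such a family), so that \<open>fst\<close> is the projection.\<close>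

type_synonym ('m, 'e) tangent = "'m \<times> (('m, 'e) chart \<Rightarrow> 'e)"

definition tspace :: "('m, 'e::euclidean_space) chart set \<Rightarrow> 'm \<Rightarrow> (('m, 'e) chart \<Rightarrow> 'e) set"
  where "tspace A p = {v.
    (\<forall>c. \<not> (c \<in> A \<and> p \<in> cdom c) \<longrightarrow> v c = 0) \<and>
    (\<forall>c\<in>A. \<forall>d\<in>A. p \<in> cdom c \<inter> cdom d \<longrightarrow>
       v d = frechet_derivative (cmap d \<circ> cinv c) (at (cmap c p)) (v c))}"

definition TB :: "('m, 'e::euclidean_space) chart set \<Rightarrow> ('m, 'e) tangent set"
  where "TB A = {(p, v). p \<in> carrier_of A \<and> v \<in> tspace A p}"

definition tchart :: "('m, 'e::euclidean_space) chart set \<Rightarrow> ('m, 'e) chart \<Rightarrow>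
    (('m, 'e) tangent, 'e \<times> 'e) chart"
  where "tchart A c = ({x \<in> TB A. fst x \<in> cdom c}, \<lambda>x. (cmap c (fst x), snd x c))"

definition tatlas :: "('m, 'e::euclidean_space) chart set \<Rightarrow>
    (('m, 'e) tangent, 'e \<times> 'e) chart set"
  where "tatlas A = tchart A ` A"

definition tzero :: "'m \<Rightarrow> ('m, 'e::euclidean_space) tangent"
  where "tzero p = (p, \<lambda>c. 0)"

definition tadd :: "('m, 'e::euclidean_space) tangent \<Rightarrow> ('m, 'e) tangent \<Rightarrow> ('m, 'e) tangent"
  where "tadd x y = (fst x, \<lambda>c. snd x c + snd y c)"

definition tscale :: "real \<Rightarrow> ('m, 'e::euclidean_space) tangent \<Rightarrow> ('m, 'e) tangent"
  where "tscale r x = (fst x, \<lambda>c. r *\<^sub>R snd x c)"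

definition chart_at :: "('m, 'e) chart set \<Rightarrow> 'm \<Rightarrow> ('m, 'e) chart"
  where "chart_at A p = (SOME c. c \<in> A \<and> p \<in> cdom c)"

text \<open>Differential of a map, differential of a real function, and velocity at time 0 of a curve.
  By the chain rule the first two do not depend on the chosen chart.\<close>

definition tmap :: "('m, 'e::euclidean_space) chart set \<Rightarrow> ('n, 'f::euclidean_space) chart set \<Rightarrow>
    ('m \<Rightarrow> 'n) \<Rightarrow> ('m, 'e) tangent \<Rightarrow> ('n, 'f) tangent"
  where "tmap A B f x = (let p = fst x; c = chart_at A p in
    (f p, \<lambda>d. if d \<in> B \<and> f p \<in> cdom d
              then frechet_derivative (cmap d \<circ> f \<circ> cinv c) (at (cmap c p)) (snd x c) else 0))"

definition dfun :: "('m, 'e::euclidean_space) chart set \<Rightarrow> ('m \<Rightarrow> real) \<Rightarrow> ('m, 'e) tangent \<Rightarrow> real"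
  where "dfun A f x = (let p = fst x; c = chart_at A p in
    frechet_derivative (f \<circ> cinv c) (at (cmap c p)) (snd x c))"

definition velocity :: "('m, 'e::euclidean_space) chart set \<Rightarrow> (real \<Rightarrow> 'm) \<Rightarrow> ('m, 'e) tangent"
  where "velocity A q = (q 0, \<lambda>d. if d \<in> A \<and> q 0 \<in> cdom d
                                  then vector_derivative (cmap d \<circ> q) (at 0) else 0)"

text \<open>Vector fields of class C^k on an open subset \<open>W\<close> of the manifold; the tangent spaces of \<open>W\<close>
  are identified with those of the ambient manifold. Outside \<open>W\<close> a field is \<open>undefined\<close>, so that
  fields equal on \<open>W\<close> are equal.\<close>

definition vfields :: "enat \<Rightarrow> ('m, 'e::euclidean_space) chart set \<Rightarrow> 'm set \<Rightarrow>
    ('m \<Rightarrow> ('m, 'e) tangent) set"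
  where "vfields k A W = {X \<in> extensional W.
    (\<forall>p\<in>W. X p \<in> TB A \<and> fst (X p) = p) \<and> Ck_map k A W (tatlas A) X}"

text \<open>Lie bracket in coordinates, with the sign convention [X,Y]f = X(Yf) - Y(Xf).\<close>

definition lie_bracket :: "('m, 'e::euclidean_space) chart set \<Rightarrow> ('m \<Rightarrow> ('m, 'e) tangent) \<Rightarrow>
    ('m \<Rightarrow> ('m, 'e) tangent) \<Rightarrow> 'm \<Rightarrow> ('m, 'e) tangent"
  where "lie_bracket A X Y p = (p, \<lambda>c. if c \<in> A \<and> p \<in> cdom c then
      (let x = cmap c p;
           X' = (\<lambda>y. snd (X (cinv c y)) c);
           Y' = (\<lambda>y. snd (Y (cinv c y)) c)
       in frechet_derivative Y' (at x) (X' x) - frechet_derivative X' (at x) (Y' x)) else 0)"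

text \<open>Exterior derivative of a 1-form \<open>w\<close> (a function on the tangent bundle), evaluated on vector
  fields; normalised without the factor 1/2.\<close>

definition ext_d :: "('m, 'e::euclidean_space) chart set \<Rightarrow> (('m, 'e) tangent \<Rightarrow> real) \<Rightarrow>
    ('m \<Rightarrow> ('m, 'e) tangent) \<Rightarrow> ('m \<Rightarrow> ('m, 'e) tangent) \<Rightarrow> 'm \<Rightarrow> real"
  where "ext_d A w X Y p =
    dfun A (\<lambda>q. w (Y q)) (X p) - dfun A (\<lambda>q. w (X q)) (Y p) - w (lie_bracket A X Y p)"


section \<open>The pullback formalism\<close>

text \<open>The slit tangent bundle, an open subset of the manifold \<open>TM\<close> with atlas \<open>tatlas A\<close>.\<close>

definition slit :: "('m, 'e::euclidean_space) chart set \<Rightarrow> ('m, 'e) tangent set"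
  where "slit A = {u \<in> TB A. u \<noteq> tzero (fst u)}"

type_synonym ('m, 'e) pullback = "('m, 'e) tangent \<times> ('m, 'e) tangent"
type_synonym ('m, 'e) tangent2 = "(('m, 'e) tangent, 'e \<times> 'e) tangent"
type_synonym ('m, 'e) vfield = "('m, 'e) tangent \<Rightarrow> ('m, 'e) tangent2"
type_synonym ('m, 'e) pbsection = "('m, 'e) tangent \<Rightarrow> ('m, 'e) pullback"

definition pb :: "('m, 'e::euclidean_space) chart set \<Rightarrow> ('m, 'e) pullback set"
  where "pb A = {(u, v). u \<in> slit A \<and> v \<in> TB A \<and> fst v = fst u}"

definition pb_atlas :: "('m, 'e::euclidean_space) chart set \<Rightarrow>
    (('m, 'e) pullback, ('e \<times> 'e) \<times> 'e) chart set"
  where "pb_atlas A = (\<lambda>c. ({a \<in> pb A. fst (fst a) \<in> cdom c},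
    \<lambda>a. (cmap (tchart A c) (fst a), snd (snd a) c))) ` A"

definition pzero :: "('m, 'e::euclidean_space) tangent \<Rightarrow> ('m, 'e) pullback"
  where "pzero u = (u, tzero (fst u))"

definition padd :: "('m, 'e::euclidean_space) pullback \<Rightarrow> ('m, 'e) pullback \<Rightarrow> ('m, 'e) pullback"
  where "padd a b = (fst a, tadd (snd a) (snd b))"

definition pscale :: "real \<Rightarrow> ('m, 'e::euclidean_space) pullback \<Rightarrow> ('m, 'e) pullback"
  where "pscale r a = (fst a, tscale r (snd a))"

definition psub :: "('m, 'e::euclidean_space) pullback \<Rightarrow> ('m, 'e) pullback \<Rightarrow> ('m, 'e) pullback"
  where "psub a b = padd a (pscale (-1) b)"

definition slit_fields :: "('m, 'e::euclidean_space) chart set \<Rightarrow> ('m, 'e) vfield set"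
  where "slit_fields A = vfields \<infinity> (tatlas A) (slit A)"

definition pb_sections :: "('m, 'e::euclidean_space) chart set \<Rightarrow> ('m, 'e) pbsection set"
  where "pb_sections A = {s \<in> extensional (slit A).
    (\<forall>u\<in>slit A. s u \<in> pb A \<and> fst (s u) = u) \<and> Ck_map \<infinity> (tatlas A) (slit A) (pb_atlas A) s}"

definition eta :: "('m, 'e::euclidean_space) chart set \<Rightarrow> ('m, 'e) pbsection"
  where "eta A = (\<lambda>u\<in>slit A. (u, u))"

definition rho :: "('m, 'e::euclidean_space) chart set \<Rightarrow> ('m, 'e) tangent2 \<Rightarrow> ('m, 'e) pullback"
  where "rho A x = (fst x, tmap (tatlas A) A fst x)"

definition gam :: "('m, 'e::euclidean_space) chart set \<Rightarrow> ('m, 'e) pullback \<Rightarrow> ('m, 'e) tangent2"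
  where "gam A a = velocity (tatlas A) (\<lambda>t. tadd (fst a) (tscale t (snd a)))"

definition J :: "('m, 'e::euclidean_space) chart set \<Rightarrow> ('m, 'e) tangent2 \<Rightarrow> ('m, 'e) tangent2"
  where "J A x = gam A (rho A x)"

definition liouville :: "('m, 'e::euclidean_space) chart set \<Rightarrow> ('m, 'e) vfield"
  where "liouville A = (\<lambda>u\<in>slit A. gam A (eta A u))"

text \<open>Semisprays and sprays are vector fields on all of \<open>TM\<close>, of class C^1 across the zero section.
  A field on the slit tangent bundle is a spray if it is the restriction of one (the C^1 extension
  is then unique).\<close>

definition is_semispray :: "('m, 'e::euclidean_space) chart set \<Rightarrow> ('m, 'e) vfield \<Rightarrow> bool"
  where "is_semispray A X \<longleftrightarrow> X \<in> vfields 1 (tatlas A) (TB A) \<and>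
    restrict X (slit A) \<in> slit_fields A \<and> (\<forall>u\<in>slit A. rho A (X u) = eta A u)"

definition is_spray :: "('m, 'e::euclidean_space) chart set \<Rightarrow> ('m, 'e) vfield \<Rightarrow> bool"
  where "is_spray A X \<longleftrightarrow> is_semispray A X \<and>
    (\<forall>u\<in>slit A. lie_bracket (tatlas A) (liouville A) X u = X u)"


section \<open>Regular connections on the pullback bundle\<close>

definition linear_connection :: "('m, 'e::euclidean_space) chart set \<Rightarrow>
    (('m, 'e) vfield \<Rightarrow> ('m, 'e) pbsection \<Rightarrow> ('m, 'e) pbsection) \<Rightarrow> bool"
  where "linear_connection A D \<longleftrightarrow>
    (\<forall>X\<in>slit_fields A. \<forall>s\<in>pb_sections A. D X s \<in> pb_sections A) \<and>
    (\<forall>X\<in>slit_fields A. \<forall>Y\<in>slit_fields A. \<forall>s\<in>pb_sections A.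
       D (\<lambda>u\<in>slit A. tadd (X u) (Y u)) s = (\<lambda>u\<in>slit A. padd (D X s u) (D Y s u))) \<and>
    (\<forall>f. \<forall>X\<in>slit_fields A. \<forall>s\<in>pb_sections A. Ck_fun \<infinity> (tatlas A) (slit A) f \<longrightarrow>
       D (\<lambda>u\<in>slit A. tscale (f u) (X u)) s = (\<lambda>u\<in>slit A. pscale (f u) (D X s u))) \<and>
    (\<forall>X\<in>slit_fields A. \<forall>s\<in>pb_sections A. \<forall>t\<in>pb_sections A.
       D X (\<lambda>u\<in>slit A. padd (s u) (t u)) = (\<lambda>u\<in>slit A. padd (D X s u) (D X t u))) \<and>
    (\<forall>f. \<forall>X\<in>slit_fields A. \<forall>s\<in>pb_sections A. Ck_fun \<infinity> (tatlas A) (slit A) f \<longrightarrow>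
       D X (\<lambda>u\<in>slit A. pscale (f u) (s u)) =
         (\<lambda>u\<in>slit A. padd (pscale (dfun (tatlas A) f (X u)) (s u)) (pscale (f u) (D X s u))))"

text \<open>The connection map at a single tangent vector \<open>x\<close>: as \<open>D\<close> is tensorial in its first argument,
  the value does not depend on the vector field chosen to extend \<open>x\<close>.\<close>

definition conn_map :: "('m, 'e::euclidean_space) chart set \<Rightarrow>
    (('m, 'e) vfield \<Rightarrow> ('m, 'e) pbsection \<Rightarrow> ('m, 'e) pbsection) \<Rightarrow>
    ('m, 'e) tangent2 \<Rightarrow> ('m, 'e) pullback"
  where "conn_map A D x = D (SOME X. X \<in> slit_fields A \<and> X (fst x) = x) (eta A) (fst x)"

definition tangent_at :: "('m, 'e::euclidean_space) chart set \<Rightarrow> ('m, 'e) tangent \<Rightarrow>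
    ('m, 'e) tangent2 set"
  where "tangent_at A u = {x \<in> TB (tatlas A). fst x = u}"

definition ver :: "('m, 'e::euclidean_space) chart set \<Rightarrow> ('m, 'e) tangent \<Rightarrow> ('m, 'e) tangent2 set"
  where "ver A u = {x \<in> tangent_at A u. rho A x = pzero u}"

definition hor :: "('m, 'e::euclidean_space) chart set \<Rightarrow>
    (('m, 'e) vfield \<Rightarrow> ('m, 'e) pbsection \<Rightarrow> ('m, 'e) pbsection) \<Rightarrow>
    ('m, 'e) tangent \<Rightarrow> ('m, 'e) tangent2 set"
  where "hor A D u = {x \<in> tangent_at A u. conn_map A D x = pzero u}"

definition regular_connection :: "('m, 'e::euclidean_space) chart set \<Rightarrow>
    (('m, 'e) vfield \<Rightarrow> ('m, 'e) pbsection \<Rightarrow> ('m, 'e) pbsection) \<Rightarrow> bool"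
  where "regular_connection A D \<longleftrightarrow> linear_connection A D \<and>
    (\<forall>u\<in>slit A. ver A u \<inter> hor A D u = {tzero u} \<and>
       (\<forall>x\<in>tangent_at A u. \<exists>v\<in>ver A u. \<exists>h\<in>hor A D u. x = tadd v h))"

definition hmap :: "('m, 'e::euclidean_space) chart set \<Rightarrow>
    (('m, 'e) vfield \<Rightarrow> ('m, 'e) pbsection \<Rightarrow> ('m, 'e) pbsection) \<Rightarrow>
    ('m, 'e) pullback \<Rightarrow> ('m, 'e) tangent2"
  where "hmap A D = inv_into (\<Union>u\<in>slit A. hor A D u) (rho A)"

definition assoc_semispray :: "('m, 'e::euclidean_space) chart set \<Rightarrow>
    (('m, 'e) vfield \<Rightarrow> ('m, 'e) pbsection \<Rightarrow> ('m, 'e) pbsection) \<Rightarrow> ('m, 'e) vfield"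
  where "assoc_semispray A D = (\<lambda>u\<in>slit A. hmap A D (eta A u))"

definition torsion :: "('m, 'e::euclidean_space) chart set \<Rightarrow>
    (('m, 'e) vfield \<Rightarrow> ('m, 'e) pbsection \<Rightarrow> ('m, 'e) pbsection) \<Rightarrow>
    ('m, 'e) vfield \<Rightarrow> ('m, 'e) vfield \<Rightarrow> ('m, 'e) pbsection"
  where "torsion A D X Y = (\<lambda>u\<in>slit A.
    psub (psub (D X (\<lambda>u\<in>slit A. rho A (Y u)) u) (D Y (\<lambda>u\<in>slit A. rho A (X u)) u))
         (rho A (lie_bracket (tatlas A) X Y u)))"

definition hor_torsion :: "('m, 'e::euclidean_space) chart set \<Rightarrow>
    (('m, 'e) vfield \<Rightarrow> ('m, 'e) pbsection \<Rightarrow> ('m, 'e) pbsection) \<Rightarrow>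
    ('m, 'e) pbsection \<Rightarrow> ('m, 'e) pbsection \<Rightarrow> ('m, 'e) pbsection"
  where "hor_torsion A D s t =
    torsion A D (\<lambda>u\<in>slit A. hmap A D (s u)) (\<lambda>u\<in>slit A. hmap A D (t u))"

definition mixed_torsion :: "('m, 'e::euclidean_space) chart set \<Rightarrow>
    (('m, 'e) vfield \<Rightarrow> ('m, 'e) pbsection \<Rightarrow> ('m, 'e) pbsection) \<Rightarrow>
    ('m, 'e) pbsection \<Rightarrow> ('m, 'e) pbsection \<Rightarrow> ('m, 'e) pbsection"
  where "mixed_torsion A D s t =
    torsion A D (\<lambda>u\<in>slit A. gam A (s u)) (\<lambda>u\<in>slit A. hmap A D (t u))"


section \<open>Finsler structures\<close>

definition energy :: "(('m, 'e::euclidean_space) tangent \<Rightarrow> real) \<Rightarrow> ('m, 'e) tangent \<Rightarrow> real"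
  where "energy L u = (L u)\<^sup>2 / 2"

text \<open>The fibrewise Hessian of the energy at \<open>u\<close>, evaluated at \<open>a = (u, v)\<close> and \<open>b = (u, w)\<close>.\<close>

definition fmetric :: "(('m, 'e::euclidean_space) tangent \<Rightarrow> real) \<Rightarrow>
    ('m, 'e) pullback \<Rightarrow> ('m, 'e) pullback \<Rightarrow> real"
  where "fmetric L a b = deriv (\<lambda>s. deriv (\<lambda>t.
    energy L (tadd (tadd (fst a) (tscale s (snd a))) (tscale t (snd b)))) 0) 0"

definition finsler_manifold :: "('m, 'e::euclidean_space) chart set \<Rightarrow>
    (('m, 'e) tangent \<Rightarrow> real) \<Rightarrow> bool"
  where "finsler_manifold A L \<longleftrightarrow> smooth_manifold A \<and>
    Ck_fun 0 (tatlas A) (TB A) L \<and> Ck_fun \<infinity> (tatlas A) (slit A) L \<and>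
    (\<forall>u\<in>slit A. L u > 0) \<and>
    (\<forall>u\<in>TB A. \<forall>r>0. L (tscale r u) = r * L u) \<and>
    (\<forall>a\<in>pb A. a \<noteq> pzero (fst a) \<longrightarrow> fmetric L a a > 0)"

definition Omega :: "('m, 'e::euclidean_space) chart set \<Rightarrow> (('m, 'e) tangent \<Rightarrow> real) \<Rightarrow>
    ('m, 'e) vfield \<Rightarrow> ('m, 'e) vfield \<Rightarrow> ('m, 'e) tangent \<Rightarrow> real"
  where "Omega A L = ext_d (tatlas A) (\<lambda>x. dfun (tatlas A) (energy L) (J A x))"

definition is_canonical_spray :: "('m, 'e::euclidean_space) chart set \<Rightarrow>
    (('m, 'e) tangent \<Rightarrow> real) \<Rightarrow> ('m, 'e) vfield \<Rightarrow> bool"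
  where "is_canonical_spray A L G \<longleftrightarrow> G \<in> slit_fields A \<and>
    (\<forall>Y\<in>slit_fields A. \<forall>u\<in>slit A. Omega A L G Y u = - dfun (tatlas A) (energy L) (Y u))"

definition metric_connection :: "('m, 'e::euclidean_space) chart set \<Rightarrow>
    (('m, 'e) tangent \<Rightarrow> real) \<Rightarrow>
    (('m, 'e) vfield \<Rightarrow> ('m, 'e) pbsection \<Rightarrow> ('m, 'e) pbsection) \<Rightarrow> bool"
  where "metric_connection A L D \<longleftrightarrow>
    (\<forall>X\<in>slit_fields A. \<forall>s\<in>pb_sections A. \<forall>t\<in>pb_sections A. \<forall>u\<in>slit A.
       dfun (tatlas A) (\<lambda>w. fmetric L (s w) (t w)) (X u) =
         fmetric L (D X s u) (t u) + fmetric L (s u) (D X t u))"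

end

theory Submission
  imports Defs
begin

text \<open>
Write \<open>\<eta>\<close> for the fundamental section, \<open>K X = D\<^sub>X \<eta>\<close> for the connection map, \<open>\<beta>\<close> for the horizontal map and
\<open>S = \<beta> \<circ> \<eta>\<close>. Everything follows from two identities that Euler's theorem gives for the 2-homogeneous
energy: \<open>E = g(\<eta>, \<eta>) / 2\<close> and \<open>dE (\<gamma> v) = g(v, \<eta>)\<close>, the latter saying \<open>d\<^sub>J E (X) = g(\<rho> X, \<eta>)\<close>.

As \<open>D\<close> is metric, the first identity gives \<open>dE (X) = g(K X, \<eta>)\<close>, so \<open>dE\<close> vanishes on horizontal vectors
(\<open>energy_horizontal\<close>). Let \<open>Y = \<beta> t\<close> be a horizontal field. As \<open>K S = 0 = K Y\<close>, metricity and the second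
identity turn \<open>\<Omega>(S, Y) = S(g(t, \<eta>)) - Y(g(\<eta>, \<eta>)) - g(\<rho>[S, Y], \<eta>)\<close> into \<open>g(Q(\<eta>, t), \<eta>)\<close>, which vanishes
(\<open>Omega_horizontal\<close>). Hence \<open>i\<^sub>S \<Omega> = -dE\<close> on horizontal vectors. On vertical vectors this equation
holds for every field \<open>X\<close> with \<open>\<rho> X = \<eta>\<close>, again by Euler's theorem (\<open>ddJ_vertical\<close>). So \<open>S\<close> satisfies the
equation of the canonical spray (\<open>S_canonical\<close>). Positivity of \<open>g\<close> makes \<open>\<Omega>\<close> nondegenerate
(\<open>ddJ_nondegenerate\<close>), so the equation has no other solution (\<open>canonical_unique\<close>).

In a chart \<open>S = (y, F(x, y))\<close>. Scaling \<open>y\<close> in the linear equation for \<open>F\<close> and using uniqueness shows that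
\<open>F\<close> is 2-homogeneous in \<open>y\<close> (\<open>spray_coefficient_homogeneous\<close>). This is \<open>[C, S] = S\<close>
(\<open>bracket_liouville\<close>), and it bounds \<open>F\<close> and its derivative near the zero section well enough for the
extension by 0 to be of class C^1 (\<open>quadratic_extension_C1\<close>).

Behind these computations stand four facts about manifolds. Tangent bundles of manifolds are manifolds
(\<open>smooth_atlas_tatlas\<close>), with smoothness of fields detected by components. A connection is
tensorial in its first argument, which needs cut-off functions since it acts on global fields only
(\<open>connection_expand\<close>). Symmetry of second derivatives makes \<open>\<rho>[X, Y]\<close> independent of the chart in which the
bracket is computed (\<open>lie_bracket_base_change\<close>). Finally, \<open>\<beta>\<close> is smooth, because in a chart it solves
a linear system with smooth coefficients (\<open>Cn_on_linear_system\<close>, \<open>hmap_smooth\<close>).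
\<close>

section \<open>Calculus of maps of class C^k\<close>

abbreviation fd :: "('a::real_normed_vector \<Rightarrow> 'b::real_normed_vector) \<Rightarrow> 'a \<Rightarrow> 'a \<Rightarrow> 'b"
  where "fd f x \<equiv> frechet_derivative f (at x)"

lemma fd_eq: "(f has_derivative f') (at x) \<Longrightarrow> fd f x = f'"
  by (simp add: frechet_derivative_at[symmetric])

lemma fd_cong:
  assumes "open S" "x \<in> S" "\<And>y. y \<in> S \<Longrightarrow> f y = g y" "f differentiable (at x)"
  shows "g differentiable (at x)" "fd g x = fd f x"
proof -
  have "(f has_derivative fd f x) (at x)" using assms(4) by (simp add: frechet_derivative_works)
  then have "(g has_derivative fd f x) (at x)"
    by (rule has_derivative_transform_within_open[OF _ assms(1,2)]) (use assms(3) in auto)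
  then show "g differentiable (at x)" "fd g x = fd f x" by (auto simp: differentiable_def fd_eq)
qed

lemma has_derivative_transform_open:
  assumes "(f has_derivative f') (at x)" "open S" "x \<in> S" "\<And>y. y \<in> S \<Longrightarrow> f y = g y"
  shows "(g has_derivative f') (at x)"
  using has_derivative_transform_within_open[OF assms(1-3)] assms(4) by auto

lemma Cn_on_cong:
  assumes "open S" "\<And>x. x \<in> S \<Longrightarrow> f x = g x" "Cn_on n S f"
  shows "Cn_on n S g"
  using assms(2,3)
proof (induction n arbitrary: f g)
  case 0
  then show ?case using continuous_on_cong by force
next
  case (Suc n)
  have d: "(g has_derivative fd f x) (at x)" if "x \<in> S" for x
    using Suc.prems that
    by (intro has_derivative_transform_open[OF _ assms(1) that Suc.prems(1)])
      (auto simp: frechet_derivative_works)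
  have "Cn_on n S (\<lambda>x. fd g x v)" for v
    by (rule Suc.IH[of "\<lambda>x. fd f x v"]) (use Suc.prems fd_eq[OF d] in auto)
  then show ?case using d by (auto simp: differentiable_def)
qed

lemma Cn_on_SucI:
  assumes "open S" "\<And>x. x \<in> S \<Longrightarrow> (f has_derivative f' x) (at x)"
    "\<And>v. Cn_on n S (\<lambda>x. f' x v)"
  shows "Cn_on (Suc n) S f"
proof -
  have "Cn_on n S (\<lambda>x. fd f x v)" for v
    by (rule Cn_on_cong[OF assms(1) _ assms(3)[of v]]) (simp add: fd_eq[OF assms(2)])
  then show ?thesis using assms(2) by (auto simp: differentiable_def)
qed

lemma Cn_on_SucD:
  assumes "Cn_on (Suc n) S f"
  shows "\<And>x. x \<in> S \<Longrightarrow> (f has_derivative fd f x) (at x)" "Cn_on n S (\<lambda>x. fd f x v)"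
  using assms by (auto simp: frechet_derivative_works)

lemma Cn_on_subset: "Cn_on n S f \<Longrightarrow> T \<subseteq> S \<Longrightarrow> Cn_on n T f"
  by (induction n arbitrary: f) (auto intro: continuous_on_subset)

lemma Cn_on_local:
  assumes "\<And>x. x \<in> S \<Longrightarrow> \<exists>T. open T \<and> x \<in> T \<and> Cn_on n T f"
  shows "Cn_on n S f"
  using assms
proof (induction n arbitrary: f)
  case 0
  have "isCont f x" if "x \<in> S" for x
    using 0[OF that] by (auto simp: continuous_on_eq_continuous_at)
  then show ?case by (simp add: continuous_at_imp_continuous_on)
next
  case (Suc n)
  have "\<exists>T. open T \<and> x \<in> T \<and> Cn_on n T (\<lambda>x. fd f x v)" if "x \<in> S" for x v
    using Suc.prems[OF that] by auto
  moreover have "f differentiable (at x)" if "x \<in> S" for x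
    using Suc.prems[OF that] by auto
  ultimately show ?case by (auto intro: Suc.IH)
qed

lemma Cn_on_Suc_lower: "Cn_on (Suc n) S f \<Longrightarrow> Cn_on n S f"
proof (induction n arbitrary: f)
  case 0
  then show ?case
    by (auto intro!: continuous_at_imp_continuous_on differentiable_imp_continuous_within)
next
  case (Suc n)
  then show ?case by (metis Cn_on.simps(2))
qed

lemma Cn_on_const: "Cn_on n S (\<lambda>x. c)"
  by (induction n arbitrary: c) auto

lemma Cn_on_bounded_linear:
  assumes "bounded_linear h" "open S"
  shows "Cn_on n S h"
proof (cases n)
  case 0
  then show ?thesis using assms linear_continuous_on by auto
next
  case (Suc m)
  show ?thesis unfolding Suc
    by (rule Cn_on_SucI[where f' = "\<lambda>x. h"])
      (use assms bounded_linear_imp_has_derivative Cn_on_const in auto)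
qed

lemma Cn_on_compose_linear:
  assumes "bounded_linear h" "open S" "Cn_on n S f"
  shows "Cn_on n S (\<lambda>x. h (f x))"
  using assms(3)
proof (induction n arbitrary: f)
  case 0
  then show ?case using assms by (auto intro: bounded_linear.continuous_on)
next
  case (Suc n)
  show ?case
    by (rule Cn_on_SucI[where f' = "\<lambda>x v. h (fd f x v)", OF assms(2)
          bounded_linear.has_derivative[OF assms(1) Cn_on_SucD(1)[OF Suc.prems]]
          Suc.IH[OF Cn_on_SucD(2)[OF Suc.prems]]])
qed

lemma Cn_on_add:
  assumes "open S" "Cn_on n S f" "Cn_on n S g"
  shows "Cn_on n S (\<lambda>x. f x + g x)"
  using assms(2,3)
proof (induction n arbitrary: f g)
  case 0
  then show ?case by (auto intro: continuous_on_add)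
next
  case (Suc n)
  show ?case
    by (rule Cn_on_SucI[where f' = "\<lambda>x v. fd f x v + fd g x v", OF assms(1)
          has_derivative_add[OF Cn_on_SucD(1)[OF Suc.prems(1)] Cn_on_SucD(1)[OF Suc.prems(2)]]
          Suc.IH[OF Cn_on_SucD(2)[OF Suc.prems(1)] Cn_on_SucD(2)[OF Suc.prems(2)]]])
qed

lemma Cn_on_sum:
  assumes "open S" "\<And>i. i \<in> I \<Longrightarrow> Cn_on n S (f i)"
  shows "Cn_on n S (\<lambda>x. \<Sum>i\<in>I. f i x)"
proof (cases "finite I")
  case True
  then show ?thesis using assms(2)
    by (induction I rule: finite_induct) (auto intro: Cn_on_const Cn_on_add[OF assms(1)])
qed (auto intro: Cn_on_const)

lemma Cn_on_bilinear:
  assumes "bounded_bilinear b" "open S" "Cn_on n S f" "Cn_on n S g"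
  shows "Cn_on n S (\<lambda>x. b (f x) (g x))"
  using assms(3,4)
proof (induction n arbitrary: f g)
  case 0
  then show ?case using bounded_bilinear.continuous_on[OF assms(1)] by auto
next
  case (Suc n)
  show ?case
    by (rule Cn_on_SucI[where f' = "\<lambda>x v. b (f x) (fd g x v) + b (fd f x v) (g x)", OF assms(2)
          bounded_bilinear.FDERIV[OF assms(1) Cn_on_SucD(1)[OF Suc.prems(1)]
            Cn_on_SucD(1)[OF Suc.prems(2)]]], assumption+)
      (intro Cn_on_add assms(2) Suc.IH Cn_on_Suc_lower[OF Suc.prems(1)]
        Cn_on_Suc_lower[OF Suc.prems(2)] Cn_on_SucD(2)[OF Suc.prems(1)] Cn_on_SucD(2)[OF Suc.prems(2)])+
qed

lemma Cn_on_Pair: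
  assumes "open S" "Cn_on n S f" "Cn_on n S g"
  shows "Cn_on n S (\<lambda>x. (f x, g x))"
  using assms(2,3)
proof (induction n arbitrary: f g)
  case 0
  then show ?case by (auto intro: continuous_on_Pair)
next
  case (Suc n)
  show ?case
    by (rule Cn_on_SucI[where f' = "\<lambda>x v. (fd f x v, fd g x v)", OF assms(1)
          has_derivative_Pair[OF Cn_on_SucD(1)[OF Suc.prems(1)] Cn_on_SucD(1)[OF Suc.prems(2)]]
          Suc.IH[OF Cn_on_SucD(2)[OF Suc.prems(1)] Cn_on_SucD(2)[OF Suc.prems(2)]]])
qed

lemma linear_basis_expansion:
  fixes h :: "'a::euclidean_space \<Rightarrow> 'b::real_vector"
  assumes "linear h"
  shows "h w = (\<Sum>b\<in>Basis. (w \<bullet> b) *\<^sub>R h b)"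
proof -
  have "h (\<Sum>b\<in>Basis. (w \<bullet> b) *\<^sub>R b) = (\<Sum>b\<in>Basis. (w \<bullet> b) *\<^sub>R h b)"
    using assms by (simp add: linear_sum linear_cmul o_def)
  then show ?thesis by (simp add: euclidean_representation)
qed

text \<open>A family of linear maps enters only through its values on the finite basis, so that evaluating it at
  a varying argument is a finite sum of products.\<close>

lemma Cn_on_linear_family:
  fixes T :: "'a::real_normed_vector \<Rightarrow> 'b::euclidean_space \<Rightarrow> 'c::real_normed_vector"
  assumes "open S" "\<And>x. x \<in> S \<Longrightarrow> linear (T x)" "\<And>b. Cn_on n S (\<lambda>x. T x b)" "Cn_on n S h"
  shows "Cn_on n S (\<lambda>x. T x (h x))"
proof (rule Cn_on_cong[OF assms(1)])
  show "Cn_on n S (\<lambda>x. \<Sum>b\<in>Basis. (h x \<bullet> b) *\<^sub>R T x b)"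
    by (intro Cn_on_sum Cn_on_bilinear[OF bounded_bilinear_scaleR] assms
        Cn_on_compose_linear[OF bounded_linear_inner_left])
  show "(\<Sum>b\<in>Basis. (h x \<bullet> b) *\<^sub>R T x b) = T x (h x)" if "x \<in> S" for x
    by (rule linear_basis_expansion[symmetric]) (rule assms(2)[OF that])
qed

text \<open>By the chain rule the derivative of the composite is the family of linear maps \<open>fd g (f x)\<close>
  evaluated at the derivative of \<open>f\<close>; induction applies to the directional derivatives of \<open>g\<close>.\<close>

lemma Cn_on_compose:
  fixes g :: "'b::euclidean_space \<Rightarrow> 'c::real_normed_vector"
    and f :: "'a::real_normed_vector \<Rightarrow> 'b"
  assumes "open S" "open T" "f ` S \<subseteq> T" "Cn_on n T g" "Cn_on n S f"
  shows "Cn_on n S (\<lambda>x. g (f x))"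
  using assms(4,5)
proof (induction n arbitrary: g)
  case 0
  then show ?case using assms(3) continuous_on_compose2 by auto
next
  case (Suc n)
  show ?case
  proof (rule Cn_on_SucI[where f' = "\<lambda>x v. fd g (f x) (fd f x v)"])
    show "open S" by fact
    show "((\<lambda>x. g (f x)) has_derivative (\<lambda>v. fd g (f x) (fd f x v))) (at x)" if "x \<in> S" for x
      using diff_chain_at[of f "fd f x" x g "fd g (f x)"] Cn_on_SucD(1)[OF Suc.prems(2) that]
        Cn_on_SucD(1)[OF Suc.prems(1), of "f x"] that assms(3) by (auto simp: o_def)
    show "Cn_on n S (\<lambda>x. fd g (f x) (fd f x v))" for v
    proof (rule Cn_on_linear_family)
      show "linear (fd g (f x))" if "x \<in> S" for x
        using Suc.prems(1) assms(3) that by (auto intro: linear_frechet_derivative)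
      show "Cn_on n S (\<lambda>x. fd g (f x) b)" for b
        using Suc.IH[OF Cn_on_SucD(2)[OF Suc.prems(1)] Cn_on_Suc_lower[OF Suc.prems(2)]] .
    qed (use assms Cn_on_SucD[OF Suc.prems(2)] in auto)
  qed
qed

subsection \<open>Solutions of linear systems\<close>

lemma linear_diff_bound:
  fixes f g :: "'a::euclidean_space \<Rightarrow> 'b::real_normed_vector"
  assumes "linear f" "linear g"
  shows "norm (f v - g v) \<le> (\<Sum>b\<in>Basis. norm (f b - g b)) * norm v"
proof -
  have "f v - g v = (\<Sum>b\<in>Basis. (v \<bullet> b) *\<^sub>R (f b - g b))"
    using linear_basis_expansion[OF assms(1), of v] linear_basis_expansion[OF assms(2), of v]
    by (simp add: scaleR_diff_right sum_subtractf)
  also have "norm \<dots> \<le> (\<Sum>b\<in>Basis. norm (f b - g b) * norm v)"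
    by (rule order_trans[OF norm_sum])
      (auto intro!: sum_mono mult_left_mono Basis_le_norm simp: mult.commute[of "\<bar>_\<bar>"])
  finally show ?thesis by (simp add: sum_distrib_right)
qed

text \<open>An injective linear map on a Euclidean space is bounded below, and the bound survives small
  perturbations. It plays the role of continuity of matrix inversion.\<close>

lemma linear_family_bounded_below:
  fixes T :: "'a::real_normed_vector \<Rightarrow> 'b::euclidean_space \<Rightarrow> 'b"
  assumes S: "open S" "x0 \<in> S" and lin: "\<And>x. x \<in> S \<Longrightarrow> linear (T x)"
    and inj: "\<And>v. T x0 v = 0 \<Longrightarrow> v = 0"
    and cont: "\<And>v. continuous_on S (\<lambda>x. T x v)"
  shows "\<exists>C>0. \<forall>\<^sub>F x in nhds x0. \<forall>v. norm v \<le> C * norm (T x v)"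
proof -
  have bl: "bounded_linear (T x)" if "x \<in> S" for x
    using lin[OF that] linear_conv_bounded_linear by blast
  have injx0: "inj (T x0)" using inj lin[OF S(2)] by (simp add: linear_injective_0)
  obtain B where B: "B > 0" "\<And>v. B * norm v \<le> norm (T x0 v)"
    using linear_inj_bounded_below_pos[OF lin[OF S(2)] injx0] by metis
  define \<epsilon> where "\<epsilon> x = (\<Sum>b\<in>Basis. norm (T x b - T x0 b))" for x
  have diff: "norm (T x v - T x0 v) \<le> \<epsilon> x * norm v" if "x \<in> S" for x v
    unfolding \<epsilon>_def by (rule linear_diff_bound[OF lin[OF that] lin[OF S(2)]])
  have "isCont (\<lambda>x. T x b) x0" for b
    using cont[of b] S continuous_on_eq_continuous_at by blast
  then have "isCont \<epsilon> x0" unfolding \<epsilon>_def by (intro continuous_intros)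
  then have "(\<epsilon> \<longlongrightarrow> \<epsilon> x0) (nhds x0)"
    by (simp only: isCont_def tendsto_at_iff_tendsto_nhds)
  then have "(\<epsilon> \<longlongrightarrow> 0) (nhds x0)" by (simp add: \<epsilon>_def)
  then have "\<forall>\<^sub>F x in nhds x0. \<epsilon> x < B / 2"
    using B(1) order_tendstoD(2)[of \<epsilon> 0 "nhds x0" "B / 2"] by simp
  moreover have "\<forall>\<^sub>F x in nhds x0. x \<in> S" using S by (auto simp: eventually_nhds)
  ultimately have "\<forall>\<^sub>F x in nhds x0. \<forall>v. norm v \<le> (2 / B) * norm (T x v)"
  proof eventually_elim
    case (elim x)
    show ?case
    proof
      fix v
      have "B * norm v \<le> norm (T x0 v)" by (rule B)
      also have "\<dots> \<le> norm (T x v) + norm (T x v - T x0 v)"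
        by (metis norm_minus_commute norm_triangle_sub)
      also have "norm (T x v - T x0 v) \<le> (B / 2) * norm v"
        using diff[OF elim(2), of v] elim(1)
        by (meson less_eq_real_def mult_right_mono norm_ge_zero order_trans)
      finally have "(B / 2) * norm v \<le> norm (T x v)" by (simp add: field_simps)
      then show "norm v \<le> (2 / B) * norm (T x v)" using B(1) by (simp add: field_simps)
    qed
  qed
  then show ?thesis using B(1) by (intro exI[of _ "2 / B"]) auto
qed

text \<open>Differentiating \<open>T x (F x) = h x\<close> shows that the directional derivatives of \<open>F\<close> solve a linear
  system with the same coefficients and with a right-hand side of one order less, to which the
  induction hypothesis applies.\<close>

lemma Cn_on_linear_system:
  fixes T :: "'a::euclidean_space \<Rightarrow> 'b::euclidean_space \<Rightarrow> 'b"
  assumes S: "open S" and lin: "\<And>x. x \<in> S \<Longrightarrow> linear (T x)"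
    and inj: "\<And>x v. x \<in> S \<Longrightarrow> T x v = 0 \<Longrightarrow> v = 0"
  assumes "\<And>v. Cn_on n S (\<lambda>x. T x v)" "Cn_on n S h" "\<And>x. x \<in> S \<Longrightarrow> T x (F x) = h x"
  shows "Cn_on n S F"
  using assms(4-6)
proof (induction n arbitrary: h F)
  case 0
  have "isCont F x0" if x0: "x0 \<in> S" for x0
  proof -
    have cT: "continuous_on S (\<lambda>x. T x v)" for v using 0(1) by simp
    obtain C where C: "C > 0" "\<forall>\<^sub>F x in nhds x0. \<forall>v. norm v \<le> C * norm (T x v)"
      using linear_family_bounded_below[OF S x0 lin inj[OF x0] cT] by auto
    let ?r = "\<lambda>x. h x - T x (F x0)"
    have "isCont h x0" "isCont (\<lambda>x. T x (F x0)) x0"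
      using 0(2) cT x0 S continuous_on_eq_continuous_at by auto
    then have "isCont (\<lambda>x. C * norm (?r x)) x0" by (intro continuous_intros)
    then have "((\<lambda>x. C * norm (?r x)) \<longlongrightarrow> C * norm (?r x0)) (nhds x0)"
      unfolding isCont_def by (subst (asm) tendsto_at_iff_tendsto_nhds)
    then have r: "((\<lambda>x. C * norm (?r x)) \<longlongrightarrow> 0) (nhds x0)"
      using 0(3)[OF x0] by simp
    have "\<forall>\<^sub>F x in nhds x0. x \<in> S" using S x0 by (auto simp: eventually_nhds)
    with C(2) have "\<forall>\<^sub>F x in nhds x0. norm (F x - F x0) \<le> C * norm (?r x)"
    proof eventually_elim
      case (elim x)
      have "T x (F x - F x0) = ?r x"
        using linear_diff[OF lin[OF elim(2)]] 0(3)[OF elim(2)] by simp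
      then show ?case using elim(1) by metis
    qed
    then have "((\<lambda>x. F x - F x0) \<longlongrightarrow> 0) (nhds x0)"
      by (rule Lim_null_comparison[OF _ r])
    then have "(F \<longlongrightarrow> F x0) (nhds x0)" by (rule LIM_zero_cancel)
    then show ?thesis unfolding isCont_def by (subst tendsto_at_iff_tendsto_nhds)
  qed
  then show ?case by (simp add: continuous_at_imp_continuous_on)
next
  case (Suc n)
  have TS: "\<And>v. Cn_on n S (\<lambda>x. T x v)" "Cn_on n S h"
    by (rule Cn_on_Suc_lower[OF Suc.prems(1)], rule Cn_on_Suc_lower[OF Suc.prems(2)])
  have Fn: "Cn_on n S F" by (rule Suc.IH[OF TS Suc.prems(3)])
  \<comment> \<open>The derivative that \<open>F\<close> must have: the solution of the differentiated system.\<close>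
  define G where "G x0 v = inv (T x0) (fd (\<lambda>x. h x - T x (F x0)) x0 v)" for x0 v
  have surj: "surj (T x)" if "x \<in> S" for x
    using inj[OF that] lin[OF that] by (simp add: linear_injective_0 linear_injective_imp_surjective)
  have TG: "T x0 (G x0 v) = fd (\<lambda>x. h x - T x (F x0)) x0 v" if "x0 \<in> S" for x0 v
    unfolding G_def using surj[OF that] by (simp add: surj_f_inv_f)
  have hd: "(h has_derivative fd h x) (at x)" if "x \<in> S" for x
    using Cn_on_SucD(1)[OF Suc.prems(2) that] .
  have Td: "((\<lambda>x. T x w) has_derivative fd (\<lambda>x. T x w) x) (at x)" if "x \<in> S" for x w
    using Cn_on_SucD(1)[OF Suc.prems(1) that] .
  have rd: "((\<lambda>y. h y - T y w) has_derivative (\<lambda>v. fd h x v - fd (\<lambda>y. T y w) x v)) (at x)"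
    if "x \<in> S" for x w
    using has_derivative_diff[OF hd[OF that] Td[OF that]] .
  have TG2: "T x (G x v) = fd h x v - fd (\<lambda>y. T y (F x)) x v" if "x \<in> S" for x v
    by (simp only: TG[OF that] fd_eq[OF rd[OF that]])
  have Fder: "(F has_derivative G x0) (at x0)" if x0: "x0 \<in> S" for x0
  proof -
    have cT: "continuous_on S (\<lambda>x. T x v)" for v
      using Suc.prems(1)[of v]
      by (auto intro!: continuous_at_imp_continuous_on differentiable_imp_continuous_within)
    obtain C where C: "C > 0" "\<forall>\<^sub>F x in nhds x0. \<forall>v. norm v \<le> C * norm (T x v)"
      using linear_family_bounded_below[OF S x0 lin inj[OF x0] cT] by auto
    let ?r = "\<lambda>x. h x - T x (F x0)"
    let ?dr = "fd ?r x0"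
    have dr: "(?r has_derivative ?dr) (at x0)"
      unfolding fd_eq[OF rd[OF x0]] by (rule rd[OF x0])
    interpret dr: bounded_linear ?dr using dr by (rule has_derivative_bounded_linear)
    have injT: "inj (T x0)" using inj[OF x0] lin[OF x0] by (simp add: linear_injective_0)
    have linG: "linear (G x0)"
    proof (rule linearI)
      show "G x0 (a + b) = G x0 a + G x0 b" for a b
        using injT by (rule injD) (simp add: TG[OF x0] linear_add[OF lin[OF x0]] dr.add)
      show "G x0 (c *\<^sub>R b) = c *\<^sub>R G x0 b" for c b
        using injT by (rule injD) (simp add: TG[OF x0] linear_cmul[OF lin[OF x0]] dr.scaleR)
    qed
    then have blG: "bounded_linear (G x0)" using linear_conv_bounded_linear by blast
    obtain K where K': "\<forall>v. norm (G x0 v) \<le> norm v * K" "K > 0"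
      using bounded_linear.pos_bounded[OF blG] by blast
    then have K: "norm (G x0 v) \<le> K * norm v" for v by (simp add: mult.commute)
    define \<epsilon> where "\<epsilon> x = (\<Sum>b\<in>Basis. norm (T x b - T x0 b))" for x
    have diff: "norm (T x v - T x0 v) \<le> \<epsilon> x * norm v" if "x \<in> S" for x v
      unfolding \<epsilon>_def by (rule linear_diff_bound[OF lin[OF that] lin[OF x0]])
    have "isCont (\<lambda>x. T x b) x0" for b
      using cT[of b] S x0 continuous_on_eq_continuous_at by blast
    then have "isCont \<epsilon> x0" unfolding \<epsilon>_def by (intro continuous_intros)
    then have \<epsilon>: "(\<epsilon> \<longlongrightarrow> 0) (at x0)"
      by (simp add: isCont_def \<epsilon>_def)
    have q: "((\<lambda>x. norm (?r x - ?r x0 - ?dr (x - x0)) / norm (x - x0)) \<longlongrightarrow> 0) (at x0)"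
      using dr[unfolded has_derivative_iff_norm, THEN conjunct2] .
    have lim: "((\<lambda>x. C * (norm (?r x - ?r x0 - ?dr (x - x0)) / norm (x - x0) + \<epsilon> x * K))
        \<longlongrightarrow> 0) (at x0)"
      using tendsto_mult[OF tendsto_const[of C] tendsto_add[OF q tendsto_mult[OF \<epsilon> tendsto_const[of K]]]]
      by simp
    have ev: "\<forall>\<^sub>F x in at x0. x \<in> S" using S x0 by (auto simp: eventually_at_topological)
    have ev2: "\<forall>\<^sub>F x in at x0. \<forall>v. norm v \<le> C * norm (T x v)"
      using C(2) unfolding eventually_at_filter by (rule eventually_mono) simp
    have ev3: "\<forall>\<^sub>F x in at x0. x \<noteq> x0" by (simp add: eventually_at_filter)
    have "\<forall>\<^sub>F x in at x0. norm (norm (F x - F x0 - G x0 (x - x0)) / norm (x - x0))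
        \<le> C * (norm (?r x - ?r x0 - ?dr (x - x0)) / norm (x - x0) + \<epsilon> x * K)"
      using ev ev2 ev3
    proof eventually_elim
      case (elim x)
      let ?d = "F x - F x0 - G x0 (x - x0)"
      \<comment> \<open>The residual of the linear approximation is \<open>o(x - x0)\<close>: the derivative of \<open>?r\<close> absorbs its first
        part, continuity of \<open>T\<close> the second.\<close>
      have "T x ?d = (?r x - ?r x0 - ?dr (x - x0)) - (T x (G x0 (x - x0)) - T x0 (G x0 (x - x0)))"
        unfolding linear_diff[OF lin[OF elim(1)]] Suc.prems(3)[OF elim(1)] Suc.prems(3)[OF x0]
          TG[OF x0] by (simp add: algebra_simps)
      then have "norm (T x ?d) \<le> norm (?r x - ?r x0 - ?dr (x - x0))
          + norm (T x (G x0 (x - x0)) - T x0 (G x0 (x - x0)))"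
        by (simp only: norm_triangle_ineq4)
      also have "norm (T x (G x0 (x - x0)) - T x0 (G x0 (x - x0))) \<le> \<epsilon> x * norm (G x0 (x - x0))"
        using diff[OF elim(1)] .
      also have "\<dots> \<le> \<epsilon> x * (K * norm (x - x0))"
        by (intro mult_left_mono K) (auto simp: \<epsilon>_def intro: sum_nonneg)
      finally have "norm (T x ?d) \<le> norm (?r x - ?r x0 - ?dr (x - x0)) + \<epsilon> x * (K * norm (x - x0))"
        by simp
      then have "norm ?d \<le> C * (norm (?r x - ?r x0 - ?dr (x - x0)) + \<epsilon> x * (K * norm (x - x0)))"
        by (rule order_trans[OF elim(2)[rule_format] mult_left_mono]) (use C(1) in simp)
      then have "norm ?d / norm (x - x0)
          \<le> C * (norm (?r x - ?r x0 - ?dr (x - x0)) + \<epsilon> x * (K * norm (x - x0))) / norm (x - x0)"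
        by (rule divide_right_mono) simp
      also have "\<dots> = C * (norm (?r x - ?r x0 - ?dr (x - x0)) / norm (x - x0) + \<epsilon> x * K)"
        using elim(3) by (simp only: add_divide_distrib times_divide_eq_right[symmetric]) simp
      finally show ?case by (simp only: real_norm_def abs_divide abs_norm_cancel)
    qed
    from Lim_null_comparison[OF this lim]
    show ?thesis unfolding has_derivative_iff_norm using blG by blast
  qed
  show ?case
  proof (rule Cn_on_SucI[where f' = G])
    show "Cn_on n S (\<lambda>x. G x v)" for v
    proof (rule Suc.IH)
      show "T x (G x v) = fd h x v - fd (\<lambda>y. T y (F x)) x v" if "x \<in> S" for x
        by (rule TG2[OF that])
      have lin': "linear (\<lambda>w. fd (\<lambda>y. T y w) x v)" if x: "x \<in> S" for x
      proof (rule linearI)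
        fix a b :: 'b and c :: real
        have "((\<lambda>y. T y (a + b)) has_derivative (\<lambda>v. fd (\<lambda>y. T y a) x v + fd (\<lambda>y. T y b) x v)) (at x)"
          by (rule has_derivative_transform_open[OF has_derivative_add[OF Td[OF x] Td[OF x]] S x])
            (simp add: linear_add[OF lin])
        from fd_eq[OF this] show "fd (\<lambda>y. T y (a + b)) x v = fd (\<lambda>y. T y a) x v + fd (\<lambda>y. T y b) x v"
          by simp
        have "((\<lambda>y. T y (c *\<^sub>R b)) has_derivative (\<lambda>v. c *\<^sub>R fd (\<lambda>y. T y b) x v)) (at x)"
          by (rule has_derivative_transform_open[OF has_derivative_scaleR_right[OF Td[OF x]] S x])
            (simp add: linear_cmul[OF lin])
        from fd_eq[OF this] show "fd (\<lambda>y. T y (c *\<^sub>R b)) x v = c *\<^sub>R fd (\<lambda>y. T y b) x v"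
          by simp
      qed
      have "Cn_on n S (\<lambda>x. fd h x v + (-1) *\<^sub>R fd (\<lambda>y. T y (F x)) x v)"
      proof (intro Cn_on_add Cn_on_compose_linear[OF bounded_linear_scaleR_right] S)
        show "Cn_on n S (\<lambda>x. fd h x v)" using Cn_on_SucD(2)[OF Suc.prems(2)] .
        show "Cn_on n S (\<lambda>x. fd (\<lambda>y. T y (F x)) x v)"
          by (rule Cn_on_linear_family[OF S lin' Cn_on_SucD(2)[OF Suc.prems(1)] Fn])
      qed
      then show "Cn_on n S (\<lambda>x. fd h x v - fd (\<lambda>y. T y (F x)) x v)" by simp
    qed (use TS in auto)
  qed (use S Fder in auto)
qed

subsection \<open>Closure properties at every order\<close>

lemma Ck_on_infty: "Ck_on \<infinity> S f \<longleftrightarrow> (\<forall>n. Cn_on n S f)"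
  by (simp add: Ck_on_def)

lemma Ck_on_1: "Ck_on 1 S f \<longleftrightarrow> Cn_on 1 S f"
proof -
  have "enat n \<le> 1 \<longleftrightarrow> n = 0 \<or> n = Suc 0" for n by (auto simp: one_enat_def)
  then have "Ck_on 1 S f \<longleftrightarrow> Cn_on 0 S f \<and> Cn_on (Suc 0) S f"
    by (auto simp: Ck_on_def simp del: Cn_on.simps)
  then show ?thesis unfolding One_nat_def by (metis Cn_on_Suc_lower)
qed

lemma Ck_on_infty_imp: "Ck_on \<infinity> S f \<Longrightarrow> Ck_on k S f"
  by (simp add: Ck_on_def)

lemma Ck_on_cong: "open S \<Longrightarrow> (\<And>x. x \<in> S \<Longrightarrow> f x = g x) \<Longrightarrow> Ck_on k S f \<Longrightarrow> Ck_on k S g"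
  unfolding Ck_on_def using Cn_on_cong by blast

lemma Ck_on_subset: "Ck_on k S f \<Longrightarrow> T \<subseteq> S \<Longrightarrow> Ck_on k T f"
  unfolding Ck_on_def using Cn_on_subset by blast

lemma Ck_on_local:
  assumes "\<And>x. x \<in> S \<Longrightarrow> \<exists>T. open T \<and> x \<in> T \<and> Ck_on k T f"
  shows "Ck_on k S f"
  unfolding Ck_on_def
proof (intro allI impI)
  fix n assume "enat n \<le> k"
  then show "Cn_on n S f"
    using assms by (intro Cn_on_local) (metis Ck_on_def)
qed

lemma Ck_on_const: "Ck_on k S (\<lambda>x. c)"
  by (simp add: Ck_on_def Cn_on_const)

lemma Ck_on_bounded_linear: "bounded_linear h \<Longrightarrow> open S \<Longrightarrow> Ck_on k S h"
  by (simp add: Ck_on_def Cn_on_bounded_linear)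

lemma Ck_on_compose_linear:
  "bounded_linear h \<Longrightarrow> open S \<Longrightarrow> Ck_on k S f \<Longrightarrow> Ck_on k S (\<lambda>x. h (f x))"
  by (simp add: Ck_on_def Cn_on_compose_linear)

lemma Ck_on_add: "open S \<Longrightarrow> Ck_on k S f \<Longrightarrow> Ck_on k S g \<Longrightarrow> Ck_on k S (\<lambda>x. f x + g x)"
  by (simp add: Ck_on_def Cn_on_add)

lemma Ck_on_bilinear:
  "bounded_bilinear b \<Longrightarrow> open S \<Longrightarrow> Ck_on k S f \<Longrightarrow> Ck_on k S g \<Longrightarrow> Ck_on k S (\<lambda>x. b (f x) (g x))"
  by (simp add: Ck_on_def Cn_on_bilinear)

lemma Ck_on_Pair: "open S \<Longrightarrow> Ck_on k S f \<Longrightarrow> Ck_on k S g \<Longrightarrow> Ck_on k S (\<lambda>x. (f x, g x))"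
  by (simp add: Ck_on_def Cn_on_Pair)

lemma Ck_on_compose:
  fixes g :: "'b::euclidean_space \<Rightarrow> 'c::real_normed_vector"
  assumes "open S" "open T" "f ` S \<subseteq> T" "Ck_on k T g" "Ck_on k S f"
  shows "Ck_on k S (\<lambda>x. g (f x))"
  using assms unfolding Ck_on_def by (blast intro: Cn_on_compose)

lemma Ck_on_linear_family:
  fixes T :: "'a::real_normed_vector \<Rightarrow> 'b::euclidean_space \<Rightarrow> 'c::real_normed_vector"
  assumes "open S" "\<And>x. x \<in> S \<Longrightarrow> linear (T x)" "\<And>b. Ck_on k S (\<lambda>x. T x b)" "Ck_on k S h"
  shows "Ck_on k S (\<lambda>x. T x (h x))"
  using assms unfolding Ck_on_def by (blast intro: Cn_on_linear_family)

lemma Ck_on_linear_system: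
  fixes T :: "'a::euclidean_space \<Rightarrow> 'b::euclidean_space \<Rightarrow> 'b"
  assumes "open S" "\<And>x. x \<in> S \<Longrightarrow> linear (T x)" "\<And>x v. x \<in> S \<Longrightarrow> T x v = 0 \<Longrightarrow> v = 0"
    and "\<And>v. Ck_on k S (\<lambda>x. T x v)" "Ck_on k S h" "\<And>x. x \<in> S \<Longrightarrow> T x (F x) = h x"
  shows "Ck_on k S F"
  using assms unfolding Ck_on_def
proof (intro allI impI)
  fix n assume "enat n \<le> k"
  then show "Cn_on n S F"
    using assms by (intro Cn_on_linear_system[of S T n h F]) (auto simp: Ck_on_def)
qed

lemma Ck_on_infty_differentiable: "Ck_on \<infinity> S f \<Longrightarrow> x \<in> S \<Longrightarrow> f differentiable (at x)"
  by (auto simp: Ck_on_infty dest: spec[of _ "Suc 0"])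

lemma Ck_on_infty_fd: "Ck_on \<infinity> S f \<Longrightarrow> Ck_on \<infinity> S (\<lambda>x. fd f x v)"
  unfolding Ck_on_infty by (metis Cn_on.simps(2))

subsection \<open>A flat function and bumps\<close>

text \<open>The functions \<open>t\<^sup>-\<^sup>m exp (-1/t)\<close> are considered together because derivatives stay in their span, which is
  what the induction for smoothness needs.\<close>

definition flat :: "nat \<Rightarrow> real \<Rightarrow> real"
  where "flat m t = (if t > 0 then inverse t ^ m * exp (- inverse t) else 0)"

text \<open>Substituting \<open>s = 1/t\<close> reduces the claim to \<open>s\<^sup>m / exp s\<close> tending to 0.\<close>

lemma flat_tendsto_0: "(flat m \<longlongrightarrow> 0) (at 0)"
proof -
  have "((\<lambda>s. s ^ m / exp s) \<longlongrightarrow> (0::real)) at_top" by (rule tendsto_power_div_exp_0)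
  then have "((\<lambda>t. inverse t ^ m / exp (inverse t)) \<longlongrightarrow> (0::real)) (at_right 0)"
    by (rule filterlim_compose) (rule filterlim_inverse_at_top_right)
  then have "(flat m \<longlongrightarrow> 0) (at_right 0)"
    by (rule Lim_transform_eventually)
      (auto simp: flat_def eventually_at_filter exp_minus field_simps)
  moreover have "(flat m \<longlongrightarrow> 0) (at_left 0)"
    by (rule Lim_transform_eventually[OF tendsto_const]) (auto simp: flat_def eventually_at_filter)
  ultimately show ?thesis by (simp add: filterlim_split_at)
qed

lemma flat_has_derivative:
  "(flat m has_field_derivative (flat (m + 2) t - real m * flat (m + 1) t)) (at t)"
proof -
  consider "t > 0" | "t < 0" | "t = 0" by linarith
  then show ?thesis
  proof cases
    case 1
    have i: "(inverse has_field_derivative - (inverse t * inverse t)) (at t)"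
      using DERIV_inverse'[OF DERIV_ident, of t] 1 by simp
    have "((\<lambda>t. inverse t ^ m * exp (- inverse t)) has_field_derivative
        inverse t ^ m * (exp (- inverse t) * (- (- (inverse t * inverse t)))) +
        real m * (- (inverse t * inverse t) * inverse t ^ (m - Suc 0)) * exp (- inverse t)) (at t)"
      by (rule DERIV_mult'[OF DERIV_power[OF i] DERIV_fun_exp[OF DERIV_minus[OF i]]])
    also have "inverse t ^ m * (exp (- inverse t) * (- (- (inverse t * inverse t)))) +
        real m * (- (inverse t * inverse t) * inverse t ^ (m - Suc 0)) * exp (- inverse t)
      = flat (m + 2) t - real m * flat (m + 1) t"
      using 1 by (cases m) (simp_all add: flat_def algebra_simps)
    finally have "((\<lambda>t. inverse t ^ m * exp (- inverse t)) has_field_derivative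
        (flat (m + 2) t - real m * flat (m + 1) t)) (at t)" .
    then show ?thesis
      by (rule DERIV_cong_ev[OF refl _ refl, THEN iffD1, rotated])
        (use 1 in \<open>auto simp: flat_def eventually_nhds intro!: exI[of _ "{0<..}"]\<close>)
  next
    case 2
    have "((\<lambda>t. 0) has_field_derivative (flat (m + 2) t - real m * flat (m + 1) t)) (at t)"
      using 2 by (simp add: flat_def)
    then show ?thesis
      by (rule DERIV_cong_ev[OF refl _ refl, THEN iffD1, rotated])
        (use 2 in \<open>auto simp: flat_def eventually_nhds intro!: exI[of _ "{..<0}"]\<close>)
  next
    case 3
    have "((\<lambda>h. flat (m + 1) h) \<longlongrightarrow> 0) (at 0)" by (rule flat_tendsto_0)
    then have "((\<lambda>h. (flat m (0 + h) - flat m 0) / h) \<longlongrightarrow> 0) (at 0)"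
      by (rule Lim_transform_eventually) (auto simp: flat_def eventually_at_filter field_simps)
    then show ?thesis using 3 by (simp add: DERIV_def flat_def)
  qed
qed

lemma Cn_on_flat: "Cn_on n UNIV (flat m)"
proof (induction n arbitrary: m)
  case 0
  have "isCont (flat m) t" for t using flat_has_derivative DERIV_isCont by blast
  then show ?case by (simp add: continuous_at_imp_continuous_on)
next
  case (Suc n)
  show ?case
  proof (rule Cn_on_SucI)
    show "(flat m has_derivative (\<lambda>h. (flat (m + 2) t - real m * flat (m + 1) t) * h)) (at t)" for t
      using flat_has_derivative[of m t] by (simp add: has_field_derivative_def)
    have "Cn_on n UNIV (\<lambda>t. v *\<^sub>R (flat (m + 2) t + (- real m) *\<^sub>R flat (m + 1) t))" for v
      by (intro Cn_on_compose_linear[OF bounded_linear_scaleR_right] Cn_on_add Suc.IH open_UNIV)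
    then show "Cn_on n UNIV (\<lambda>t. (flat (m + 2) t - real m * flat (m + 1) t) * v)" for v
      by (simp add: mult.commute)
  qed simp
qed

text \<open>The bump has no plateau: it serves to multiply fields and then to divide by its positive value
  at the centre.\<close>

lemma ex_smooth_bump:
  fixes x0 :: "'a::euclidean_space"
  assumes "r > 0"
  shows "\<exists>f::'a \<Rightarrow> real. Ck_on \<infinity> UNIV f \<and> f x0 > 0 \<and> (\<forall>x. x \<notin> cball x0 r \<longrightarrow> f x = 0)"
proof -
  define f where "f x = flat 0 (r\<^sup>2 - (x - x0) \<bullet> (x - x0))" for x
  have "Cn_on n UNIV (\<lambda>x. r\<^sup>2 + (-1) *\<^sub>R ((x + - x0) \<bullet> (x + - x0)))" for n
    by (intro Cn_on_add Cn_on_const Cn_on_compose_linear[OF bounded_linear_scaleR_right]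
        Cn_on_bilinear[OF bounded_bilinear_inner] Cn_on_bounded_linear[OF bounded_linear_ident] open_UNIV)
  then have "Cn_on n UNIV (\<lambda>x. r\<^sup>2 - (x - x0) \<bullet> (x - x0))" for n by simp
  then have "Ck_on \<infinity> UNIV f"
    unfolding Ck_on_infty f_def
    by (intro allI Cn_on_compose[OF open_UNIV open_UNIV subset_UNIV Cn_on_flat])
  moreover have "f x0 > 0" using assms by (simp add: f_def flat_def)
  moreover have "f x = 0" if "x \<notin> cball x0 r" for x
  proof -
    have "r < norm (x - x0)" using that by (simp add: dist_norm norm_minus_commute)
    then have "r\<^sup>2 < (norm (x - x0))\<^sup>2" using assms by (intro power_strict_mono) auto
    then show ?thesis by (simp add: f_def flat_def power2_norm_eq_inner)
  qed
  ultimately show ?thesis by blast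
qed

subsection \<open>Homogeneous functions of degree two\<close>

text \<open>By compactness of the unit sphere, homogeneity bounds \<open>F (x, y)\<close> by a multiple of \<open>|y|\<^sup>2\<close>, locally
  uniformly in \<open>x\<close>; so \<open>F\<close> has derivative 0 at \<open>(x, 0)\<close>. The partial derivatives in \<open>x\<close> and \<open>y\<close> are
  homogeneous of degree 2 and 1, so the derivative tends to 0 there as well.\<close>

lemma quadratic_extension_C1:
  fixes F :: "'e::euclidean_space \<times> 'e \<Rightarrow> 'b::real_normed_vector"
  assumes U: "open U" and smooth: "Cn_on 1 (U \<times> (UNIV - {0})) F"
    and hom: "\<And>x y t. x \<in> U \<Longrightarrow> y \<noteq> 0 \<Longrightarrow> t > 0 \<Longrightarrow> F (x, t *\<^sub>R y) = t\<^sup>2 *\<^sub>R F (x, y)"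
    and zero: "\<And>x. x \<in> U \<Longrightarrow> F (x, 0) = 0"
  shows "Cn_on 1 (U \<times> UNIV) F"
proof -
  let ?W = "U \<times> (UNIV - {0::'e})"
  have W: "open ?W" using U by (auto intro!: open_Times)
  have der: "(F has_derivative fd F z) (at z)" if "z \<in> ?W" for z
    using Cn_on_SucD(1)[OF smooth[unfolded One_nat_def] that] .
  have cont: "continuous_on ?W (\<lambda>z. fd F z v)" for v
    using Cn_on_SucD(2)[OF smooth[unfolded One_nat_def], of v] by (simp only: Cn_on.simps(1))
  have contF: "continuous_on ?W F"
    using Cn_on_Suc_lower[of 0 ?W F] smooth by simp
  have fdhom: "fd F (x, t *\<^sub>R y) (a, b) = t\<^sup>2 *\<^sub>R fd F (x, y) (a, b /\<^sub>R t)"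
    if "x \<in> U" "y \<noteq> 0" "t > 0" for x y t a b
  proof -
    let ?s = "\<lambda>z::'e \<times> 'e. (fst z, t *\<^sub>R snd z)"
    have s: "(?s has_derivative ?s) (at (x, y))"
      by (auto intro!: derivative_eq_intros)
    have h1: "((F \<circ> ?s) has_derivative (fd F (x, t *\<^sub>R y) \<circ> ?s)) (at (x, y))"
      using diff_chain_at[OF s, of F "fd F (x, t *\<^sub>R y)"] der[of "(x, t *\<^sub>R y)"] that by simp
    have h2: "(F \<circ> ?s) z = t\<^sup>2 *\<^sub>R F z" if "z \<in> ?W" for z
      using hom[of "fst z" "snd z" t] that \<open>t > 0\<close> by (cases z) auto
    have h3: "(x, y) \<in> ?W" using that by auto
    have h4: "((\<lambda>z. t\<^sup>2 *\<^sub>R F z) has_derivative (fd F (x, t *\<^sub>R y) \<circ> ?s)) (at (x, y))"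
      by (rule has_derivative_transform_open[OF h1 W h3 h2])
    have h5: "((\<lambda>z. t\<^sup>2 *\<^sub>R F z) has_derivative (\<lambda>v. t\<^sup>2 *\<^sub>R fd F (x, y) v)) (at (x, y))"
      using der[of "(x, y)"] that by (intro has_derivative_scaleR_right) auto
    have "(fd F (x, t *\<^sub>R y) \<circ> ?s) (a, b /\<^sub>R t) = t\<^sup>2 *\<^sub>R fd F (x, y) (a, b /\<^sub>R t)"
      by (rule fun_cong[OF has_derivative_unique[OF h4 h5]])
    then show ?thesis using that by simp
  qed
  have zero_case: "(F has_derivative (\<lambda>v. 0)) (at (x0, 0)) \<and> (\<forall>v. isCont (\<lambda>z. if snd z = 0 then 0 else fd F z v) (x0, 0))"
    if x0: "x0 \<in> U" for x0
  proof -
    obtain r where r: "r > 0" "cball x0 r \<subseteq> U" using U x0 open_contains_cball by blast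
    let ?K = "cball x0 r \<times> sphere (0::'e) 1"
    have K: "compact ?K" "?K \<subseteq> ?W" using r by (auto intro!: compact_Times)
    have bound: "\<exists>M>0. \<forall>z\<in>?K. norm (G z) \<le> M" if "continuous_on ?W G" for G :: "'e \<times> 'e \<Rightarrow> 'b"
    proof -
      have "bounded (G ` ?K)"
        by (intro compact_imp_bounded compact_continuous_image K)
          (rule continuous_on_subset[OF that K(2)])
      then show ?thesis unfolding bounded_pos by auto
    qed
    obtain M where M: "M > 0" "\<And>z. z \<in> ?K \<Longrightarrow> norm (F z) \<le> M" using bound[OF contF] by auto
    have scale: "(x, sgn y) \<in> ?K" "y = norm y *\<^sub>R sgn y" "norm y > 0" "sgn y \<noteq> 0"
      if "x \<in> cball x0 r" "y \<noteq> 0" for x y :: 'e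
      using that by (auto simp: norm_sgn sgn_div_norm)
    have Fb: "norm (F (x, y)) \<le> M * (norm y)\<^sup>2" if "x \<in> cball x0 r" for x y
    proof (cases "y = 0")
      case True
      then show ?thesis using zero that r by auto
    next
      case False
      have "F (x, y) = (norm y)\<^sup>2 *\<^sub>R F (x, sgn y)"
        using hom[of x "sgn y" "norm y"] scale[OF that False] that r by auto
      then show ?thesis
        using mult_left_mono[OF M(2)[OF scale(1)[OF that False]], of "(norm y)\<^sup>2"]
        by (simp add: mult.commute)
    qed
    have nb: "\<forall>\<^sub>F z in at (x0, 0::'e). fst z \<in> cball x0 r"
    proof -
      have "open (ball x0 r \<times> (UNIV::'e set))" by (intro open_Times) auto
      then have "\<forall>\<^sub>F z in at (x0, 0::'e). z \<in> ball x0 r \<times> (UNIV::'e set)"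
        using r by (intro eventually_at_in_open') auto
      then show ?thesis by (rule eventually_mono) auto
    qed
    have lim0: "((\<lambda>z. C * norm (snd z)) \<longlongrightarrow> 0) (at (x0, 0::'e))" for C :: real
      by (rule tendsto_eq_intros | simp)+
    have "((\<lambda>z. norm (F z - F (x0, 0) - 0) / norm (z - (x0, 0))) \<longlongrightarrow> 0) (at (x0, 0))"
    proof (rule Lim_null_comparison[OF _ lim0])
      show "\<forall>\<^sub>F z in at (x0, 0). norm (norm (F z - F (x0, 0) - 0) / norm (z - (x0, 0))) \<le> M * norm (snd z)"
        using nb
      proof eventually_elim
        case (elim z)
        have "norm (snd z) \<le> norm (z - (x0, 0))"
          by (cases z) (simp add: norm_snd_le[of "(fst z - x0, snd z)", simplified] norm_Pair)
        then have "M * norm (snd z) * norm (snd z) \<le> M * norm (snd z) * norm (z - (x0, 0))"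
          using M(1) by (intro mult_left_mono) auto
        moreover have "norm (F z) \<le> M * (norm (snd z))\<^sup>2" using Fb[OF elim, of "snd z"] by simp
        ultimately have "norm (F z) \<le> M * norm (snd z) * norm (z - (x0, 0))"
          by (simp add: power2_eq_square)
        then show ?case using zero[OF x0] M(1)
          by (cases "z = (x0, 0)") (auto simp: field_simps)
      qed
    qed
    then have d0: "(F has_derivative (\<lambda>v. 0)) (at (x0, 0))"
      by (simp add: has_derivative_iff_norm)
    have "isCont (\<lambda>z. if snd z = 0 then 0 else fd F z (a, b)) (x0, 0)" for a b
    proof -
      obtain M1 where M1: "M1 > 0" "\<And>z. z \<in> ?K \<Longrightarrow> norm (fd F z (a, 0)) \<le> M1"
        using bound[of "\<lambda>z. fd F z (a, 0)"] cont by auto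
      obtain M2 where M2: "M2 > 0" "\<And>z. z \<in> ?K \<Longrightarrow> norm (fd F z (0, b)) \<le> M2"
        using bound[of "\<lambda>z. fd F z (0, b)"] cont by auto
      have fb: "norm (fd F (x, y) (a, b)) \<le> M1 * (norm y)\<^sup>2 + M2 * norm y"
        if "x \<in> cball x0 r" "y \<noteq> 0" for x y
      proof -
        note s = scale[OF that]
        have lin: "linear (fd F (x, sgn y))"
          by (rule has_derivative_linear[OF der[OF subsetD[OF K(2) s(1)]]])
        have "fd F (x, y) (a, b) = (norm y)\<^sup>2 *\<^sub>R fd F (x, sgn y) (a, b /\<^sub>R norm y)"
          using fdhom[of x "sgn y" "norm y" a b] s that r by auto
        also have "(a, b /\<^sub>R norm y) = (a, 0) + (inverse (norm y)) *\<^sub>R (0, b)" by simp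
        also have "fd F (x, sgn y) \<dots> = fd F (x, sgn y) (a, 0) + inverse (norm y) *\<^sub>R fd F (x, sgn y) (0, b)"
          by (simp only: linear_add[OF lin] linear_cmul[OF lin])
        finally have e: "fd F (x, y) (a, b) = (norm y)\<^sup>2 *\<^sub>R fd F (x, sgn y) (a, 0) + norm y *\<^sub>R fd F (x, sgn y) (0, b)"
          using s by (simp add: scaleR_add_right power2_eq_square)
        have "norm (fd F (x, y) (a, b)) \<le> (norm y)\<^sup>2 * norm (fd F (x, sgn y) (a, 0)) + norm y * norm (fd F (x, sgn y) (0, b))"
          unfolding e by (rule norm_triangle_le) simp
        also have "\<dots> \<le> (norm y)\<^sup>2 * M1 + norm y * M2"
          by (intro add_mono mult_left_mono M1 M2 s) auto
        finally show ?thesis by (simp add: mult.commute)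
      qed
      have "((\<lambda>z. if snd z = 0 then 0 else fd F z (a, b)) \<longlongrightarrow> 0) (at (x0, 0))"
      proof (rule Lim_null_comparison)
        show "\<forall>\<^sub>F z in at (x0, 0). norm (if snd z = 0 then 0 else fd F z (a, b)) \<le> M1 * (norm (snd z))\<^sup>2 + M2 * norm (snd z)"
          using nb by eventually_elim (use fb M1(1) M2(1) in auto)
        show "((\<lambda>z. M1 * (norm (snd z))\<^sup>2 + M2 * norm (snd z)) \<longlongrightarrow> 0) (at (x0, 0::'e))"
          by (rule tendsto_eq_intros | simp)+
      qed
      then show ?thesis by (simp add: isCont_def)
    qed
    then show ?thesis using d0 by auto
  qed
  have der': "(F has_derivative (\<lambda>v. if snd z = 0 then 0 else fd F z v)) (at z)" if zU: "z \<in> U \<times> UNIV" for z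
  proof (cases "snd z = 0")
    case True
    then obtain x where x: "z = (x, 0)" "x \<in> U" using zU by (cases z) auto
    then show ?thesis using zero_case[OF x(2)] by simp
  next
    case False
    then have "z \<in> ?W" using zU by (cases z) auto
    then show ?thesis using der False by simp
  qed
  have "continuous_on (U \<times> UNIV) (\<lambda>z. if snd z = 0 then 0 else fd F z v)" for v
  proof (rule continuous_at_imp_continuous_on, rule ballI)
    fix z :: "'e \<times> 'e" assume z: "z \<in> U \<times> UNIV"
    show "isCont (\<lambda>z. if snd z = 0 then 0 else fd F z v) z"
    proof (cases "snd z = 0")
      case True
      then obtain x where x: "z = (x, 0)" "x \<in> U" using z by (cases z) auto
      show ?thesis unfolding x(1) by (rule conjunct2[OF zero_case[OF x(2)], rule_format])
    next
      case False
      then have zW: "z \<in> ?W" using z by auto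
      have "isCont (\<lambda>z. fd F z v) z"
        using cont[of v] zW W continuous_on_eq_continuous_at by blast
      moreover have "\<forall>\<^sub>F w in nhds z. (if snd w = 0 then 0 else fd F w v) = fd F w v"
        using zW W by (auto simp: eventually_nhds intro!: exI[of _ ?W])
      ultimately show ?thesis by (subst isCont_cong[where g = "\<lambda>w. fd F w v"])
    qed
  qed
  then have "Cn_on (Suc 0) (U \<times> UNIV) F"
    by (intro Cn_on_SucI[where f' = "\<lambda>z v. if snd z = 0 then 0 else fd F z v"])
      (use U der' in \<open>auto intro!: open_Times\<close>)
  then show ?thesis by (simp only: One_nat_def)
qed

section \<open>Calculus on manifolds\<close>

subsection \<open>Charts\<close>

abbreviation chg :: "('m, 'e::euclidean_space) chart \<Rightarrow> ('m, 'e) chart \<Rightarrow> 'e \<Rightarrow> 'e"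
  where "chg c d \<equiv> cmap d \<circ> cinv c"

lemma cdom_carrier: "c \<in> B \<Longrightarrow> p \<in> cdom c \<Longrightarrow> p \<in> carrier_of B"
  by (auto simp: carrier_of_def)

lemma cinv_cmap: "smooth_atlas B \<Longrightarrow> c \<in> B \<Longrightarrow> p \<in> cdom c \<Longrightarrow> cinv c (cmap c p) = p"
  by (auto simp: smooth_atlas_def cinv_def)

lemma cinv_in:
  assumes "x \<in> cmap c ` cdom c"
  shows "cinv c x \<in> cdom c" "cmap c (cinv c x) = x"
  using assms by (auto simp: cinv_def inv_into_into f_inv_into_f)

lemma cinv_in_subset:
  assumes "smooth_atlas B" "c \<in> B" "x \<in> cmap c ` (W \<inter> cdom c)"
  shows "cinv c x \<in> W" "cinv c x \<in> cdom c" "cmap c (cinv c x) = x"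
  using assms by (auto simp: cinv_cmap)

lemma atlas_openD: "atlas_open B W \<Longrightarrow> c \<in> B \<Longrightarrow> open (cmap c ` (W \<inter> cdom c))"
  by (simp add: atlas_open_def)

lemma atlas_open_cdom: "smooth_atlas B \<Longrightarrow> c \<in> B \<Longrightarrow> atlas_open B (cdom c)"
  by (auto simp: atlas_open_def smooth_atlas_def carrier_of_def Int_commute)

lemma atlas_open_Int: "smooth_atlas B \<Longrightarrow> atlas_open B V \<Longrightarrow> atlas_open B W \<Longrightarrow> atlas_open B (V \<inter> W)"
  using istopology_atlas_open by (auto simp: istopology_def)

lemma atlas_open_carrier: "smooth_atlas B \<Longrightarrow> atlas_open B (carrier_of B)"
  using istopology_atlas_open[of B] atlas_open_cdom[of B]
  unfolding carrier_of_def istopology_def by (metis (no_types, lifting) imageE)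

lemma open_chg_dom: "smooth_atlas B \<Longrightarrow> c \<in> B \<Longrightarrow> d \<in> B \<Longrightarrow> open (cmap c ` (cdom c \<inter> cdom d))"
  by (auto simp: smooth_atlas_def)

lemma chg_smooth:
  "smooth_atlas B \<Longrightarrow> c \<in> B \<Longrightarrow> d \<in> B \<Longrightarrow> Ck_on \<infinity> (cmap c ` (cdom c \<inter> cdom d)) (chg c d)"
  by (auto simp: smooth_atlas_def)

lemma chg_has_derivative:
  assumes "smooth_atlas B" "c \<in> B" "d \<in> B" "p \<in> cdom c" "p \<in> cdom d"
  shows "(chg c d has_derivative fd (chg c d) (cmap c p)) (at (cmap c p))"
  using Ck_on_infty_differentiable[OF chg_smooth[OF assms(1-3)], of "cmap c p"] assms(4,5)
  by (auto simp: frechet_derivative_works)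

lemma chg_linear:
  assumes "smooth_atlas B" "c \<in> B" "d \<in> B" "p \<in> cdom c" "p \<in> cdom d"
  shows "linear (fd (chg c d) (cmap c p))"
  using chg_has_derivative[OF assms] by (rule has_derivative_linear)

text \<open>The cocycle identity of the Jacobians makes the components of a tangent vector consistent.\<close>

lemma chg_chain:
  assumes B: "smooth_atlas B" "c \<in> B" "d \<in> B" "e \<in> B" and p: "p \<in> cdom c" "p \<in> cdom d" "p \<in> cdom e"
  shows "fd (chg c e) (cmap c p) v = fd (chg d e) (cmap d p) (fd (chg c d) (cmap c p) v)"
proof -
  have eq: "chg c d (cmap c p) = cmap d p" using cinv_cmap[OF B(1,2) p(1)] by simp
  have "(chg d e has_derivative fd (chg d e) (cmap d p)) (at (chg c d (cmap c p)))"
    unfolding eq by (rule chg_has_derivative[OF B(1,3,4) p(2,3)])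
  from diff_chain_at[OF chg_has_derivative[OF B(1-3) p(1,2)] this]
  have 1: "((chg d e \<circ> chg c d) has_derivative (fd (chg d e) (cmap d p) \<circ> fd (chg c d) (cmap c p)))
      (at (cmap c p))" .
  have 2: "(chg c e has_derivative (fd (chg d e) (cmap d p) \<circ> fd (chg c d) (cmap c p)))
      (at (cmap c p))"
  proof (rule has_derivative_transform_open[OF 1 open_chg_dom[OF B(1-3)]])
    show "cmap c p \<in> cmap c ` (cdom c \<inter> cdom d)" using p by auto
    show "(chg d e \<circ> chg c d) y = chg c e y" if "y \<in> cmap c ` (cdom c \<inter> cdom d)" for y
      using that B by (auto simp: cinv_cmap)
  qed
  show ?thesis by (simp add: fd_eq[OF 2])
qed

lemma chg_self:
  assumes B: "smooth_atlas B" "c \<in> B" "p \<in> cdom c"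
  shows "fd (chg c c) (cmap c p) v = v"
proof -
  have "(chg c c has_derivative (\<lambda>v. v)) (at (cmap c p))"
  proof (rule has_derivative_transform_open[OF has_derivative_ident])
    show "open (cmap c ` cdom c)" using B by (auto simp: smooth_atlas_def)
  qed (use B in \<open>auto simp: cinv_cmap\<close>)
  then show ?thesis by (simp add: fd_eq)
qed

subsection \<open>Vector-valued functions\<close>

text \<open>Functions with values in a normed space are treated intrinsically on the manifold. Components of
  fields and sections in a fixed chart, and their images under smooth operations, are of this kind,
  so smoothness can be composed without writing out coordinate representations.\<close>

definition Ck_mfun :: "enat \<Rightarrow> ('m, 'e::euclidean_space) chart set \<Rightarrow> 'm set \<Rightarrow>
    ('m \<Rightarrow> 'v::real_normed_vector) \<Rightarrow> bool"
  where "Ck_mfun k B W f \<longleftrightarrow> (\<forall>c\<in>B. Ck_on k (cmap c ` (W \<inter> cdom c)) (f \<circ> cinv c))"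

lemma Ck_fun_eq_mfun: "Ck_fun k B W f = Ck_mfun k B W f"
  by (simp add: Ck_fun_def Ck_mfun_def)

lemma Ck_mfunD: "Ck_mfun k B W f \<Longrightarrow> c \<in> B \<Longrightarrow> Ck_on k (cmap c ` (W \<inter> cdom c)) (\<lambda>x. f (cinv c x))"
  by (simp add: Ck_mfun_def o_def)

lemma Ck_mfunI: "(\<And>c. c \<in> B \<Longrightarrow> Ck_on k (cmap c ` (W \<inter> cdom c)) (\<lambda>x. f (cinv c x))) \<Longrightarrow> Ck_mfun k B W f"
  by (simp add: Ck_mfun_def o_def)

lemma Ck_mfun_cong:
  assumes "smooth_atlas B" "atlas_open B W" "\<And>p. p \<in> W \<Longrightarrow> f p = g p" "Ck_mfun k B W f"
  shows "Ck_mfun k B W g"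
proof (rule Ck_mfunI)
  fix c assume c: "c \<in> B"
  show "Ck_on k (cmap c ` (W \<inter> cdom c)) (\<lambda>x. g (cinv c x))"
    by (rule Ck_on_cong[OF atlas_openD[OF assms(2) c] _ Ck_mfunD[OF assms(4) c]])
      (use assms(3) cinv_in_subset(1)[OF assms(1) c] in auto)
qed

lemma Ck_mfun_subset: "Ck_mfun k B W f \<Longrightarrow> V \<subseteq> W \<Longrightarrow> Ck_mfun k B V f"
  unfolding Ck_mfun_def by (blast intro: Ck_on_subset)

lemma Ck_mfun_infty_imp: "Ck_mfun \<infinity> B W f \<Longrightarrow> Ck_mfun k B W f"
  unfolding Ck_mfun_def by (blast intro: Ck_on_infty_imp)

text \<open>The neighbourhoods are open sets of the manifold, so each of them serves all charts at once.\<close>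

lemma Ck_mfun_local:
  assumes "\<And>p. p \<in> W \<Longrightarrow> \<exists>N. atlas_open B N \<and> p \<in> N \<and> Ck_mfun k B N f"
  shows "Ck_mfun k B W f"
proof (rule Ck_mfunI, rule Ck_on_local)
  fix c x assume c: "c \<in> B" and x: "x \<in> cmap c ` (W \<inter> cdom c)"
  then obtain p where p: "p \<in> W" "p \<in> cdom c" "x = cmap c p" by auto
  obtain N where N: "atlas_open B N" "p \<in> N" "Ck_mfun k B N f" using assms[OF p(1)] by auto
  show "\<exists>T. open T \<and> x \<in> T \<and> Ck_on k T (\<lambda>x. f (cinv c x))"
    using atlas_openD[OF N(1) c] Ck_mfunD[OF N(3) c] p N(2) by blast
qed

lemma Ck_mfun_const: "Ck_mfun k B W (\<lambda>p. v)"
  by (rule Ck_mfunI) (rule Ck_on_const)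

lemma Ck_mfun_compose_linear:
  assumes "bounded_linear h" "atlas_open B W" "Ck_mfun k B W f"
  shows "Ck_mfun k B W (\<lambda>p. h (f p))"
  by (rule Ck_mfunI, rule Ck_on_compose_linear[OF assms(1)])
    (use assms atlas_openD Ck_mfunD in auto)

lemma Ck_mfun_bilinear:
  assumes "bounded_bilinear b" "atlas_open B W" "Ck_mfun k B W f" "Ck_mfun k B W g"
  shows "Ck_mfun k B W (\<lambda>p. b (f p) (g p))"
  by (rule Ck_mfunI, rule Ck_on_bilinear[OF assms(1)])
    (use assms atlas_openD Ck_mfunD in auto)

lemma Ck_mfun_add:
  assumes "atlas_open B W" "Ck_mfun k B W f" "Ck_mfun k B W g"
  shows "Ck_mfun k B W (\<lambda>p. f p + g p)"
  by (rule Ck_mfunI, rule Ck_on_add)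
    (use assms atlas_openD Ck_mfunD in auto)

lemma Ck_mfun_Pair:
  assumes "atlas_open B W" "Ck_mfun k B W f" "Ck_mfun k B W g"
  shows "Ck_mfun k B W (\<lambda>p. (f p, g p))"
  by (rule Ck_mfunI, rule Ck_on_Pair)
    (use assms atlas_openD Ck_mfunD in auto)

lemma Ck_mfun_compose:
  fixes g :: "'b::euclidean_space \<Rightarrow> 'c::real_normed_vector"
  assumes "smooth_atlas B" "atlas_open B W" "open T" "\<And>p. p \<in> W \<Longrightarrow> f p \<in> T" "Ck_on k T g" "Ck_mfun k B W f"
  shows "Ck_mfun k B W (\<lambda>p. g (f p))"
proof (rule Ck_mfunI)
  fix c assume c: "c \<in> B"
  show "Ck_on k (cmap c ` (W \<inter> cdom c)) (\<lambda>x. g (f (cinv c x)))"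
    by (rule Ck_on_compose[OF atlas_openD[OF assms(2) c] assms(3) _ assms(5) Ck_mfunD[OF assms(6) c]])
      (use assms(4) cinv_in_subset(1)[OF assms(1) c] in auto)
qed

lemma Ck_mfun_linear_family:
  fixes T :: "'n \<Rightarrow> 'b::euclidean_space \<Rightarrow> 'c::real_normed_vector"
  assumes "smooth_atlas B" "atlas_open B W" "\<And>p. p \<in> W \<Longrightarrow> linear (T p)"
    "\<And>b. Ck_mfun k B W (\<lambda>p. T p b)" "Ck_mfun k B W h"
  shows "Ck_mfun k B W (\<lambda>p. T p (h p))"
proof (rule Ck_mfunI)
  fix c assume c: "c \<in> B"
  show "Ck_on k (cmap c ` (W \<inter> cdom c)) (\<lambda>x. T (cinv c x) (h (cinv c x)))"
    by (rule Ck_on_linear_family[OF atlas_openD[OF assms(2) c] _ Ck_mfunD[OF assms(4) c]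
          Ck_mfunD[OF assms(5) c]]) (use assms(3) cinv_in_subset(1)[OF assms(1) c] in auto)
qed

lemma Ck_mfun_linear_system:
  fixes T :: "'n \<Rightarrow> 'b::euclidean_space \<Rightarrow> 'b"
  assumes "smooth_atlas B" "atlas_open B W" "\<And>p. p \<in> W \<Longrightarrow> linear (T p)"
    "\<And>p v. p \<in> W \<Longrightarrow> T p v = 0 \<Longrightarrow> v = 0"
    "\<And>b. Ck_mfun k B W (\<lambda>p. T p b)" "Ck_mfun k B W h" "\<And>p. p \<in> W \<Longrightarrow> T p (F p) = h p"
  shows "Ck_mfun k B W F"
proof (rule Ck_mfunI)
  fix c assume c: "c \<in> B"
  note W = cinv_in_subset(1)[OF assms(1) c, of _ W]
  show "Ck_on k (cmap c ` (W \<inter> cdom c)) (\<lambda>x. F (cinv c x))"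
    by (rule Ck_on_linear_system[OF atlas_openD[OF assms(2) c] assms(3)[OF W] assms(4)[OF W]
          Ck_mfunD[OF assms(5) c] Ck_mfunD[OF assms(6) c] assms(7)[OF W]])
qed

lemma Ck_mfun_cmap:
  assumes "smooth_atlas B" "c \<in> B"
  shows "Ck_mfun \<infinity> B (cdom c) (cmap c)"
proof (rule Ck_mfunI)
  fix d assume d: "d \<in> B"
  show "Ck_on \<infinity> (cmap d ` (cdom c \<inter> cdom d)) (\<lambda>x. cmap c (cinv d x))"
    using chg_smooth[OF assms(1) d assms(2)] by (simp add: Int_commute o_def)
qed

text \<open>One chart suffices on a set that it covers, as \<open>f\<close> factors through its coordinate map.\<close>

lemma Ck_mfun_chart:
  assumes "smooth_atlas B" "c \<in> B" "atlas_open B N" "N \<subseteq> cdom c" "Ck_on k (cmap c ` N) (\<lambda>x. f (cinv c x))"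
  shows "Ck_mfun k B N f"
proof (rule Ck_mfun_cong[OF assms(1,3)])
  have "open (cmap c ` N)" using atlas_openD[OF assms(3,2)] assms(4) by (simp add: Int_absorb2)
  then show "Ck_mfun k B N (\<lambda>p. f (cinv c (cmap c p)))"
    by (rule Ck_mfun_compose[OF assms(1,3) _ _ assms(5)])
      (use Ck_mfun_subset[OF Ck_mfun_infty_imp[OF Ck_mfun_cmap[OF assms(1,2)]] assms(4)] in auto)
  show "f (cinv c (cmap c p)) = f p" if "p \<in> N" for p
    using that assms by (auto simp: cinv_cmap)
qed

lemma Ck_mfun_chg:
  fixes c d :: "('m, 'e::euclidean_space) chart"
  assumes "smooth_atlas B" "atlas_open B W" and A: "smooth_atlas A" "c \<in> A" "d \<in> A"
    and x: "\<And>p. p \<in> W \<Longrightarrow> q p \<in> cdom c \<inter> cdom d" "Ck_mfun k B W (\<lambda>p. cmap c (q p))" "Ck_mfun k B W f"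
  shows "Ck_mfun k B W (\<lambda>p. fd (chg c d) (cmap c (q p)) (f p))"
proof (rule Ck_mfun_linear_family[OF assms(1,2) _ _ x(3)])
  show "linear (fd (chg c d) (cmap c (q p)))" if "p \<in> W" for p
    using chg_linear[OF A, of "q p"] x(1)[OF that] by auto
  show "Ck_mfun k B W (\<lambda>p. fd (chg c d) (cmap c (q p)) b)" for b
    by (rule Ck_mfun_compose[OF assms(1,2) open_chg_dom[OF A] _
          Ck_on_infty_imp[OF Ck_on_infty_fd[OF chg_smooth[OF A]]] x(2)]) (use x(1) in auto)
qed

subsection \<open>Tangent vectors in charts\<close>

text \<open>The tangent vector at \<open>p\<close> whose component in the chart \<open>c\<close> is \<open>v\<close>; the other components are forced.\<close>

definition tvec :: "('m, 'e::euclidean_space) chart set \<Rightarrow> ('m, 'e) chart \<Rightarrow> 'm \<Rightarrow> 'e \<Rightarrow> ('m, 'e) tangent"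
  where "tvec B c p v = (p, \<lambda>d. if d \<in> B \<and> p \<in> cdom d then fd (chg c d) (cmap c p) v else 0)"

lemma fst_tvec [simp]: "fst (tvec B c p v) = p"
  by (simp add: tvec_def)

lemma tvec_comp:
  "smooth_atlas B \<Longrightarrow> c \<in> B \<Longrightarrow> p \<in> cdom c \<Longrightarrow> snd (tvec B c p v) c = v"
  by (simp add: tvec_def chg_self)

lemma TB_iff: "x \<in> TB B \<longleftrightarrow> fst x \<in> carrier_of B \<and>
    (\<forall>c. \<not> (c \<in> B \<and> fst x \<in> cdom c) \<longrightarrow> snd x c = 0) \<and>
    (\<forall>c\<in>B. \<forall>d\<in>B. fst x \<in> cdom c \<inter> cdom d \<longrightarrow>
       snd x d = fd (chg c d) (cmap c (fst x)) (snd x c))"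
  by (cases x) (simp only: TB_def tspace_def mem_Collect_eq prod.case fst_conv snd_conv)

lemma TBI:
  assumes "p \<in> carrier_of B" "\<And>c. \<not> (c \<in> B \<and> p \<in> cdom c) \<Longrightarrow> v c = 0"
    "\<And>c d. c \<in> B \<Longrightarrow> d \<in> B \<Longrightarrow> p \<in> cdom c \<Longrightarrow> p \<in> cdom d \<Longrightarrow> v d = fd (chg c d) (cmap c p) (v c)"
  shows "(p, v) \<in> TB B"
  unfolding TB_iff fst_conv snd_conv
proof (intro conjI allI ballI impI)
  show "v d = fd (chg c d) (cmap c p) (v c)" if "c \<in> B" "d \<in> B" "p \<in> cdom c \<inter> cdom d" for c d
    using assms(3)[OF that(1,2)] that(3) by blast
qed (rule assms(1), rule assms(2))

lemma tvec_in_TB: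
  assumes "smooth_atlas B" "c \<in> B" "p \<in> cdom c"
  shows "tvec B c p v \<in> TB B"
  unfolding tvec_def
proof (rule TBI)
  show "p \<in> carrier_of B" by (rule cdom_carrier[OF assms(2,3)])
  show "(if e \<in> B \<and> p \<in> cdom e then fd (chg c e) (cmap c p) v else 0) =
      fd (chg d e) (cmap d p) (if d \<in> B \<and> p \<in> cdom d then fd (chg c d) (cmap c p) v else 0)"
    if "d \<in> B" "e \<in> B" "p \<in> cdom d" "p \<in> cdom e" for d e
    using chg_chain[OF assms(1,2) that(1,2) assms(3) that(3,4), of v] that by (simp only: simp_thms if_True)
qed auto

lemma TB_comp:
  assumes "x \<in> TB B" "c \<in> B" "d \<in> B" "fst x \<in> cdom c" "fst x \<in> cdom d"
  shows "snd x d = fd (chg c d) (cmap c (fst x)) (snd x c)"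
  using assms unfolding TB_iff by blast

lemma TB_comp_out:
  assumes "x \<in> TB B" "\<not> (c \<in> B \<and> fst x \<in> cdom c)"
  shows "snd x c = 0"
  using assms unfolding TB_iff by blast

text \<open>The Jacobians of the coordinate changes turn one component into all others.\<close>

lemma TB_eqI:
  assumes B: "smooth_atlas B" "c \<in> B" and x: "x \<in> TB B" "y \<in> TB B" "fst x = fst y" "fst x \<in> cdom c"
    and "snd x c = snd y c"
  shows "x = y"
proof -
  have "snd x d = snd y d" for d
  proof (cases "d \<in> B \<and> fst x \<in> cdom d")
    case True
    then have "d \<in> B" "fst x \<in> cdom d" "fst y \<in> cdom c" "fst y \<in> cdom d" using x(3,4) by auto
    with TB_comp[OF x(1) B(2) this(1) x(4) this(2)] TB_comp[OF x(2) B(2) this(1) this(3,4)]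
    show ?thesis using x(3) assms(7) by simp
  next
    case False
    then show ?thesis using TB_comp_out[OF x(1)] TB_comp_out[OF x(2)] x(3) by auto
  qed
  then show ?thesis using x(3) by (auto simp: prod_eq_iff)
qed

lemma TB_carrier: "x \<in> TB B \<Longrightarrow> fst x \<in> carrier_of B"
  by (simp add: TB_iff)

lemma TB_fst: "x \<in> TB B \<Longrightarrow> \<exists>c\<in>B. fst x \<in> cdom c"
  using TB_carrier[of x B] by (auto simp: carrier_of_def)

lemma fst_tangent_ops [simp]: "fst (tadd x y) = fst x" "fst (tscale r x) = fst x" "fst (tzero p) = p"
  by (simp_all add: tadd_def tscale_def tzero_def)

lemma snd_tangent_ops [simp]: "snd (tadd x y) c = snd x c + snd y c" "snd (tscale r x) c = r *\<^sub>R snd x c"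
    "snd (tzero p) c = 0"
  by (simp_all add: tadd_def tscale_def tzero_def)

lemma tzero_TB:
  assumes "smooth_atlas B" "p \<in> carrier_of B"
  shows "tzero p \<in> TB B"
  unfolding tzero_def
proof (rule TBI)
  show "0 = fd (chg c d) (cmap c p) 0"
    if "c \<in> B" "d \<in> B" "p \<in> cdom c" "p \<in> cdom d" for c d
    using linear_0[OF chg_linear[OF assms(1) that]] by simp
qed (rule assms(2), rule refl)

lemma tadd_TB:
  assumes "smooth_atlas B" "x \<in> TB B" "y \<in> TB B" "fst x = fst y"
  shows "tadd x y \<in> TB B"
  unfolding tadd_def
proof (rule TBI)
  show "snd x d + snd y d = fd (chg c d) (cmap c (fst x)) (snd x c + snd y c)"
    if "c \<in> B" "d \<in> B" "fst x \<in> cdom c" "fst x \<in> cdom d" for c d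
    using linear_add[OF chg_linear[OF assms(1) that]] TB_comp[OF assms(2) that]
      TB_comp[OF assms(3) that(1,2)] that assms(4) by simp
next
  show "fst x \<in> carrier_of B" by (rule TB_carrier[OF assms(2)])
  show "snd x c + snd y c = 0" if "\<not> (c \<in> B \<and> fst x \<in> cdom c)" for c
    using TB_comp_out[OF assms(2) that] TB_comp_out[OF assms(3), of c] that assms(4) by simp
qed

lemma tscale_TB:
  assumes "smooth_atlas B" "x \<in> TB B"
  shows "tscale r x \<in> TB B"
  unfolding tscale_def
proof (rule TBI)
  show "r *\<^sub>R snd x d = fd (chg c d) (cmap c (fst x)) (r *\<^sub>R snd x c)"
    if "c \<in> B" "d \<in> B" "fst x \<in> cdom c" "fst x \<in> cdom d" for c d
    using linear_cmul[OF chg_linear[OF assms(1) that]] TB_comp[OF assms(2) that] by simp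
next
  show "fst x \<in> carrier_of B" by (rule TB_carrier[OF assms(2)])
  show "r *\<^sub>R snd x c = 0" if "\<not> (c \<in> B \<and> fst x \<in> cdom c)" for c
    using TB_comp_out[OF assms(2) that] by simp
qed

lemma tchart_simps [simp]:
  "cdom (tchart B c) = {x \<in> TB B. fst x \<in> cdom c}"
  "cmap (tchart B c) x = (cmap c (fst x), snd x c)"
  by (simp_all add: tchart_def)

lemma tchart_in [simp]: "c \<in> B \<Longrightarrow> tchart B c \<in> tatlas B"
  by (simp add: tatlas_def)

lemma tatlasE: "C \<in> tatlas B \<Longrightarrow> (\<And>c. c \<in> B \<Longrightarrow> C = tchart B c \<Longrightarrow> P) \<Longrightarrow> P"
  by (auto simp: tatlas_def)

lemma carrier_tatlas: "carrier_of (tatlas B) = TB B"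
proof
  show "TB B \<subseteq> carrier_of (tatlas B)"
    using TB_fst[of _ B] by (auto simp: carrier_of_def tatlas_def)
qed (auto simp: carrier_of_def tatlas_def)

lemma tchart_image:
  assumes "smooth_atlas B" "c \<in> B"
  shows "cmap (tchart B c) ` {x \<in> TB B. fst x \<in> N \<inter> cdom c} = cmap c ` (N \<inter> cdom c) \<times> UNIV"
proof
  show "cmap c ` (N \<inter> cdom c) \<times> UNIV \<subseteq> cmap (tchart B c) ` {x \<in> TB B. fst x \<in> N \<inter> cdom c}"
  proof
    fix z assume "z \<in> cmap c ` (N \<inter> cdom c) \<times> (UNIV::'b set)"
    then obtain p v where z: "z = (cmap c p, v)" "p \<in> N" "p \<in> cdom c" by auto
    then have "z = cmap (tchart B c) (tvec B c p v)" using assms by (simp add: tvec_comp)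
    then show "z \<in> cmap (tchart B c) ` {x \<in> TB B. fst x \<in> N \<inter> cdom c}"
      using z tvec_in_TB[OF assms z(3)] by (intro image_eqI) auto
  qed
qed auto

lemma tchart_inj:
  assumes "smooth_atlas B" "c \<in> B"
  shows "inj_on (cmap (tchart B c)) (cdom (tchart B c))"
proof (rule inj_onI)
  fix x y assume xy: "x \<in> cdom (tchart B c)" "y \<in> cdom (tchart B c)"
    "cmap (tchart B c) x = cmap (tchart B c) y"
  then have "fst x = fst y" using assms unfolding smooth_atlas_def by (auto simp: inj_on_def)
  then show "x = y" using xy by (intro TB_eqI[OF assms]) auto
qed

lemma cinv_tchart:
  assumes "smooth_atlas B" "c \<in> B" "x \<in> cmap c ` cdom c"
  shows "cinv (tchart B c) (x, y) = tvec B c (cinv c x) y"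
proof -
  let ?u = "tvec B c (cinv c x) y"
  have "?u \<in> cdom (tchart B c)" using cinv_in[OF assms(3)] tvec_in_TB[OF assms(1,2)] by auto
  moreover have "cmap (tchart B c) ?u = (x, y)" using cinv_in[OF assms(3)] assms by (simp add: tvec_comp)
  ultimately show ?thesis using tchart_inj[OF assms(1,2)] unfolding cinv_def
    by (metis inv_into_f_f)
qed

text \<open>The coordinate changes are \<open>(x, y) \<mapsto> (\<phi> x, D\<phi>(x) y)\<close> on products of the old overlaps with the whole
  vector space. Applied to the tangent bundle itself it makes the second tangent bundle available.\<close>

lemma smooth_atlas_tatlas:
  assumes B: "smooth_atlas B"
  shows "smooth_atlas (tatlas B)"
proof -
  have ov: "cmap (tchart B c) ` (cdom (tchart B c) \<inter> cdom (tchart B d)) = cmap c ` (cdom c \<inter> cdom d) \<times> UNIV"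
    if "c \<in> B" for c d
  proof -
    have "cdom (tchart B c) \<inter> cdom (tchart B d) = {x \<in> TB B. fst x \<in> cdom d \<inter> cdom c}" by auto
    then show ?thesis using tchart_image[OF B that, of "cdom d"] by (simp add: Int_commute)
  qed
  have "open (cmap (tchart B c) ` cdom (tchart B c))" if "c \<in> B" for c
    using ov[OF that, of c] B that by (auto simp: smooth_atlas_def intro!: open_Times)
  moreover have "open (cmap (tchart B c) ` (cdom (tchart B c) \<inter> cdom (tchart B d)))" if "c \<in> B" "d \<in> B" for c d
    unfolding ov[OF that(1)] using B that by (auto simp: smooth_atlas_def intro!: open_Times)
  moreover have "Ck_on \<infinity> (cmap (tchart B c) ` (cdom (tchart B c) \<inter> cdom (tchart B d))) (chg (tchart B c) (tchart B d))"
    if "c \<in> B" "d \<in> B" for c d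
  proof -
    let ?V = "cmap c ` (cdom c \<inter> cdom d)"
    have V: "open (?V \<times> (UNIV::'b set))" using open_chg_dom[OF B that] by (auto intro!: open_Times)
    have f: "Ck_on \<infinity> (?V \<times> (UNIV::'b set)) fst" "Ck_on \<infinity> (?V \<times> (UNIV::'b set)) snd"
      by (rule Ck_on_bounded_linear[OF bounded_linear_fst V], rule Ck_on_bounded_linear[OF bounded_linear_snd V])
    have 1: "Ck_on \<infinity> (?V \<times> (UNIV::'b set)) (\<lambda>z. chg c d (fst z))"
      by (rule Ck_on_compose[OF V open_chg_dom[OF B that] _ chg_smooth[OF B that] f(1)]) auto
    have 2: "Ck_on \<infinity> (?V \<times> (UNIV::'b set)) (\<lambda>z. fd (chg c d) (fst z) (snd z))"
    proof (rule Ck_on_linear_family[OF V _ _ f(2)])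
      show "linear (fd (chg c d) (fst z))" if "z \<in> ?V \<times> UNIV" for z :: "'b \<times> 'b"
        using that chg_linear[OF B \<open>c \<in> B\<close> \<open>d \<in> B\<close>] by auto
      show "Ck_on \<infinity> (?V \<times> (UNIV::'b set)) (\<lambda>z. fd (chg c d) (fst z) b)" for b
        by (rule Ck_on_compose[OF V open_chg_dom[OF B that] _ Ck_on_infty_fd[OF chg_smooth[OF B that]] f(1)]) auto
    qed
    show ?thesis unfolding ov[OF that(1)]
    proof (rule Ck_on_cong[OF V _ Ck_on_Pair[OF V 1 2]])
      fix z assume z: "z \<in> ?V \<times> (UNIV::'b set)"
      then obtain p y where p: "z = (cmap c p, y)" "p \<in> cdom c" "p \<in> cdom d" by auto
      then have "cinv (tchart B c) z = tvec B c p y"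
        using cinv_tchart[OF B that(1), of "cmap c p" y] cinv_cmap[OF B that(1)] by auto
      then show "(chg c d (fst z), fd (chg c d) (fst z) (snd z)) = chg (tchart B c) (tchart B d) z"
        using p B that by (simp add: cinv_cmap) (simp add: tvec_def)
    qed
  qed
  ultimately show ?thesis using tchart_inj[OF B]
    unfolding smooth_atlas_def by (auto elim!: tatlasE simp del: tchart_simps)
qed

lemma atlas_open_pullback:
  assumes "smooth_atlas B" "atlas_open B N"
  shows "atlas_open (tatlas B) {u \<in> TB B. fst u \<in> N}"
  unfolding atlas_open_def carrier_tatlas
proof (intro conjI ballI)
  fix C assume "C \<in> tatlas B"
  then obtain c where c: "c \<in> B" "C = tchart B c" by (rule tatlasE)
  have "{u \<in> TB B. fst u \<in> N} \<inter> cdom C = {x \<in> TB B. fst x \<in> N \<inter> cdom c}" using c by auto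
  then show "open (cmap C ` ({u \<in> TB B. fst u \<in> N} \<inter> cdom C))"
    using tchart_image[OF assms(1) c(1), of N] atlas_openD[OF assms(2) c(1)] c(2)
    by (auto intro!: open_Times)
qed auto

lemma slit_iff:
  assumes "smooth_atlas B" "c \<in> B" "fst u \<in> cdom c"
  shows "u \<in> slit B \<longleftrightarrow> u \<in> TB B \<and> snd u c \<noteq> 0"
proof -
  have "u = tzero (fst u)" if "u \<in> TB B" "snd u c = 0"
    by (rule TB_eqI[OF assms(1,2) that(1) tzero_TB[OF assms(1) TB_carrier[OF that(1)]]])
      (use assms that in auto)
  moreover have "snd u c = 0" if "u = tzero (fst u)" using that by (metis snd_tangent_ops(3))
  ultimately show ?thesis by (auto simp: slit_def)
qed

lemma slit_TB: "u \<in> slit B \<Longrightarrow> u \<in> TB B"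
  by (simp add: slit_def)

lemma tchart_image_slit:
  assumes "smooth_atlas B" "c \<in> B"
  shows "cmap (tchart B c) ` (slit B \<inter> cdom (tchart B c)) = cmap c ` cdom c \<times> (UNIV - {0})"
proof
  show "cmap (tchart B c) ` (slit B \<inter> cdom (tchart B c)) \<subseteq> cmap c ` cdom c \<times> (UNIV - {0})"
    using slit_iff[OF assms] by auto
  show "cmap c ` cdom c \<times> (UNIV - {0}) \<subseteq> cmap (tchart B c) ` (slit B \<inter> cdom (tchart B c))"
  proof
    fix z assume "z \<in> cmap c ` cdom c \<times> (UNIV - {0::'b})"
    then obtain p v where z: "z = (cmap c p, v)" "p \<in> cdom c" "v \<noteq> 0" by auto
    then have "z = cmap (tchart B c) (tvec B c p v)" using assms by (simp add: tvec_comp)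
    moreover have "tvec B c p v \<in> slit B \<inter> cdom (tchart B c)"
      using slit_iff[OF assms, of "tvec B c p v"] tvec_in_TB[OF assms z(2)] z tvec_comp[OF assms z(2)] by auto
    ultimately show "z \<in> cmap (tchart B c) ` (slit B \<inter> cdom (tchart B c))" by blast
  qed
qed

lemma atlas_open_slit:
  assumes "smooth_atlas B"
  shows "atlas_open (tatlas B) (slit B)"
  unfolding atlas_open_def carrier_tatlas
proof (intro conjI ballI)
  show "slit B \<subseteq> TB B" by (auto simp: slit_def)
  fix C assume "C \<in> tatlas B"
  then obtain c where c: "c \<in> B" "C = tchart B c" by (rule tatlasE)
  show "open (cmap C ` (slit B \<inter> cdom C))"
    unfolding c(2) tchart_image_slit[OF assms c(1)]
    using assms c(1) by (intro open_Times) (auto simp: smooth_atlas_def)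
qed

subsection \<open>Smooth vector fields in charts\<close>

lemma atlas_open_Int_cdom:
  "smooth_atlas B \<Longrightarrow> atlas_open B W \<Longrightarrow> c \<in> B \<Longrightarrow> atlas_open B (W \<inter> cdom c)"
  by (intro atlas_open_Int atlas_open_cdom)

lemma Ck_mapD:
  assumes "Ck_map k A W B f" "c \<in> A" "d \<in> B"
  shows "Ck_on k (cmap c ` (W \<inter> cdom c \<inter> f -` cdom d)) (cmap d \<circ> f \<circ> cinv c)"
  using conjunct2[OF assms(1)[unfolded Ck_map_def]] assms(2,3) by simp

lemma vfieldsI:
  assumes B: "smooth_atlas B" and W: "atlas_open B W" and X: "X \<in> extensional W"
    "\<And>p. p \<in> W \<Longrightarrow> X p \<in> TB B" "\<And>p. p \<in> W \<Longrightarrow> fst (X p) = p"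
    and sm: "\<And>c. c \<in> B \<Longrightarrow> Ck_mfun k B (W \<inter> cdom c) (\<lambda>p. snd (X p) c)"
  shows "X \<in> vfields k B W"
proof -
  have "Ck_map k B W (tatlas B) X"
    unfolding Ck_map_def carrier_tatlas
  proof (intro conjI ballI)
    show "X ` W \<subseteq> TB B" using X(2) by auto
    fix c D assume c: "c \<in> B" and "D \<in> tatlas B"
    then obtain d where d: "d \<in> B" "D = tchart B d" by (elim tatlasE)
    have eq: "W \<inter> cdom c \<inter> X -` cdom D = (W \<inter> cdom d) \<inter> cdom c"
      using X(2,3) d(2) by auto
    note op = atlas_openD[OF atlas_open_Int_cdom[OF B W d(1)] c]
    show "open (cmap c ` (W \<inter> cdom c \<inter> X -` cdom D))" unfolding eq by (rule op)
    have 1: "Ck_on k (cmap c ` (W \<inter> cdom d \<inter> cdom c)) (\<lambda>x. cmap d (cinv c x))"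
      using Ck_mfunD[OF Ck_mfun_subset[OF Ck_mfun_infty_imp[OF Ck_mfun_cmap[OF B d(1)]], of "W \<inter> cdom d"] c] by simp
    show "Ck_on k (cmap c ` (W \<inter> cdom c \<inter> X -` cdom D)) (cmap D \<circ> X \<circ> cinv c)"
      unfolding eq
    proof (rule Ck_on_cong[OF op _ Ck_on_Pair[OF op 1 Ck_mfunD[OF sm[OF d(1)] c]]])
      fix x assume "x \<in> cmap c ` (W \<inter> cdom d \<inter> cdom c)"
      then have "cinv c x \<in> W" using cinv_in_subset(1)[OF B c, of x "W \<inter> cdom d"] by blast
      then show "(cmap d (cinv c x), snd (X (cinv c x)) d) = (cmap D \<circ> X \<circ> cinv c) x"
        using X(3) d(2) by simp
    qed
  qed
  then show ?thesis using X by (auto simp: vfields_def)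
qed

lemma vfieldsD:
  assumes "X \<in> vfields k B W"
  shows "X \<in> extensional W" "\<And>p. p \<in> W \<Longrightarrow> X p \<in> TB B" "\<And>p. p \<in> W \<Longrightarrow> fst (X p) = p"
  using assms by (auto simp: vfields_def)

lemma vfields_smooth:
  assumes B: "smooth_atlas B" and W: "atlas_open B W" and X: "X \<in> vfields k B W" and d: "d \<in> B"
  shows "Ck_mfun k B (W \<inter> cdom d) (\<lambda>p. snd (X p) d)"
proof (rule Ck_mfunI)
  fix c assume c: "c \<in> B"
  have eq: "W \<inter> cdom c \<inter> X -` cdom (tchart B d) = (W \<inter> cdom d) \<inter> cdom c"
    using vfieldsD[OF X] by auto
  have "Ck_on k (cmap c ` (W \<inter> cdom c \<inter> X -` cdom (tchart B d))) (cmap (tchart B d) \<circ> X \<circ> cinv c)"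
    by (rule Ck_mapD[OF _ c tchart_in[OF d]]) (use X in \<open>simp add: vfields_def\<close>)
  then have 1: "Ck_on k (cmap c ` (W \<inter> cdom d \<inter> cdom c)) (cmap (tchart B d) \<circ> X \<circ> cinv c)"
    unfolding eq .
  show "Ck_on k (cmap c ` (W \<inter> cdom d \<inter> cdom c)) (\<lambda>x. snd (X (cinv c x)) d)"
    using Ck_on_compose_linear[OF bounded_linear_snd atlas_openD[OF atlas_open_Int_cdom[OF B W d] c] 1]
    by simp
qed

text \<open>Components in another chart arise by applying the Jacobian, a smooth family of linear maps. The
  map \<open>Y\<close> may live on another manifold than its values' base points; this covers vector fields and
  sections of the pullback bundle.\<close>

lemma Ck_mfun_change_comp:
  assumes B: "smooth_atlas B" and N: "atlas_open B N" and A: "smooth_atlas A" "c \<in> A" "d \<in> A"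
    and q: "\<And>u. u \<in> N \<Longrightarrow> fst (Y u) \<in> cdom c" "Ck_mfun k B N (\<lambda>u. cmap c (fst (Y u)))"
      "atlas_open B {u \<in> N. fst (Y u) \<in> cdom d}"
    and Y: "\<And>u. u \<in> N \<Longrightarrow> Y u \<in> TB A" "Ck_mfun k B N (\<lambda>u. snd (Y u) c)"
  shows "Ck_mfun k B {u \<in> N. fst (Y u) \<in> cdom d} (\<lambda>u. snd (Y u) d)"
proof (rule Ck_mfun_cong[OF B q(3)])
  show "Ck_mfun k B {u \<in> N. fst (Y u) \<in> cdom d}
      (\<lambda>u. fd (chg c d) (cmap c (fst (Y u))) (snd (Y u) c))"
    by (rule Ck_mfun_chg[OF B q(3) A]) (use q(1) in \<open>auto intro: Ck_mfun_subset[OF q(2)] Ck_mfun_subset[OF Y(2)]\<close>)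
  show "fd (chg c d) (cmap c (fst (Y u))) (snd (Y u) c) = snd (Y u) d"
    if "u \<in> {u \<in> N. fst (Y u) \<in> cdom d}" for u
    using TB_comp[OF Y(1) A(2,3), of u] q(1) that by simp
qed

text \<open>Coordinate changes act smoothly on components, so one chart near each point decides.\<close>

lemma vfieldsI_local:
  assumes B: "smooth_atlas B" and W: "atlas_open B W" and X: "X \<in> extensional W"
    "\<And>p. p \<in> W \<Longrightarrow> X p \<in> TB B" "\<And>p. p \<in> W \<Longrightarrow> fst (X p) = p"
    and sm: "\<And>p. p \<in> W \<Longrightarrow> \<exists>c\<in>B. \<exists>N. atlas_open B N \<and> p \<in> N \<and> N \<subseteq> W \<inter> cdom c \<and>
      Ck_mfun k B N (\<lambda>p. snd (X p) c)"
  shows "X \<in> vfields k B W"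
proof (rule vfieldsI[OF B W X])
  fix d assume d: "d \<in> B"
  show "Ck_mfun k B (W \<inter> cdom d) (\<lambda>p. snd (X p) d)"
  proof (rule Ck_mfun_local)
    fix p assume p: "p \<in> W \<inter> cdom d"
    then obtain c N where c: "c \<in> B" and N: "atlas_open B N" "p \<in> N" "N \<subseteq> W \<inter> cdom c"
      "Ck_mfun k B N (\<lambda>p. snd (X p) c)" using sm[of p] by blast
    have fstX: "fst (X u) = u" if "u \<in> N" for u using X(3) N(3) that by auto
    have eq: "{u \<in> N. fst (X u) \<in> cdom d} = N \<inter> cdom d" using fstX by auto
    have cm: "Ck_mfun k B N (\<lambda>u. cmap c (fst (X u)))"
      by (rule Ck_mfun_cong[OF B N(1) _ Ck_mfun_subset[OF Ck_mfun_infty_imp[OF Ck_mfun_cmap[OF B c]]]])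
        (use fstX N(3) in auto)
    have "Ck_mfun k B {u \<in> N. fst (X u) \<in> cdom d} (\<lambda>u. snd (X u) d)"
      by (rule Ck_mfun_change_comp[OF B N(1) B c d _ cm _ _ N(4)])
        (use N(3) fstX X(2) atlas_open_Int_cdom[OF B N(1) d] eq in auto)
    then show "\<exists>N. atlas_open B N \<and> p \<in> N \<and> Ck_mfun k B N (\<lambda>p. snd (X p) d)"
      unfolding eq using atlas_open_Int_cdom[OF B N(1) d] N(2) p by blast
  qed
qed

subsection \<open>Functions pulled back from the base\<close>

abbreviation slit_over :: "('m, 'e::euclidean_space) chart set \<Rightarrow> 'm set \<Rightarrow> ('m, 'e) tangent set"
  where "slit_over A N \<equiv> {u \<in> slit A. fst u \<in> N}"

lemma atlas_open_slit_over:
  assumes "smooth_atlas A" "atlas_open A N"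
  shows "atlas_open (tatlas A) (slit_over A N)"
proof -
  have "slit_over A N = slit A \<inter> {u \<in> TB A. fst u \<in> N}" by (auto simp: slit_def)
  then show ?thesis
    using atlas_open_Int[OF smooth_atlas_tatlas[OF assms(1)] atlas_open_slit[OF assms(1)]
        atlas_open_pullback[OF assms]] by simp
qed

lemma slit_Int_tchart: "slit A \<inter> cdom (tchart A c) = slit_over A (cdom c)"
  by (auto simp: slit_def)

lemma Ck_mfun_pullback:
  assumes A: "smooth_atlas A" and N: "atlas_open A N" and f: "Ck_mfun k A N f"
  shows "Ck_mfun k (tatlas A) {u \<in> TB A. fst u \<in> N} (\<lambda>u. f (fst u))"
proof (rule Ck_mfunI)
  fix C assume "C \<in> tatlas A"
  then obtain c where c: "c \<in> A" "C = tchart A c" by (rule tatlasE)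
  let ?V = "cmap c ` (N \<inter> cdom c)"
  have op: "open ?V" "open (?V \<times> (UNIV::'b set))"
    using atlas_openD[OF N c(1)] by (auto intro: open_Times)
  have "{u \<in> TB A. fst u \<in> N} \<inter> cdom C = {x \<in> TB A. fst x \<in> N \<inter> cdom c}" using c by auto
  then have im: "cmap C ` ({u \<in> TB A. fst u \<in> N} \<inter> cdom C) = ?V \<times> UNIV"
    using tchart_image[OF A c(1), of N] c(2) by simp
  have "Ck_on k (?V \<times> (UNIV::'b set)) (\<lambda>z. f (cinv c (fst z)))"
    by (rule Ck_on_compose[OF op(2,1) _ Ck_mfunD[OF f c(1)] Ck_on_bounded_linear[OF bounded_linear_fst op(2)]])
      auto
  then show "Ck_on k (cmap C ` ({u \<in> TB A. fst u \<in> N} \<inter> cdom C)) (\<lambda>x. f (fst (cinv C x)))"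
    unfolding im
  proof (rule Ck_on_cong[OF op(2), rotated])
    fix z assume "z \<in> ?V \<times> (UNIV::'b set)"
    then show "f (cinv c (fst z)) = f (fst (cinv C z))"
      using cinv_tchart[OF A c(1), of "fst z" "snd z"] c(2) by auto
  qed
qed

lemma Ck_mfun_pullback_slit:
  assumes A: "smooth_atlas A" and N: "atlas_open A N" and f: "Ck_mfun k A N f"
  shows "Ck_mfun k (tatlas A) (slit_over A N) (\<lambda>u. f (fst u))"
  by (rule Ck_mfun_subset[OF Ck_mfun_pullback[OF assms]]) (auto simp: slit_def)

lemma Ck_mfun_fibre_comp:
  assumes A: "smooth_atlas A" "c \<in> A"
  shows "Ck_mfun \<infinity> (tatlas A) {u \<in> TB A. fst u \<in> cdom c} (\<lambda>u. snd u c)"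
proof -
  have "atlas_open (tatlas A) {u \<in> TB A. fst u \<in> cdom c}"
    by (rule atlas_open_pullback[OF A(1) atlas_open_cdom[OF A]])
  from Ck_mfun_compose_linear[OF bounded_linear_snd this
      Ck_mfun_cmap[OF smooth_atlas_tatlas[OF A(1)] tchart_in[OF A(2)], unfolded tchart_simps(1)]]
  show ?thesis by simp
qed

subsection \<open>Sections of the pullback bundle\<close>

lemma pb_iff: "a \<in> pb A \<longleftrightarrow> fst a \<in> slit A \<and> snd a \<in> TB A \<and> fst (snd a) = fst (fst a)"
  by (cases a) (auto simp: pb_def)

lemma fst_pullback_ops [simp]: "fst (padd a b) = fst a" "fst (pscale r a) = fst a" "fst (psub a b) = fst a"
    "fst (pzero u) = u"
  by (simp_all add: padd_def pscale_def psub_def pzero_def)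

lemma snd_pullback_ops [simp]: "snd (padd a b) = tadd (snd a) (snd b)" "snd (pscale r a) = tscale r (snd a)"
    "snd (pzero u) = tzero (fst u)" "snd (snd (psub a b)) c = snd (snd a) c - snd (snd b) c"
    "fst (snd (psub a b)) = fst (snd a)"
  by (simp_all add: padd_def pscale_def psub_def pzero_def)

lemma pb_eqI:
  assumes "smooth_atlas A" "c \<in> A" "a \<in> pb A" "b \<in> pb A" "fst a = fst b" "fst (fst a) \<in> cdom c"
    "snd (snd a) c = snd (snd b) c"
  shows "a = b"
proof -
  have "snd a = snd b"
    by (rule TB_eqI[OF assms(1,2)]) (use assms in \<open>auto simp: pb_iff\<close>)
  then show ?thesis using assms(5) by (auto simp: prod_eq_iff)
qed

lemma pzero_pb:
  assumes "smooth_atlas A" "u \<in> slit A"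
  shows "pzero u \<in> pb A"
  using tzero_TB[OF assms(1) TB_carrier[OF slit_TB[OF assms(2)]]] assms(2) by (simp add: pb_iff)

lemma carrier_pb_atlas: "carrier_of (pb_atlas A) = pb A"
proof
  show "pb A \<subseteq> carrier_of (pb_atlas A)"
  proof
    fix a assume a: "a \<in> pb A"
    then obtain c where "c \<in> A" "fst (fst a) \<in> cdom c"
      using TB_fst[OF slit_TB, of "fst a" A] by (auto simp: pb_iff)
    then show "a \<in> carrier_of (pb_atlas A)" using a by (auto simp: carrier_of_def pb_atlas_def)
  qed
qed (auto simp: carrier_of_def pb_atlas_def)

lemma pb_sectionsD:
  assumes "s \<in> pb_sections A"
  shows "s \<in> extensional (slit A)" "\<And>u. u \<in> slit A \<Longrightarrow> s u \<in> pb A" "\<And>u. u \<in> slit A \<Longrightarrow> fst (s u) = u"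
  using assms by (auto simp: pb_sections_def)

lemma pb_sections_smooth:
  assumes A: "smooth_atlas A" and s: "s \<in> pb_sections A" and d: "d \<in> A"
  shows "Ck_mfun \<infinity> (tatlas A) (slit_over A (cdom d)) (\<lambda>u. snd (snd (s u)) d)"
proof (rule Ck_mfunI)
  let ?D = "({a \<in> pb A. fst (fst a) \<in> cdom d}, \<lambda>a. (cmap (tchart A d) (fst a), snd (snd a) d))"
  fix C assume C: "C \<in> tatlas A"
  have eq: "slit A \<inter> cdom C \<inter> s -` cdom ?D = slit_over A (cdom d) \<inter> cdom C"
    using pb_sectionsD[OF s] by auto
  have D: "?D \<in> pb_atlas A" using d by (auto simp: pb_atlas_def)
  have cm: "Ck_map \<infinity> (tatlas A) (slit A) (pb_atlas A) s"
    using s unfolding pb_sections_def by simp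
  have "Ck_on \<infinity> (cmap C ` (slit A \<inter> cdom C \<inter> s -` cdom ?D)) (cmap ?D \<circ> s \<circ> cinv C)"
    by (rule Ck_mapD[OF cm C D])
  then have 1: "Ck_on \<infinity> (cmap C ` (slit_over A (cdom d) \<inter> cdom C)) (cmap ?D \<circ> s \<circ> cinv C)"
    unfolding eq .
  show "Ck_on \<infinity> (cmap C ` (slit_over A (cdom d) \<inter> cdom C)) (\<lambda>x. snd (snd (s (cinv C x))) d)"
    using Ck_on_compose_linear[OF bounded_linear_snd
        atlas_openD[OF atlas_open_slit_over[OF A atlas_open_cdom[OF A d]] C] 1]
    by simp
qed

lemma pb_sectionsI:
  assumes A: "smooth_atlas A" and s: "s \<in> extensional (slit A)" "\<And>u. u \<in> slit A \<Longrightarrow> s u \<in> pb A"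
    "\<And>u. u \<in> slit A \<Longrightarrow> fst (s u) = u"
    and sm: "\<And>d. d \<in> A \<Longrightarrow> Ck_mfun \<infinity> (tatlas A) (slit_over A (cdom d)) (\<lambda>u. snd (snd (s u)) d)"
  shows "s \<in> pb_sections A"
proof -
  note TA = smooth_atlas_tatlas[OF A]
  have "Ck_map \<infinity> (tatlas A) (slit A) (pb_atlas A) s"
    unfolding Ck_map_def carrier_pb_atlas
  proof (intro conjI ballI)
    show "s ` slit A \<subseteq> pb A" using s(2) by auto
    fix C D assume C: "C \<in> tatlas A" and "D \<in> pb_atlas A"
    then obtain d where d: "d \<in> A"
      "D = ({a \<in> pb A. fst (fst a) \<in> cdom d}, \<lambda>a. (cmap (tchart A d) (fst a), snd (snd a) d))"
      unfolding pb_atlas_def by blast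
    have eq: "slit A \<inter> cdom C \<inter> s -` cdom D = slit_over A (cdom d) \<inter> cdom C"
      using s(2,3) d(2) by auto
    note op = atlas_openD[OF atlas_open_slit_over[OF A atlas_open_cdom[OF A d(1)]] C]
    show "open (cmap C ` (slit A \<inter> cdom C \<inter> s -` cdom D))" unfolding eq by (rule op)
    have 1: "Ck_on \<infinity> (cmap C ` (slit_over A (cdom d) \<inter> cdom C)) (\<lambda>x. cmap (tchart A d) (cinv C x))"
      by (rule Ck_mfunD[OF Ck_mfun_subset[OF Ck_mfun_cmap[OF TA tchart_in[OF d(1)]]] C])
        (auto simp: slit_def)
    show "Ck_on \<infinity> (cmap C ` (slit A \<inter> cdom C \<inter> s -` cdom D)) (cmap D \<circ> s \<circ> cinv C)"
      unfolding eq
    proof (rule Ck_on_cong[OF op _ Ck_on_Pair[OF op 1 Ck_mfunD[OF sm[OF d(1)] C]]])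
      fix x assume "x \<in> cmap C ` (slit_over A (cdom d) \<inter> cdom C)"
      then have "cinv C x \<in> slit A" using cinv_in_subset(1)[OF TA C, of x "slit_over A (cdom d)"] by blast
      then show "(cmap (tchart A d) (cinv C x), snd (snd (s (cinv C x))) d) = (cmap D \<circ> s \<circ> cinv C) x"
        using s(3) d(2) by simp
    qed
  qed
  then show ?thesis using s by (auto simp: pb_sections_def)
qed

lemma eta_section:
  assumes A: "smooth_atlas A"
  shows "eta A \<in> pb_sections A"
proof (rule pb_sectionsI[OF A])
  fix d assume d: "d \<in> A"
  show "Ck_mfun \<infinity> (tatlas A) (slit_over A (cdom d)) (\<lambda>u. snd (snd (eta A u)) d)"
    by (rule Ck_mfun_cong[OF smooth_atlas_tatlas[OF A] atlas_open_slit_over[OF A atlas_open_cdom[OF A d]] _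
          Ck_mfun_subset[OF Ck_mfun_fibre_comp[OF A d]]]) (auto simp: eta_def slit_def)
qed (auto simp: eta_def pb_iff slit_def)

subsection \<open>Differentials in charts\<close>

text \<open>Chain rule: the differential of a function paired with a tangent vector does not see the chart.\<close>

lemma fd_chart_indep:
  assumes B: "smooth_atlas B" "c \<in> B" "e \<in> B" and x: "x \<in> TB B" "fst x \<in> cdom c" "fst x \<in> cdom e"
    and h: "(h \<circ> cinv c) differentiable (at (cmap c (fst x)))"
  shows "(h \<circ> cinv e) differentiable (at (cmap e (fst x)))"
    "fd (h \<circ> cinv e) (cmap e (fst x)) (snd x e) = fd (h \<circ> cinv c) (cmap c (fst x)) (snd x c)"
proof -
  have eq: "chg e c (cmap e (fst x)) = cmap c (fst x)" using cinv_cmap[OF B(1,3) x(3)] by simp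
  have "((h \<circ> cinv c) has_derivative fd (h \<circ> cinv c) (cmap c (fst x))) (at (chg e c (cmap e (fst x))))"
    unfolding eq using h by (simp add: frechet_derivative_works)
  from diff_chain_at[OF chg_has_derivative[OF B(1,3,2) x(3,2)] this]
  have "((h \<circ> cinv e) has_derivative (fd (h \<circ> cinv c) (cmap c (fst x)) \<circ> fd (chg e c) (cmap e (fst x))))
      (at (cmap e (fst x)))"
  proof (rule has_derivative_transform_open[OF _ open_chg_dom[OF B(1,3,2)]])
    show "cmap e (fst x) \<in> cmap e ` (cdom e \<inter> cdom c)" using x by auto
    show "(h \<circ> cinv c \<circ> chg e c) y = (h \<circ> cinv e) y" if "y \<in> cmap e ` (cdom e \<inter> cdom c)" for y
      using that cinv_cmap[OF B(1,3)] cinv_cmap[OF B(1,2)] by auto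
  qed
  then show "(h \<circ> cinv e) differentiable (at (cmap e (fst x)))"
    "fd (h \<circ> cinv e) (cmap e (fst x)) (snd x e) = fd (h \<circ> cinv c) (cmap c (fst x)) (snd x c)"
    using TB_comp[OF x(1) B(3,2) x(3,2)] by (auto simp: differentiable_def fd_eq)
qed

lemma chart_at:
  assumes "p \<in> carrier_of B"
  shows "chart_at B p \<in> B" "p \<in> cdom (chart_at B p)"
proof -
  have "\<exists>c. c \<in> B \<and> p \<in> cdom c" using assms by (auto simp: carrier_of_def)
  from someI_ex[OF this] show "chart_at B p \<in> B" "p \<in> cdom (chart_at B p)" by (auto simp: chart_at_def)
qed

lemma dfun_chart:
  assumes "smooth_atlas B" "c \<in> B" "x \<in> TB B" "fst x \<in> cdom c"
    and "(h \<circ> cinv c) differentiable (at (cmap c (fst x)))"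
  shows "dfun B h x = fd (h \<circ> cinv c) (cmap c (fst x)) (snd x c)"
  using fd_chart_indep(2)[OF assms(1,2) chart_at(1)[OF TB_carrier[OF assms(3)]] assms(3,4)
      chart_at(2)[OF TB_carrier[OF assms(3)]] assms(5)]
  by (simp add: dfun_def Let_def)

lemma Ck_mfun_differentiable:
  assumes "Ck_mfun \<infinity> B W h" "c \<in> B" "p \<in> W" "p \<in> cdom c"
  shows "(h \<circ> cinv c) differentiable (at (cmap c p))"
  using Ck_on_infty_differentiable[OF Ck_mfunD[OF assms(1,2)], of "cmap c p"] assms(3,4)
  by (auto simp: o_def)

lemma dfun_cong:
  assumes B: "smooth_atlas B" "x \<in> TB B" and N: "atlas_open B N" "fst x \<in> N" "\<And>q. q \<in> N \<Longrightarrow> f q = g q"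
    and f: "Ck_mfun \<infinity> B N f"
  shows "dfun B g x = dfun B f x"
proof -
  let ?c = "chart_at B (fst x)"
  note c = chart_at[OF TB_carrier[OF B(2)]]
  have "fd (g \<circ> cinv ?c) (cmap ?c (fst x)) = fd (f \<circ> cinv ?c) (cmap ?c (fst x))"
  proof (rule fd_cong(2)[OF atlas_openD[OF N(1) c(1)]])
    show "cmap ?c (fst x) \<in> cmap ?c ` (N \<inter> cdom ?c)" using N(2) c(2) by auto
    show "(f \<circ> cinv ?c) y = (g \<circ> cinv ?c) y" if "y \<in> cmap ?c ` (N \<inter> cdom ?c)" for y
      using N(3) cinv_in_subset(1)[OF B(1) c(1) that] by simp
    show "(f \<circ> cinv ?c) differentiable at (cmap ?c (fst x))"
      by (rule Ck_mfun_differentiable[OF f c(1) N(2) c(2)])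
  qed
  then show ?thesis by (simp add: dfun_def Let_def)
qed

section \<open>The pullback formalism in charts\<close>

lemma base_chart:
  assumes "u \<in> TB A"
  shows "\<exists>c\<in>A. chart_at (tatlas A) u = tchart A c \<and> fst u \<in> cdom c"
proof -
  have u: "u \<in> carrier_of (tatlas A)" using assms by (simp add: carrier_tatlas)
  obtain c where c: "c \<in> A" "chart_at (tatlas A) u = tchart A c"
    using chart_at(1)[OF u] by (elim tatlasE)
  then show ?thesis using chart_at(2)[OF u] by auto
qed

lemma projection_has_derivative:
  fixes A :: "('m, 'e::euclidean_space) chart set"
  assumes A: "smooth_atlas A" "c \<in> A" "d \<in> A" and p: "p \<in> cdom c" "p \<in> cdom d"
  shows "((cmap d \<circ> fst \<circ> cinv (tchart A c)) has_derivative (\<lambda>z. fd (chg c d) (cmap c p) (fst z)))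
    (at (cmap c p, y))"
proof -
  have f: "(fst has_derivative fst) (at (cmap c p, y))" by (intro derivative_eq_intros) auto
  have "(chg c d has_derivative fd (chg c d) (cmap c p)) (at (fst (cmap c p, y)))"
    using chg_has_derivative[OF A p] by simp
  from diff_chain_at[OF f this]
  have 1: "((chg c d \<circ> fst) has_derivative (fd (chg c d) (cmap c p) \<circ> fst)) (at (cmap c p, y))" .
  have "((cmap d \<circ> fst \<circ> cinv (tchart A c)) has_derivative (fd (chg c d) (cmap c p) \<circ> fst))
    (at (cmap c p, y))"
  proof (rule has_derivative_transform_open[OF 1])
    show "open (cmap c ` (cdom c \<inter> cdom d) \<times> (UNIV::'e set))"
      by (intro open_Times open_chg_dom[OF A] open_UNIV)
    show "(cmap c p, y) \<in> cmap c ` (cdom c \<inter> cdom d) \<times> UNIV" using p by auto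
    show "(chg c d \<circ> fst) z = (cmap d \<circ> fst \<circ> cinv (tchart A c)) z"
      if "z \<in> cmap c ` (cdom c \<inter> cdom d) \<times> UNIV" for z
      using that cinv_tchart[OF A(1,2), of "fst z" "snd z"] by auto
  qed
  then show ?thesis by (simp add: o_def)
qed

text \<open>The definition of the differential reads \<open>x\<close> only through its component in the chart chosen by
  \<open>chart_at\<close>, whether or not \<open>x\<close> is a tangent vector. This form applies to Lie brackets, which
  are defined chart by chart.\<close>

lemma rho_base_chart:
  assumes A: "smooth_atlas A" and u: "fst x \<in> TB A"
    and c: "c \<in> A" "chart_at (tatlas A) (fst x) = tchart A c" "fst (fst x) \<in> cdom c"
  shows "rho A x = (fst x, tvec A c (fst (fst x)) (fst (snd x (tchart A c))))"
proof -
  have "fd (cmap d \<circ> fst \<circ> cinv (tchart A c)) (cmap (tchart A c) (fst x)) v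
      = fd (chg c d) (cmap c (fst (fst x))) (fst v)" if "d \<in> A" "fst (fst x) \<in> cdom d" for d v
    using fd_eq[OF projection_has_derivative[OF A c(1) that(1) c(3) that(2)]] by simp
  then show ?thesis
    unfolding rho_def tmap_def tvec_def Let_def c(2) by (simp cong: if_cong)
qed

lemma rho_chart:
  assumes A: "smooth_atlas A" and x: "x \<in> TB (tatlas A)" and c: "c \<in> A" "fst (fst x) \<in> cdom c"
  shows "rho A x = (fst x, tvec A c (fst (fst x)) (fst (snd x (tchart A c))))"
proof -
  have u: "fst x \<in> TB A" using TB_carrier[OF x] by (simp add: carrier_tatlas)
  obtain e where e: "e \<in> A" "chart_at (tatlas A) (fst x) = tchart A e" "fst (fst x) \<in> cdom e"
    using base_chart[OF u] by blast
  let ?h = "cmap c \<circ> fst"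
  note d1 = projection_has_derivative[OF A c(1) c(1) c(2) c(2), of "snd (fst x) c"]
  note d2 = projection_has_derivative[OF A e(1) c(1) e(3) c(2), of "snd (fst x) e"]
  have "(?h \<circ> cinv (tchart A c)) differentiable (at (cmap (tchart A c) (fst x)))"
    unfolding tchart_simps using d1 differentiableI by blast
  from fd_chart_indep(2)[OF smooth_atlas_tatlas[OF A] tchart_in[OF c(1)] tchart_in[OF e(1)] x _ _ this]
  have "fd (chg e c) (cmap e (fst (fst x))) (fst (snd x (tchart A e))) = fst (snd x (tchart A c))"
    using fd_eq[OF d1] fd_eq[OF d2] u c(2) e(3) chg_self[OF A c] by simp
  then have "tvec A e (fst (fst x)) (fst (snd x (tchart A e))) = tvec A c (fst (fst x)) (fst (snd x (tchart A c)))"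
    by (intro TB_eqI[OF A c(1) tvec_in_TB[OF A e(1,3)] tvec_in_TB[OF A c]])
      (use c tvec_comp[OF A c] in \<open>simp_all add: tvec_def\<close>)
  then show ?thesis using rho_base_chart[OF A u e] by simp
qed

lemma tangent_at_iff: "x \<in> tangent_at A u \<longleftrightarrow> x \<in> TB (tatlas A) \<and> fst x = u"
  by (auto simp: tangent_at_def)

lemma rho_pb:
  assumes A: "smooth_atlas A" and x: "x \<in> tangent_at A u" "u \<in> slit A"
  shows "rho A x \<in> pb A" "fst (rho A x) = u"
    "\<And>c. c \<in> A \<Longrightarrow> fst u \<in> cdom c \<Longrightarrow> snd (snd (rho A x)) c = fst (snd x (tchart A c))"
proof -
  have x': "x \<in> TB (tatlas A)" "fst x = u" using x by (auto simp: tangent_at_iff)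
  obtain c where c: "c \<in> A" "fst (fst x) \<in> cdom c" using TB_fst[OF slit_TB[OF x(2)]] x' by auto
  show "rho A x \<in> pb A" "fst (rho A x) = u"
    using rho_chart[OF A x'(1) c] tvec_in_TB[OF A c] x x' by (auto simp: pb_iff)
  show "snd (snd (rho A x)) c = fst (snd x (tchart A c))" if "c \<in> A" "fst u \<in> cdom c" for c
    using rho_chart[OF A x'(1) that(1)] tvec_comp[OF A that] x' that by simp
qed

lemma ver_iff:
  assumes A: "smooth_atlas A" and c: "c \<in> A" "fst u \<in> cdom c" and u: "u \<in> slit A"
  shows "x \<in> ver A u \<longleftrightarrow> x \<in> tangent_at A u \<and> fst (snd x (tchart A c)) = 0"
proof (cases "x \<in> tangent_at A u")
  case True
  have "rho A x = pzero u" if "snd (snd (rho A x)) c = 0"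
    using pb_eqI[OF A c(1) rho_pb(1)[OF A True u] pzero_pb[OF A u]] rho_pb(2)[OF A True u] c that by simp
  moreover have "snd (snd (rho A x)) c = 0" if "rho A x = pzero u" unfolding that by simp
  ultimately have "rho A x = pzero u \<longleftrightarrow> snd (snd (rho A x)) c = 0" by blast
  then show ?thesis using rho_pb(3)[OF A True u c] True by (simp add: ver_def)
qed (simp add: ver_def)

text \<open>In the chart the curve is the straight line through \<open>(x, y)\<close> with direction \<open>(0, v)\<close>; its velocity in
  other charts follows by the chain rule.\<close>

lemma gam_tvec:
  assumes A: "smooth_atlas A" and a: "a \<in> pb A" and c: "c \<in> A" "fst (fst a) \<in> cdom c"
  shows "gam A a = tvec (tatlas A) (tchart A c) (fst a) (0, snd (snd a) c)"
proof -
  let ?u = "fst a" and ?v = "snd a"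
  let ?q = "\<lambda>t. tadd ?u (tscale t ?v)"
  have uv: "?u \<in> TB A" "?v \<in> TB A" "fst ?v = fst ?u" using a by (auto simp: pb_iff slit_def)
  have q0: "?q 0 = ?u" by (simp add: tadd_def tscale_def)
  have qTB: "?q t \<in> TB A" for t using uv by (intro tadd_TB[OF A] tscale_TB[OF A]) auto
  have uC: "?u \<in> cdom (tchart A c)" using uv c by simp
  have "vector_derivative (cmap D \<circ> ?q) (at 0) = fd (chg (tchart A c) D) (cmap (tchart A c) ?u) (0, snd ?v c)"
    if D: "D \<in> tatlas A" "?u \<in> cdom D" for D
  proof -
    note TA = smooth_atlas_tatlas[OF A]
    obtain d where d: "d \<in> A" "D = tchart A d" using D(1) by (rule tatlasE)
    have "((\<lambda>t. (cmap c (fst ?u), snd ?u c + t *\<^sub>R snd ?v c)) has_vector_derivative (0, snd ?v c)) (at 0)"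
      by (auto intro!: derivative_eq_intros simp: has_vector_derivative_def)
    then have g: "((cmap (tchart A c) \<circ> ?q) has_vector_derivative (0, snd ?v c)) (at 0)"
      by (simp add: o_def)
    have "(cmap (tchart A c) \<circ> ?q) 0 = cmap (tchart A c) ?u" using q0 by simp
    then have "(chg (tchart A c) D has_derivative fd (chg (tchart A c) D) (cmap (tchart A c) ?u))
        (at ((cmap (tchart A c) \<circ> ?q) 0))"
      using chg_has_derivative[OF TA tchart_in[OF c(1)] D(1) uC D(2)] by simp
    from vector_derivative_diff_chain_within[OF g has_derivative_at_withinI[OF this]]
    have "((chg (tchart A c) D \<circ> (cmap (tchart A c) \<circ> ?q)) has_vector_derivative
        fd (chg (tchart A c) D) (cmap (tchart A c) ?u) (0, snd ?v c)) (at 0)" .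
    moreover have "chg (tchart A c) D \<circ> (cmap (tchart A c) \<circ> ?q) = cmap D \<circ> ?q"
    proof
      fix t
      have "?q t \<in> cdom (tchart A c)" using qTB[of t] c by simp
      then show "(chg (tchart A c) D \<circ> (cmap (tchart A c) \<circ> ?q)) t = (cmap D \<circ> ?q) t"
        using cinv_cmap[OF TA tchart_in[OF c(1)], of "?q t"] by (simp only: o_apply)
    qed
    ultimately show ?thesis using vector_derivative_at by metis
  qed
  then show ?thesis unfolding gam_def velocity_def tvec_def q0
    by (intro arg_cong2[where f = Pair] refl ext) auto
qed

lemma gam_comp:
  assumes A: "smooth_atlas A" and a: "a \<in> pb A"
  shows "gam A a \<in> tangent_at A (fst a)"
    "\<And>c. c \<in> A \<Longrightarrow> fst (fst a) \<in> cdom c \<Longrightarrow> snd (gam A a) (tchart A c) = (0, snd (snd a) c)"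
proof -
  have u: "fst a \<in> TB A" using a by (auto simp: pb_iff slit_def)
  obtain c where c: "c \<in> A" "fst (fst a) \<in> cdom c" using TB_fst[OF u] by auto
  show "gam A a \<in> tangent_at A (fst a)"
    unfolding gam_tvec[OF A a c] tangent_at_iff
    using tvec_in_TB[OF smooth_atlas_tatlas[OF A] tchart_in[OF c(1)], of "fst a"] u c by simp
  show "snd (gam A a) (tchart A c) = (0, snd (snd a) c)" if c: "c \<in> A" "fst (fst a) \<in> cdom c" for c
    unfolding gam_tvec[OF A a c]
    using tvec_comp[OF smooth_atlas_tatlas[OF A] tchart_in[OF c(1)], of "fst a"] u c by simp
qed

section \<open>Cut-off coordinate fields\<close>

lemma atlas_open_vimage:
  assumes B: "smooth_atlas B" "atlas_open B W" and f: "Ck_mfun k B W f" and T: "open T"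
  shows "atlas_open B {p \<in> W. f p \<in> T}"
  unfolding atlas_open_def
proof (intro conjI ballI)
  show "{p \<in> W. f p \<in> T} \<subseteq> carrier_of B" using B(2) by (auto simp: atlas_open_def)
  fix c assume c: "c \<in> B"
  let ?V = "cmap c ` (W \<inter> cdom c)"
  have "enat 0 \<le> k" by (simp add: zero_enat_def[symmetric])
  then have "Cn_on 0 ?V (\<lambda>x. f (cinv c x))" using Ck_mfunD[OF f c] unfolding Ck_on_def by blast
  then have "continuous_on ?V (\<lambda>x. f (cinv c x))" by simp
  then have "\<forall>T. open T \<longrightarrow> open ((\<lambda>x. f (cinv c x)) -` T \<inter> ?V)"
    by (rule iffD1[OF continuous_on_open_vimage[OF atlas_openD[OF B(2) c]]])
  then have "open (?V \<inter> (\<lambda>x. f (cinv c x)) -` T)"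
    using T by (simp add: Int_commute)
  moreover have "cmap c ` ({p \<in> W. f p \<in> T} \<inter> cdom c) = ?V \<inter> (\<lambda>x. f (cinv c x)) -` T"
    using cinv_cmap[OF B(1) c] by auto
  ultimately show "open (cmap c ` ({p \<in> W. f p \<in> T} \<inter> cdom c))" by simp
qed

text \<open>The closed set \<open>K\<close> inside the chart domain lets products with \<open>\<phi>\<close> be extended by 0 to the whole
  manifold. Fields on the slit tangent bundle are cut off along the base only.\<close>

definition cutoff :: "('m, 'e::euclidean_space) chart set \<Rightarrow> ('m, 'e) chart \<Rightarrow> ('m \<Rightarrow> real) \<Rightarrow> bool"
  where "cutoff A c \<phi> \<longleftrightarrow> Ck_mfun \<infinity> A (carrier_of A) \<phi> \<and>
    (\<exists>K\<subseteq>cdom c. atlas_open A (carrier_of A - K) \<and> (\<forall>q. q \<notin> K \<longrightarrow> \<phi> q = 0))"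

text \<open>A bump in the chart is transported to the manifold. The compact ball that supports it is closed in
  the manifold because the manifold is Hausdorff.\<close>

lemma ex_cutoff:
  fixes A :: "('m, 'e::euclidean_space) chart set"
  assumes M: "smooth_manifold A" and c: "c \<in> A" "p \<in> cdom c"
  shows "\<exists>\<phi>. cutoff A c \<phi> \<and> \<phi> p > 0"
proof -
  have A: "smooth_atlas A" and H: "Hausdorff_space (atlas_topology A)"
    using M by (auto simp: smooth_manifold_def)
  let ?U = "cmap c ` cdom c"
  have U: "open ?U" using A c by (auto simp: smooth_atlas_def)
  obtain r where r: "r > 0" "cball (cmap c p) r \<subseteq> ?U" using U c(2) open_contains_cball by blast
  obtain f :: "'e \<Rightarrow> real" where f: "Ck_on \<infinity> UNIV f" "f (cmap c p) > 0"
      "\<forall>x. x \<notin> cball (cmap c p) r \<longrightarrow> f x = 0"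
    using ex_smooth_bump[OF r(1)] by blast
  define K where "K = cinv c ` cball (cmap c p) r"
  define \<phi> where "\<phi> q = (if q \<in> cdom c then f (cmap c q) else 0)" for q
  have K: "K \<subseteq> cdom c" using r(2) cinv_in(1)[of _ c] unfolding K_def by blast
  have top: "openin (atlas_topology A) W \<longleftrightarrow> atlas_open A W" for W
    by (rule openin_atlas_topology[OF A])
  have ts: "topspace (atlas_topology A) = carrier_of A"
  proof
    show "topspace (atlas_topology A) \<subseteq> carrier_of A"
      using openin_topspace[of "atlas_topology A"] unfolding top by (simp add: atlas_open_def)
    show "carrier_of A \<subseteq> topspace (atlas_topology A)"
      using atlas_open_carrier[OF A] unfolding top[symmetric] by (rule openin_subset)
  qed
  have "continuous_map (top_of_set ?U) (atlas_topology A) (cinv c)"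
    unfolding continuous_map_def
  proof (intro conjI allI impI)
    show "cinv c \<in> topspace (top_of_set ?U) \<rightarrow> topspace (atlas_topology A)"
      unfolding ts using cinv_in(1)[of _ c] cdom_carrier[OF c(1)] by auto
    fix W assume "openin (atlas_topology A) W"
    then have W: "atlas_open A W" by (simp add: top)
    have "{x \<in> topspace (top_of_set ?U). cinv c x \<in> W} = cmap c ` (W \<inter> cdom c)"
      using cinv_cmap[OF A c(1)] by auto
    moreover have "openin (top_of_set ?U) (cmap c ` (W \<inter> cdom c))"
      using atlas_openD[OF W c(1)] U by (simp add: openin_open_eq) blast
    ultimately show "openin (top_of_set ?U) {x \<in> topspace (top_of_set ?U). cinv c x \<in> W}" by simp
  qed
  moreover have "compactin (top_of_set ?U) (cball (cmap c p) r)"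
    using r(2) by (simp add: compactin_subtopology)
  ultimately have "compactin (atlas_topology A) K" unfolding K_def
    by (rule image_compactin[rotated])
  then have "closedin (atlas_topology A) K" by (rule compactin_imp_closedin[OF H])
  then have Kop: "atlas_open A (carrier_of A - K)" unfolding closedin_def ts top by simp
  have zero: "\<phi> q = 0" if "q \<notin> K" for q
  proof (cases "q \<in> cdom c")
    case True
    have "cmap c q \<notin> cball (cmap c p) r"
    proof
      assume "cmap c q \<in> cball (cmap c p) r"
      then have "cinv c (cmap c q) \<in> K" unfolding K_def by (rule imageI)
      then show False using that cinv_cmap[OF A c(1) True] by simp
    qed
    then show ?thesis using f(3) True by (simp add: \<phi>_def)
  qed (simp add: \<phi>_def)
  have "Ck_mfun \<infinity> A (carrier_of A) \<phi>"
  proof (rule Ck_mfun_local)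
    fix q assume q: "q \<in> carrier_of A"
    show "\<exists>N. atlas_open A N \<and> q \<in> N \<and> Ck_mfun \<infinity> A N \<phi>"
    proof (cases "q \<in> K")
      case True
      have "Ck_mfun \<infinity> A (cdom c) \<phi>"
        by (rule Ck_mfun_cong[OF A atlas_open_cdom[OF A c(1)] _
              Ck_mfun_compose[OF A atlas_open_cdom[OF A c(1)] open_UNIV _ f(1) Ck_mfun_cmap[OF A c(1)]]])
          (auto simp: \<phi>_def)
      then show ?thesis using atlas_open_cdom[OF A c(1)] K True by blast
    next
      case False
      have "Ck_mfun \<infinity> A (carrier_of A - K) \<phi>"
        by (rule Ck_mfun_cong[OF A Kop _ Ck_mfun_const[where v = 0]]) (use zero in auto)
      then show ?thesis using Kop False q by blast
    qed
  qed
  moreover have "\<phi> p > 0" using f(2) c(2) by (simp add: \<phi>_def)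
  ultimately show ?thesis unfolding cutoff_def using K Kop zero by (intro exI[of _ \<phi>]) auto
qed

lemma cutoff_smooth: "cutoff A c \<phi> \<Longrightarrow> Ck_mfun \<infinity> A (carrier_of A) \<phi>"
  by (simp add: cutoff_def)

lemma cutoff_outside: "cutoff A c \<phi> \<Longrightarrow> q \<notin> cdom c \<Longrightarrow> \<phi> q = 0"
  unfolding cutoff_def by blast

lemma cutoff_cover:
  assumes A: "smooth_atlas A" and cut: "cutoff A c \<phi>" and u: "u \<in> slit A" "fst u \<notin> cdom c"
  shows "\<exists>N. atlas_open A N \<and> fst u \<in> N \<and> (\<forall>q\<in>N. \<phi> q = 0)"
proof -
  obtain K where K: "K \<subseteq> cdom c" "atlas_open A (carrier_of A - K)" "\<forall>q. q \<notin> K \<longrightarrow> \<phi> q = 0"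
    using cut by (auto simp: cutoff_def)
  have "fst u \<in> carrier_of A" by (rule TB_carrier[OF slit_TB[OF u(1)]])
  then show ?thesis using K u(2) by (intro exI[of _ "carrier_of A - K"]) auto
qed

lemma cutoff_slit_smooth:
  assumes A: "smooth_atlas A" "c \<in> A" and cut: "cutoff A c \<phi>"
  shows "Ck_mfun \<infinity> (tatlas A) (slit A) (\<lambda>u. \<phi> (fst u))"
  by (rule Ck_mfun_subset[OF Ck_mfun_pullback_slit[OF A(1) atlas_open_carrier[OF A(1)] cutoff_smooth[OF cut]]])
    (use TB_carrier[OF slit_TB] in auto)

lemma cutoff_extend:
  assumes A: "smooth_atlas A" "c \<in> A" and cut: "cutoff A c \<phi>"
    and g: "Ck_mfun \<infinity> (tatlas A) (slit_over A (cdom c)) g"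
  shows "Ck_mfun \<infinity> (tatlas A) (slit A) (\<lambda>u. if fst u \<in> cdom c then \<phi> (fst u) *\<^sub>R g u else 0)"
proof (rule Ck_mfun_local)
  fix u assume u: "u \<in> slit A"
  let ?g = "\<lambda>u. if fst u \<in> cdom c then \<phi> (fst u) *\<^sub>R g u else 0"
  note TA = smooth_atlas_tatlas[OF A(1)]
  note O = atlas_open_slit_over[OF A(1) atlas_open_cdom[OF A]]
  show "\<exists>N. atlas_open (tatlas A) N \<and> u \<in> N \<and> Ck_mfun \<infinity> (tatlas A) N ?g"
  proof (cases "fst u \<in> cdom c")
    case True
    have "Ck_mfun \<infinity> (tatlas A) (slit_over A (cdom c)) (\<lambda>u. \<phi> (fst u) *\<^sub>R g u)"
      by (rule Ck_mfun_bilinear[OF bounded_bilinear_scaleR O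
            Ck_mfun_subset[OF cutoff_slit_smooth[OF A cut]] g]) auto
    then have "Ck_mfun \<infinity> (tatlas A) (slit_over A (cdom c)) ?g"
      by (rule Ck_mfun_cong[OF TA O, rotated]) auto
    then show ?thesis using O u True by blast
  next
    case False
    obtain N where N: "atlas_open A N" "fst u \<in> N" "\<forall>q\<in>N. \<phi> q = 0"
      using cutoff_cover[OF A(1) cut u False] by blast
    have "Ck_mfun \<infinity> (tatlas A) (slit_over A N) ?g"
      by (rule Ck_mfun_cong[OF TA atlas_open_slit_over[OF A(1) N(1)] _ Ck_mfun_const[where v = 0]])
        (use N in auto)
    then show ?thesis using atlas_open_slit_over[OF A(1) N(1)] u N by blast
  qed
qed

text \<open>The coordinate field \<open>v\<close> of the chart \<open>c\<close>, made global by a cut-off factor.\<close>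

definition coord_field :: "('m, 'e::euclidean_space) chart set \<Rightarrow> ('m, 'e) chart \<Rightarrow> ('m \<Rightarrow> real) \<Rightarrow>
    'e \<times> 'e \<Rightarrow> ('m, 'e) vfield"
  where "coord_field A c \<phi> v = (\<lambda>u\<in>slit A.
    if fst u \<in> cdom c then tvec (tatlas A) (tchart A c) u (\<phi> (fst u) *\<^sub>R v) else tzero u)"

lemma tvec_zero:
  assumes "smooth_atlas B" "c \<in> B" "p \<in> cdom c"
  shows "tvec B c p 0 = tzero p"
  by (rule TB_eqI[OF assms(1,2) tvec_in_TB[OF assms] tzero_TB[OF assms(1) cdom_carrier[OF assms(2,3)]]])
    (use assms in \<open>simp_all add: tvec_comp\<close>)

lemma slit_fieldsI:
  assumes A: "smooth_atlas A" and X: "X \<in> extensional (slit A)"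
    "\<And>u. u \<in> slit A \<Longrightarrow> X u \<in> tangent_at A u"
    and sm: "\<And>u. u \<in> slit A \<Longrightarrow> \<exists>c\<in>A. \<exists>N. atlas_open A N \<and> fst u \<in> N \<and> N \<subseteq> cdom c \<and>
      Ck_mfun \<infinity> (tatlas A) (slit_over A N) (\<lambda>u. snd (X u) (tchart A c))"
  shows "X \<in> slit_fields A"
  unfolding slit_fields_def
proof (rule vfieldsI_local[OF smooth_atlas_tatlas[OF A] atlas_open_slit[OF A] X(1)])
  fix u assume u: "u \<in> slit A"
  then obtain c N where c: "c \<in> A" "atlas_open A N" "fst u \<in> N" "N \<subseteq> cdom c"
      "Ck_mfun \<infinity> (tatlas A) (slit_over A N) (\<lambda>u. snd (X u) (tchart A c))"
    using sm by blast
  show "\<exists>C\<in>tatlas A. \<exists>N. atlas_open (tatlas A) N \<and> u \<in> N \<and> N \<subseteq> slit A \<inter> cdom C \<and>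
      Ck_mfun \<infinity> (tatlas A) N (\<lambda>p. snd (X p) C)"
  proof (intro bexI[OF _ tchart_in[OF c(1)]] exI conjI)
    show "atlas_open (tatlas A) (slit_over A N)" by (rule atlas_open_slit_over[OF A c(2)])
    show "slit_over A N \<subseteq> slit A \<inter> cdom (tchart A c)" using c(4) slit_TB by auto
  qed (use u c in auto)
qed (use X(2) in \<open>auto simp: tangent_at_iff\<close>)

lemma slit_fieldsD:
  assumes "X \<in> slit_fields A"
  shows "X \<in> extensional (slit A)" "\<And>u. u \<in> slit A \<Longrightarrow> X u \<in> tangent_at A u"
    "\<And>u. u \<in> slit A \<Longrightarrow> X u \<in> TB (tatlas A)" "\<And>u. u \<in> slit A \<Longrightarrow> fst (X u) = u"
  using vfieldsD[OF assms[unfolded slit_fields_def]] by (auto simp: tangent_at_iff)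

lemma slit_fields_smooth:
  assumes A: "smooth_atlas A" "c \<in> A" and X: "X \<in> slit_fields A"
  shows "Ck_mfun \<infinity> (tatlas A) (slit_over A (cdom c)) (\<lambda>u. snd (X u) (tchart A c))"
  using vfields_smooth[OF smooth_atlas_tatlas[OF A(1)] atlas_open_slit[OF A(1)] X[unfolded slit_fields_def]
      tchart_in[OF A(2)]] unfolding slit_Int_tchart .

lemma coord_field_slit:
  assumes A: "smooth_atlas A" "c \<in> A" and cut: "cutoff A c \<phi>"
  shows "coord_field A c \<phi> v \<in> slit_fields A"
    and "u \<in> slit A \<Longrightarrow> fst u \<in> cdom c \<Longrightarrow> snd (coord_field A c \<phi> v u) (tchart A c) = \<phi> (fst u) *\<^sub>R v"
    and "u \<in> slit A \<Longrightarrow> \<phi> (fst u) = 0 \<Longrightarrow> coord_field A c \<phi> v u = tzero u"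
proof -
  note TA = smooth_atlas_tatlas[OF A(1)]
  let ?X = "coord_field A c \<phi> v"
  have uC: "u \<in> cdom (tchart A c)" if "u \<in> slit A" "fst u \<in> cdom c" for u
    using that slit_TB by simp
  have comp: "snd (?X u) (tchart A c) = \<phi> (fst u) *\<^sub>R v" if "u \<in> slit A" "fst u \<in> cdom c" for u
    using tvec_comp[OF TA tchart_in[OF A(2)] uC[OF that]] that by (simp add: coord_field_def)
  have zero: "?X u = tzero u" if "u \<in> slit A" "\<phi> (fst u) = 0" for u
    using tvec_zero[OF TA tchart_in[OF A(2)] uC[OF that(1)]] that by (simp add: coord_field_def)
  show "u \<in> slit A \<Longrightarrow> fst u \<in> cdom c \<Longrightarrow> snd (?X u) (tchart A c) = \<phi> (fst u) *\<^sub>R v"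
    "u \<in> slit A \<Longrightarrow> \<phi> (fst u) = 0 \<Longrightarrow> ?X u = tzero u" using comp zero by auto
  show "?X \<in> slit_fields A"
  proof (rule slit_fieldsI[OF A(1)])
    show "?X \<in> extensional (slit A)" by (simp add: coord_field_def)
    fix u assume u: "u \<in> slit A"
    have "tzero u \<in> TB (tatlas A)"
      using tzero_TB[OF TA, of u] slit_TB[OF u] by (simp add: carrier_tatlas)
    then show "?X u \<in> tangent_at A u"
      using u tvec_in_TB[OF TA tchart_in[OF A(2)] uC[OF u]]
      by (simp add: coord_field_def tangent_at_iff)
    show "\<exists>e\<in>A. \<exists>N. atlas_open A N \<and> fst u \<in> N \<and> N \<subseteq> cdom e \<and>
      Ck_mfun \<infinity> (tatlas A) (slit_over A N) (\<lambda>u. snd (?X u) (tchart A e))"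
    proof (cases "fst u \<in> cdom c")
      case True
      note O = atlas_open_cdom[OF A]
      have "Ck_mfun \<infinity> (tatlas A) (slit_over A (cdom c)) (\<lambda>u. \<phi> (fst u) *\<^sub>R v)"
        by (rule Ck_mfun_bilinear[OF bounded_bilinear_scaleR atlas_open_slit_over[OF A(1) O]
              Ck_mfun_subset[OF cutoff_slit_smooth[OF A cut]] Ck_mfun_const]) auto
      then have "Ck_mfun \<infinity> (tatlas A) (slit_over A (cdom c)) (\<lambda>u. snd (?X u) (tchart A c))"
        by (rule Ck_mfun_cong[OF TA atlas_open_slit_over[OF A(1) O], rotated]) (use comp in auto)
      then show ?thesis using A(2) O True by blast
    next
      case False
      obtain N where N: "atlas_open A N" "fst u \<in> N" "\<forall>q\<in>N. \<phi> q = 0"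
        using cutoff_cover[OF A(1) cut u False] by blast
      obtain e where e: "e \<in> A" "fst u \<in> cdom e" using TB_fst[OF slit_TB[OF u]] by blast
      note O = atlas_open_Int_cdom[OF A(1) N(1) e(1)]
      have "Ck_mfun \<infinity> (tatlas A) (slit_over A (N \<inter> cdom e)) (\<lambda>u. snd (?X u) (tchart A e))"
        by (rule Ck_mfun_cong[OF TA atlas_open_slit_over[OF A(1) O] _ Ck_mfun_const[where v = 0]])
          (use N(3) zero in auto)
      then show ?thesis using e O N(2) by blast
    qed
  qed
qed

text \<open>Connections act on global fields, so pointwise statements need an extension of each tangent vector.\<close>

lemma ex_field_through:
  assumes M: "smooth_manifold A" and x: "x \<in> tangent_at A u" "u \<in> slit A"
  shows "\<exists>X\<in>slit_fields A. X u = x"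
proof -
  have A: "smooth_atlas A" using M by (simp add: smooth_manifold_def)
  note TA = smooth_atlas_tatlas[OF A]
  obtain c where c: "c \<in> A" "fst u \<in> cdom c" using TB_fst[OF slit_TB[OF x(2)]] by blast
  obtain \<phi> where \<phi>: "cutoff A c \<phi>" "\<phi> (fst u) > 0" using ex_cutoff[OF M c] by blast
  let ?X = "coord_field A c \<phi> (snd x (tchart A c) /\<^sub>R \<phi> (fst u))"
  note X = slit_fieldsD(3,4)[OF coord_field_slit(1)[OF A c(1) \<phi>(1)] x(2)]
  have x': "x \<in> TB (tatlas A)" "fst x = u" using x(1) by (simp_all add: tangent_at_iff)
  have "snd (?X u) (tchart A c) = snd x (tchart A c)"
    unfolding coord_field_slit(2)[OF A c(1) \<phi>(1) x(2) c(2)] using \<phi>(2) by simp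
  moreover have "fst (?X u) \<in> cdom (tchart A c)" unfolding X(2) using c(2) slit_TB[OF x(2)] by simp
  ultimately have "?X u = x"
    by (intro TB_eqI[OF TA tchart_in[OF c(1)] X(1) x'(1)]) (simp_all only: X(2) x'(2))
  then show ?thesis using coord_field_slit(1)[OF A c(1) \<phi>(1)] by blast
qed

section \<open>Regular connections in charts\<close>

lemma slit_field_add:
  assumes A: "smooth_atlas A" and X: "X \<in> slit_fields A" "Y \<in> slit_fields A"
  shows "(\<lambda>u\<in>slit A. tadd (X u) (Y u)) \<in> slit_fields A"
proof (rule slit_fieldsI[OF A])
  note TA = smooth_atlas_tatlas[OF A]
  fix u assume u: "u \<in> slit A"
  show "(\<lambda>u\<in>slit A. tadd (X u) (Y u)) u \<in> tangent_at A u"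
    using tadd_TB[OF TA slit_fieldsD(3)[OF X(1) u] slit_fieldsD(3)[OF X(2) u]] u
      slit_fieldsD(4)[OF X(1) u] slit_fieldsD(4)[OF X(2) u] by (simp add: tangent_at_iff)
  obtain c where c: "c \<in> A" "fst u \<in> cdom c" using TB_fst[OF slit_TB[OF u]] by blast
  note O = atlas_open_slit_over[OF A atlas_open_cdom[OF A c(1)]]
  have "Ck_mfun \<infinity> (tatlas A) (slit_over A (cdom c))
      (\<lambda>u. snd ((\<lambda>u\<in>slit A. tadd (X u) (Y u)) u) (tchart A c))"
    by (rule Ck_mfun_cong[OF TA O _ Ck_mfun_add[OF O slit_fields_smooth[OF A c(1) X(1)]
            slit_fields_smooth[OF A c(1) X(2)]]]) simp
  then show "\<exists>c\<in>A. \<exists>N. atlas_open A N \<and> fst u \<in> N \<and> N \<subseteq> cdom c \<and> Ck_mfun \<infinity> (tatlas A) (slit_over A N)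
      (\<lambda>u. snd ((\<lambda>u\<in>slit A. tadd (X u) (Y u)) u) (tchart A c))"
    using c atlas_open_cdom[OF A c(1)] by blast
qed simp

lemma slit_field_scale:
  assumes A: "smooth_atlas A" and X: "X \<in> slit_fields A" and f: "Ck_mfun \<infinity> (tatlas A) (slit A) f"
  shows "(\<lambda>u\<in>slit A. tscale (f u) (X u)) \<in> slit_fields A"
proof (rule slit_fieldsI[OF A])
  note TA = smooth_atlas_tatlas[OF A]
  fix u assume u: "u \<in> slit A"
  show "(\<lambda>u\<in>slit A. tscale (f u) (X u)) u \<in> tangent_at A u"
    using tscale_TB[OF TA slit_fieldsD(3)[OF X u]] u slit_fieldsD(4)[OF X u]
    by (simp add: tangent_at_iff)
  obtain c where c: "c \<in> A" "fst u \<in> cdom c" using TB_fst[OF slit_TB[OF u]] by blast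
  note O = atlas_open_slit_over[OF A atlas_open_cdom[OF A c(1)]]
  have f': "Ck_mfun \<infinity> (tatlas A) (slit_over A (cdom c)) f"
    by (rule Ck_mfun_subset[OF f]) auto
  have "Ck_mfun \<infinity> (tatlas A) (slit_over A (cdom c))
      (\<lambda>u. snd ((\<lambda>u\<in>slit A. tscale (f u) (X u)) u) (tchart A c))"
    by (rule Ck_mfun_cong[OF TA O _ Ck_mfun_bilinear[OF bounded_bilinear_scaleR O f'
            slit_fields_smooth[OF A c(1) X]]]) simp
  then show "\<exists>c\<in>A. \<exists>N. atlas_open A N \<and> fst u \<in> N \<and> N \<subseteq> cdom c \<and> Ck_mfun \<infinity> (tatlas A) (slit_over A N)
      (\<lambda>u. snd ((\<lambda>u\<in>slit A. tscale (f u) (X u)) u) (tchart A c))"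
    using c atlas_open_cdom[OF A c(1)] by blast
qed simp

lemma connection_closed:
  "linear_connection A D \<Longrightarrow> X \<in> slit_fields A \<Longrightarrow> s \<in> pb_sections A \<Longrightarrow> D X s \<in> pb_sections A"
  by (simp add: linear_connection_def)

lemma connection_add:
  "linear_connection A D \<Longrightarrow> X \<in> slit_fields A \<Longrightarrow> Y \<in> slit_fields A \<Longrightarrow> s \<in> pb_sections A \<Longrightarrow>
    D (\<lambda>u\<in>slit A. tadd (X u) (Y u)) s = (\<lambda>u\<in>slit A. padd (D X s u) (D Y s u))"
  by (simp add: linear_connection_def)

lemma connection_scale:
  "linear_connection A D \<Longrightarrow> X \<in> slit_fields A \<Longrightarrow> s \<in> pb_sections A \<Longrightarrow>
    Ck_mfun \<infinity> (tatlas A) (slit A) f \<Longrightarrow>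
    D (\<lambda>u\<in>slit A. tscale (f u) (X u)) s = (\<lambda>u\<in>slit A. pscale (f u) (D X s u))"
  by (simp add: linear_connection_def Ck_fun_eq_mfun)

definition field_comb :: "('m, 'e::euclidean_space) chart set \<Rightarrow> 'i set \<Rightarrow>
    ('i \<Rightarrow> ('m, 'e) tangent \<Rightarrow> real) \<Rightarrow> ('i \<Rightarrow> ('m, 'e) vfield) \<Rightarrow> ('m, 'e) vfield"
  where "field_comb A I f X = (\<lambda>u\<in>slit A. (u, \<lambda>d. \<Sum>i\<in>I. f i u *\<^sub>R snd (X i u) d))"

lemma connection_field_comb:
  fixes A :: "('m, 'e::euclidean_space) chart set"
  assumes A: "smooth_atlas A" and D: "linear_connection A D" and Y: "Y \<in> slit_fields A"
    and fin: "finite I" and X: "\<And>i. i \<in> I \<Longrightarrow> X i \<in> slit_fields A"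
    and f: "\<And>i. i \<in> I \<Longrightarrow> Ck_mfun \<infinity> (tatlas A) (slit A) (f i)"
  shows "field_comb A I f X \<in> slit_fields A \<and>
    (\<forall>s\<in>pb_sections A. \<forall>u\<in>slit A. \<forall>d.
      snd (snd (D (field_comb A I f X) s u)) d = (\<Sum>i\<in>I. f i u *\<^sub>R snd (snd (D (X i) s u)) d))"
  using fin X f
proof (induction I rule: finite_induct)
  case empty
  have c: "Ck_mfun \<infinity> (tatlas A) (slit A) (\<lambda>u. 0::real)" by (rule Ck_mfun_const)
  have e: "field_comb A {} f X = (\<lambda>u\<in>slit A. tscale 0 (Y u))"
    unfolding field_comb_def
    by (rule restrict_ext) (simp add: tscale_def slit_fieldsD(4)[OF Y])
  have "snd (snd (D (field_comb A {} f X) s u)) d = 0" if s: "s \<in> pb_sections A" and u: "u \<in> slit A" for s u d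
    unfolding e connection_scale[OF D Y s c] using u by simp
  moreover have "field_comb A {} f X \<in> slit_fields A" unfolding e by (rule slit_field_scale[OF A Y c])
  ultimately show ?case by simp
next
  case (insert i I)
  have IH: "field_comb A I f X \<in> slit_fields A"
    "\<And>s u d. s \<in> pb_sections A \<Longrightarrow> u \<in> slit A \<Longrightarrow>
      snd (snd (D (field_comb A I f X) s u)) d = (\<Sum>i\<in>I. f i u *\<^sub>R snd (snd (D (X i) s u)) d)"
    using insert.IH insert.prems by auto
  have Xi: "X i \<in> slit_fields A" and fi: "Ck_mfun \<infinity> (tatlas A) (slit A) (f i)"
    using insert.prems by auto
  let ?Z = "\<lambda>u\<in>slit A. tscale (f i u) (X i u)"
  have Z: "?Z \<in> slit_fields A" by (rule slit_field_scale[OF A Xi fi])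
  have e: "field_comb A (insert i I) f X = (\<lambda>u\<in>slit A. tadd (?Z u) (field_comb A I f X u))"
    unfolding field_comb_def
  proof (rule restrict_ext)
    fix u assume u: "u \<in> slit A"
    show "(u, \<lambda>d. \<Sum>i\<in>insert i I. f i u *\<^sub>R snd (X i u) d) =
        tadd (?Z u) ((\<lambda>u\<in>slit A. (u, \<lambda>d. \<Sum>i\<in>I. f i u *\<^sub>R snd (X i u) d)) u)"
      using u insert.hyps slit_fieldsD(4)[OF Xi u] by (simp add: tadd_def tscale_def)
  qed
  have "snd (snd (D (field_comb A (insert i I) f X) s u)) d =
      (\<Sum>j\<in>insert i I. f j u *\<^sub>R snd (snd (D (X j) s u)) d)"
    if s: "s \<in> pb_sections A" and u: "u \<in> slit A" for s u d
    unfolding e connection_add[OF D Z IH(1) s] connection_scale[OF D Xi s fi]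
    using u insert.hyps IH(2)[OF s u] by simp
  then show ?case using slit_field_add[OF A Z IH(1)] unfolding e by blast
qed

text \<open>The value of a connection at \<open>u\<close> depends on the field only through its value at \<open>u\<close>. Cut off twice,
  \<open>\<phi>\<^sup>2 X\<close> is the global combination of the fields \<open>\<phi> \<partial>\<^sub>b\<close> with the global coefficients \<open>\<phi> X\<^sub>b\<close>, and
  linearity over functions applies to both descriptions.\<close>

lemma connection_expand:
  fixes A :: "('m, 'e::euclidean_space) chart set"
  assumes A: "smooth_atlas A" "c \<in> A" and D: "linear_connection A D" and cut: "cutoff A c \<phi>"
    and X: "X \<in> slit_fields A" and s: "s \<in> pb_sections A"
    and u: "u \<in> slit A" "fst u \<in> cdom c" "\<phi> (fst u) \<noteq> 0"
  shows "snd (snd (D X s u)) d = (\<Sum>b\<in>Basis. (snd (X u) (tchart A c) \<bullet> b) *\<^sub>R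
      (inverse (\<phi> (fst u)) *\<^sub>R snd (snd (D (coord_field A c \<phi> b) s u)) d))"
proof -
  note TA = smooth_atlas_tatlas[OF A(1)]
  let ?C = "tchart A c"
  define f where "f b w = (if fst w \<in> cdom c then \<phi> (fst w) *\<^sub>R (snd (X w) ?C \<bullet> b) else 0)"
    for b :: "'e \<times> 'e" and w
  let ?Z = "field_comb A Basis f (coord_field A c \<phi>)"
  have f: "Ck_mfun \<infinity> (tatlas A) (slit A) (f b)" for b
    unfolding f_def
    by (rule cutoff_extend[OF A cut Ck_mfun_compose_linear[OF bounded_linear_inner_left
            atlas_open_slit_over[OF A(1) atlas_open_cdom[OF A]] slit_fields_smooth[OF A X]]])
  have Z: "?Z \<in> slit_fields A" and DZ: "snd (snd (D ?Z s u)) d =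
      (\<Sum>b\<in>Basis. f b u *\<^sub>R snd (snd (D (coord_field A c \<phi> b) s u)) d)"
  proof -
    note comb = connection_field_comb[OF A(1) D X finite_Basis, of "coord_field A c \<phi>" f,
        OF coord_field_slit(1)[OF A cut] f]
    show "?Z \<in> slit_fields A" by (rule conjunct1[OF comb])
    show "snd (snd (D ?Z s u)) d =
      (\<Sum>b\<in>Basis. f b u *\<^sub>R snd (snd (D (coord_field A c \<phi> b) s u)) d)"
      by (rule conjunct2[OF comb, rule_format, OF s u(1)])
  qed
  \<comment> \<open>One factor \<open>\<phi>\<close> makes the coefficient functions global, the other one the coordinate fields.\<close>
  have \<phi>: "Ck_mfun \<infinity> (tatlas A) (slit A) (\<lambda>w. \<phi> (fst w) * \<phi> (fst w))"
    by (rule Ck_mfun_bilinear[OF bounded_bilinear_mult atlas_open_slit[OF A(1)]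
          cutoff_slit_smooth[OF A cut] cutoff_slit_smooth[OF A cut]])
  let ?Y = "\<lambda>w\<in>slit A. tscale (\<phi> (fst w) * \<phi> (fst w)) (X w)"
  have "?Z = ?Y"
  proof (rule extensionalityI[of _ "slit A"])
    fix w assume w: "w \<in> slit A"
    show "?Z w = ?Y w"
    proof (cases "fst w \<in> cdom c")
      case True
      have Yw: "?Y w \<in> TB (tatlas A)" "fst (?Y w) = w"
        using slit_fieldsD(3,4)[OF slit_field_scale[OF A(1) X \<phi>] w] by auto
      have "snd (?Z w) ?C = (\<Sum>b\<in>Basis. (\<phi> (fst w) * \<phi> (fst w)) *\<^sub>R ((snd (X w) ?C \<bullet> b) *\<^sub>R b))"
        using w True by (simp add: field_comb_def f_def coord_field_slit(2)[OF A cut] mult_ac)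
      also have "\<dots> = (\<phi> (fst w) * \<phi> (fst w)) *\<^sub>R snd (X w) ?C"
        unfolding scaleR_sum_right[symmetric] euclidean_representation ..
      finally have "snd (?Z w) ?C = snd (?Y w) ?C" using w by simp
      moreover have "fst (?Z w) \<in> cdom ?C"
        unfolding slit_fieldsD(4)[OF Z w] using True slit_TB[OF w] by simp
      ultimately show ?thesis
        by (intro TB_eqI[OF TA tchart_in[OF A(2)] slit_fieldsD(3)[OF Z w] Yw(1)])
          (simp_all only: slit_fieldsD(4)[OF Z w] Yw(2))
    next
      case False
      have "\<phi> (fst w) = 0" by (rule cutoff_outside[OF cut False])
      then show ?thesis using w False slit_fieldsD(4)[OF X w]
        by (simp add: field_comb_def f_def tscale_def)
    qed
  qed (simp_all add: field_comb_def)
  then have "snd (snd (D ?Z s u)) d = (\<phi> (fst u) * \<phi> (fst u)) *\<^sub>R snd (snd (D X s u)) d"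
    using connection_scale[OF D X s \<phi>] u(1) by simp
  then have "(\<phi> (fst u) * \<phi> (fst u)) *\<^sub>R snd (snd (D X s u)) d =
      (\<Sum>b\<in>Basis. f b u *\<^sub>R snd (snd (D (coord_field A c \<phi> b) s u)) d)"
    using DZ by simp
  then have "inverse (\<phi> (fst u) * \<phi> (fst u)) *\<^sub>R ((\<phi> (fst u) * \<phi> (fst u)) *\<^sub>R snd (snd (D X s u)) d) =
      inverse (\<phi> (fst u) * \<phi> (fst u)) *\<^sub>R (\<Sum>b\<in>Basis. f b u *\<^sub>R snd (snd (D (coord_field A c \<phi> b) s u)) d)"
    by (rule arg_cong)
  also have "inverse (\<phi> (fst u) * \<phi> (fst u)) *\<^sub>R ((\<phi> (fst u) * \<phi> (fst u)) *\<^sub>R snd (snd (D X s u)) d)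
      = snd (snd (D X s u)) d"
    unfolding scaleR_scaleR using left_inverse[of "\<phi> (fst u) * \<phi> (fst u)"] u(3)
    by (simp del: inverse_mult_distrib left_inverse)
  finally have "snd (snd (D X s u)) d = (\<Sum>b\<in>Basis. inverse (\<phi> (fst u) * \<phi> (fst u)) *\<^sub>R
      (f b u *\<^sub>R snd (snd (D (coord_field A c \<phi> b) s u)) d))"
    unfolding scaleR_sum_right .
  also have "\<dots> = (\<Sum>b\<in>Basis. (snd (X u) ?C \<bullet> b) *\<^sub>R
      (inverse (\<phi> (fst u)) *\<^sub>R snd (snd (D (coord_field A c \<phi> b) s u)) d))"
  proof (rule sum.cong[OF refl])
    fix b :: "'e \<times> 'e"
    have "inverse (\<phi> (fst u) * \<phi> (fst u)) * f b u = (snd (X u) ?C \<bullet> b) * inverse (\<phi> (fst u))"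
      using u(2,3) by (simp add: f_def field_simps)
    then show "inverse (\<phi> (fst u) * \<phi> (fst u)) *\<^sub>R (f b u *\<^sub>R snd (snd (D (coord_field A c \<phi> b) s u)) d)
        = (snd (X u) ?C \<bullet> b) *\<^sub>R (inverse (\<phi> (fst u)) *\<^sub>R snd (snd (D (coord_field A c \<phi> b) s u)) d)"
      by (simp only: scaleR_scaleR)
  qed
  finally show ?thesis .
qed

text \<open>The connection map in the chart \<open>c\<close>, as a linear map on components. The factor \<open>inverse (\<phi> (fst u))\<close>
  removes the cut-off again, so the choice of \<open>\<phi>\<close> is immaterial where it is not 0.\<close>

definition conn_coord :: "('m, 'e::euclidean_space) chart set \<Rightarrow>
    (('m, 'e) vfield \<Rightarrow> ('m, 'e) pbsection \<Rightarrow> ('m, 'e) pbsection) \<Rightarrow> ('m, 'e) chart \<Rightarrow> ('m \<Rightarrow> real) \<Rightarrow>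
    ('m, 'e) tangent \<Rightarrow> 'e \<times> 'e \<Rightarrow> 'e"
  where "conn_coord A D c \<phi> u \<xi> = (\<Sum>b\<in>Basis. (\<xi> \<bullet> b) *\<^sub>R
      (inverse (\<phi> (fst u)) *\<^sub>R snd (snd (D (coord_field A c \<phi> b) (eta A) u)) c))"

lemma linear_conn_coord: "linear (conn_coord A D c \<phi> u)"
proof (rule linearI)
  show "conn_coord A D c \<phi> u (x + y) = conn_coord A D c \<phi> u x + conn_coord A D c \<phi> u y" for x y
    by (simp only: conn_coord_def inner_add_left scaleR_add_left sum.distrib)
  show "conn_coord A D c \<phi> u (r *\<^sub>R x) = r *\<^sub>R conn_coord A D c \<phi> u x" for r x
    by (simp add: conn_coord_def scaleR_sum_right mult.assoc)
qed

lemma conn_map_field: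
  assumes M: "smooth_manifold A" and x: "x \<in> tangent_at A u" "u \<in> slit A"
  shows "\<exists>X\<in>slit_fields A. X u = x \<and> conn_map A D x = D X (eta A) u"
proof -
  have u: "fst x = u" using x by (simp add: tangent_at_iff)
  have "\<exists>X. X \<in> slit_fields A \<and> X (fst x) = x" using ex_field_through[OF M x] u by auto
  from someI_ex[OF this] show ?thesis unfolding conn_map_def u by blast
qed

lemma conn_map_coord:
  assumes M: "smooth_manifold A" and D: "linear_connection A D" and c: "c \<in> A" and cut: "cutoff A c \<phi>"
    and x: "x \<in> tangent_at A u" and u: "u \<in> slit A" "fst u \<in> cdom c" "\<phi> (fst u) \<noteq> 0"
  shows "snd (snd (conn_map A D x)) c = conn_coord A D c \<phi> u (snd x (tchart A c))"
proof -
  have A: "smooth_atlas A" using M by (simp add: smooth_manifold_def)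
  obtain X where X: "X \<in> slit_fields A" "X u = x" "conn_map A D x = D X (eta A) u"
    using conn_map_field[OF M x u(1), where D = D] by blast
  show ?thesis unfolding X(3) conn_coord_def
    using connection_expand[OF A c D cut X(1) eta_section[OF A] u] X(2) by simp
qed

lemma conn_map_pb:
  assumes M: "smooth_manifold A" and D: "linear_connection A D"
    and x: "x \<in> tangent_at A u" "u \<in> slit A"
  shows "conn_map A D x \<in> pb A" "fst (conn_map A D x) = u"
proof -
  have A: "smooth_atlas A" using M by (simp add: smooth_manifold_def)
  obtain X where X: "X \<in> slit_fields A" "conn_map A D x = D X (eta A) u"
    using conn_map_field[OF M x, where D = D] by blast
  show "conn_map A D x \<in> pb A" "fst (conn_map A D x) = u"
    unfolding X(2) using pb_sectionsD(2,3)[OF connection_closed[OF D X(1) eta_section[OF A]] x(2)] by auto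
qed

text \<open>Tensoriality justifies the arbitrary choice of an extending field in the connection map.\<close>

lemma conn_map_eq:
  assumes M: "smooth_manifold A" and D: "linear_connection A D" and X: "X \<in> slit_fields A" and u: "u \<in> slit A"
  shows "D X (eta A) u = conn_map A D (X u)"
proof -
  have A: "smooth_atlas A" using M by (simp add: smooth_manifold_def)
  obtain c where c: "c \<in> A" "fst u \<in> cdom c" using TB_fst[OF slit_TB[OF u]] by blast
  obtain \<phi> where \<phi>: "cutoff A c \<phi>" "\<phi> (fst u) > 0" using ex_cutoff[OF M c] by blast
  then have \<phi>0: "\<phi> (fst u) \<noteq> 0" by simp
  note Xu = slit_fieldsD(2)[OF X u]
  note DX = connection_closed[OF D X eta_section[OF A]]
  have "snd (snd (D X (eta A) u)) c = snd (snd (conn_map A D (X u))) c"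
    unfolding conn_map_coord[OF M D c(1) \<phi>(1) Xu u c(2) \<phi>0] conn_coord_def
    by (rule connection_expand[OF A c(1) D \<phi>(1) X eta_section[OF A] u c(2) \<phi>0])
  then show ?thesis
    by (intro pb_eqI[OF A c(1) pb_sectionsD(2)[OF DX u] conn_map_pb(1)[OF M D Xu u]])
      (simp_all only: pb_sectionsD(3)[OF DX u] conn_map_pb(2)[OF M D Xu u] c(2))
qed

lemma conn_coord_smooth:
  assumes A: "smooth_atlas A" "c \<in> A" and D: "linear_connection A D" and cut: "cutoff A c \<phi>"
    and N: "atlas_open A N" "N \<subseteq> {q \<in> cdom c. \<phi> q \<noteq> 0}"
    and g: "Ck_mfun \<infinity> (tatlas A) (slit_over A N) g"
  shows "Ck_mfun \<infinity> (tatlas A) (slit_over A N) (\<lambda>u. conn_coord A D c \<phi> u (g u))"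
proof (rule Ck_mfun_linear_family[OF smooth_atlas_tatlas[OF A(1)] atlas_open_slit_over[OF A(1) N(1)]
      linear_conn_coord _ g])
  note TA = smooth_atlas_tatlas[OF A(1)] and O = atlas_open_slit_over[OF A(1) N(1)]
  have p: "Ck_mfun \<infinity> (tatlas A) (slit_over A N) (\<lambda>u. \<phi> (fst u))"
    by (rule Ck_mfun_subset[OF cutoff_slit_smooth[OF A cut]]) auto
  have i: "Ck_mfun \<infinity> (tatlas A) (slit_over A N) (\<lambda>u. inverse (\<phi> (fst u)))"
  proof (rule Ck_mfun_linear_system[OF TA O, where T = "\<lambda>u v. \<phi> (fst u) * v" and h = "\<lambda>u. 1", rotated 2])
    show "Ck_mfun \<infinity> (tatlas A) (slit_over A N) (\<lambda>u. \<phi> (fst u) * b)" for b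
      by (rule Ck_mfun_bilinear[OF bounded_bilinear_mult O p Ck_mfun_const])
  qed (use N(2) Ck_mfun_const in \<open>auto intro: linearI simp: algebra_simps\<close>)
  show "Ck_mfun \<infinity> (tatlas A) (slit_over A N) (\<lambda>u. conn_coord A D c \<phi> u \<xi>)" for \<xi>
  proof -
    have t: "Ck_mfun \<infinity> (tatlas A) (slit_over A N) (\<lambda>u. (\<xi> \<bullet> b) *\<^sub>R
      (inverse (\<phi> (fst u)) *\<^sub>R snd (snd (D (coord_field A c \<phi> b) (eta A) u)) c))" for b
    proof (intro Ck_mfun_compose_linear[OF bounded_linear_scaleR_right O]
        Ck_mfun_bilinear[OF bounded_bilinear_scaleR O i])
      show "Ck_mfun \<infinity> (tatlas A) (slit_over A N) (\<lambda>u. snd (snd (D (coord_field A c \<phi> b) (eta A) u)) c)"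
        by (rule Ck_mfun_subset[OF pb_sections_smooth[OF A(1) connection_closed[OF D
                coord_field_slit(1)[OF A cut] eta_section[OF A(1)]] A(2)]]) (use N(2) in auto)
    qed
    have "Ck_mfun \<infinity> (tatlas A) (slit_over A N) (\<lambda>u. \<Sum>b\<in>B. (\<xi> \<bullet> b) *\<^sub>R
      (inverse (\<phi> (fst u)) *\<^sub>R snd (snd (D (coord_field A c \<phi> b) (eta A) u)) c))" if "finite B" for B
      using that
    proof (induction B rule: finite_induct)
      case empty
      then show ?case using Ck_mfun_const by simp
    next
      case (insert b B)
      show ?case using Ck_mfun_add[OF O t[of b] insert.IH] insert.hyps by simp
    qed
    then show ?thesis unfolding conn_coord_def by simp
  qed
qed

lemma hor_iff_conn_coord:
  assumes M: "smooth_manifold A" and D: "linear_connection A D" and x: "x \<in> tangent_at A u" and u: "u \<in> slit A"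
    and c: "c \<in> A" "fst u \<in> cdom c" and \<phi>: "cutoff A c \<phi>" "\<phi> (fst u) \<noteq> 0"
  shows "x \<in> hor A D u \<longleftrightarrow> conn_coord A D c \<phi> u (snd x (tchart A c)) = 0"
proof -
  have A: "smooth_atlas A" using M by (simp add: smooth_manifold_def)
  have "conn_map A D x = pzero u" if "snd (snd (conn_map A D x)) c = 0"
    using pb_eqI[OF A c(1) conn_map_pb(1)[OF M D x u] pzero_pb[OF A u]] conn_map_pb(2)[OF M D x u] c that
    by simp
  moreover have "snd (snd (conn_map A D x)) c = 0" if "conn_map A D x = pzero u" unfolding that by simp
  ultimately show ?thesis
    using x unfolding hor_def conn_map_coord[OF M D c(1) \<phi>(1) x u c(2) \<phi>(2)] by blast
qed

section \<open>The horizontal map\<close>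

lemma regular_linear: "regular_connection A D \<Longrightarrow> linear_connection A D"
  by (simp add: regular_connection_def)

lemma tvec_tangent_at:
  assumes A: "smooth_atlas A" and c: "c \<in> A" "fst u \<in> cdom c" and u: "u \<in> TB A"
  shows "tvec (tatlas A) (tchart A c) u z \<in> tangent_at A u"
    "snd (tvec (tatlas A) (tchart A c) u z) (tchart A c) = z"
proof -
  have uC: "u \<in> cdom (tchart A c)" using u c by simp
  show "tvec (tatlas A) (tchart A c) u z \<in> tangent_at A u"
    "snd (tvec (tatlas A) (tchart A c) u z) (tchart A c) = z"
    using tvec_in_TB[OF smooth_atlas_tatlas[OF A] tchart_in[OF c(1)] uC]
      tvec_comp[OF smooth_atlas_tatlas[OF A] tchart_in[OF c(1)] uC] by (simp_all add: tangent_at_iff)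
qed

text \<open>Regularity in coordinates: a vertical vector that is also horizontal is 0.\<close>

lemma conn_coord_vertical_inj:
  assumes M: "smooth_manifold A" and D: "regular_connection A D" and u: "u \<in> slit A"
    and c: "c \<in> A" "fst u \<in> cdom c" and \<phi>: "cutoff A c \<phi>" "\<phi> (fst u) \<noteq> 0"
    and z: "conn_coord A D c \<phi> u (0, w) = 0"
  shows "w = 0"
proof -
  have A: "smooth_atlas A" using M by (simp add: smooth_manifold_def)
  let ?x = "tvec (tatlas A) (tchart A c) u (0, w)"
  note x = tvec_tangent_at[OF A c slit_TB[OF u]]
  have "?x \<in> ver A u" using ver_iff[OF A c u] x by simp
  moreover have "?x \<in> hor A D u"
    using hor_iff_conn_coord[OF M regular_linear[OF D] x(1) u c \<phi>] x(2) z by simp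
  ultimately have "?x \<in> {tzero u}" using D u unfolding regular_connection_def by blast
  then have "?x = tzero u" by simp
  then have "snd ?x (tchart A c) = 0" by simp
  then show ?thesis using x(2)[of "(0, w)"] by (simp add: zero_prod_def)
qed

text \<open>A lift of \<open>a\<close> to the double tangent space decomposes into a vertical and a horizontal part. The
  horizontal part still projects to \<open>a\<close>, so \<open>\<rho>\<close> maps the horizontal vectors onto the bundle and its
  inverse there behaves as expected.\<close>

lemma hmap_hor:
  assumes M: "smooth_manifold A" and D: "regular_connection A D" and a: "a \<in> pb A"
  shows "hmap A D a \<in> hor A D (fst a)" "rho A (hmap A D a) = a"
proof -
  have A: "smooth_atlas A" using M by (simp add: smooth_manifold_def)
  let ?u = "fst a"
  have u: "?u \<in> slit A" using a by (simp add: pb_iff)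
  obtain c where c: "c \<in> A" "fst ?u \<in> cdom c" using TB_fst[OF slit_TB[OF u]] by blast
  let ?x = "tvec (tatlas A) (tchart A c) ?u (snd (snd a) c, 0)"
  note x = tvec_tangent_at[OF A c slit_TB[OF u]]
  obtain v h where vh: "v \<in> ver A ?u" "h \<in> hor A D ?u" "?x = tadd v h"
    using D u x(1) unfolding regular_connection_def by blast
  have h: "h \<in> tangent_at A ?u" using vh(2) by (simp add: hor_def)
  have sum: "snd ?x (tchart A c) = snd v (tchart A c) + snd h (tchart A c)" unfolding vh(3) by simp
  have "fst (snd v (tchart A c)) = 0" using vh(1) ver_iff[OF A c u] by simp
  then have "fst (snd h (tchart A c)) = snd (snd a) c"
    using arg_cong[OF sum, of fst] unfolding x(2) by simp
  then have "rho A h = a"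
    by (intro pb_eqI[OF A c(1) rho_pb(1)[OF A h u] a])
      (simp_all add: rho_pb(2)[OF A h u] rho_pb(3)[OF A h u c] c(2))
  then have im: "a \<in> rho A ` (\<Union>u\<in>slit A. hor A D u)" using vh(2) u by blast
  show r: "rho A (hmap A D a) = a" unfolding hmap_def by (rule f_inv_into_f[OF im])
  have "hmap A D a \<in> (\<Union>u\<in>slit A. hor A D u)" unfolding hmap_def by (rule inv_into_into[OF im])
  then obtain w where w: "w \<in> slit A" "hmap A D a \<in> hor A D w" by blast
  then have "fst (hmap A D a) = w" by (simp add: hor_def tangent_at_iff)
  moreover have "fst (rho A (hmap A D a)) = fst (hmap A D a)" by (simp add: rho_def)
  ultimately show "hmap A D a \<in> hor A D ?u" using w r by simp
qed

lemma hmap_tangent: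
  assumes M: "smooth_manifold A" and D: "regular_connection A D" and a: "a \<in> pb A"
  shows "hmap A D a \<in> tangent_at A (fst a)"
    "\<And>c. c \<in> A \<Longrightarrow> fst (fst a) \<in> cdom c \<Longrightarrow> fst (snd (hmap A D a) (tchart A c)) = snd (snd a) c"
proof -
  have A: "smooth_atlas A" using M by (simp add: smooth_manifold_def)
  show t: "hmap A D a \<in> tangent_at A (fst a)" using hmap_hor(1)[OF assms] by (simp add: hor_def)
  show "fst (snd (hmap A D a) (tchart A c)) = snd (snd a) c" if "c \<in> A" "fst (fst a) \<in> cdom c" for c
    using rho_pb(3)[OF A t _ that] hmap_hor(2)[OF assms] a by (simp add: pb_iff)
qed

text \<open>In a chart the lift of \<open>s\<close> is \<open>(s, w)\<close>, where horizontality is the linear system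
  \<open>K(0, w) = -K(s, 0)\<close> for \<open>w\<close>. Its coefficients are smooth and it is injective by regularity.\<close>

lemma hmap_smooth:
  assumes M: "smooth_manifold A" and D: "regular_connection A D" and s: "s \<in> pb_sections A"
  shows "(\<lambda>u\<in>slit A. hmap A D (s u)) \<in> slit_fields A"
proof -
  have A: "smooth_atlas A" using M by (simp add: smooth_manifold_def)
  note TA = smooth_atlas_tatlas[OF A] and Dl = regular_linear[OF D]
  note su = pb_sectionsD(2,3)[OF s]
  show ?thesis
  proof (rule slit_fieldsI[OF A])
    fix u assume u: "u \<in> slit A"
    show "(\<lambda>u\<in>slit A. hmap A D (s u)) u \<in> tangent_at A u"
      using hmap_tangent(1)[OF M D su(1)[OF u]] su(2)[OF u] u by simp
    obtain c where c: "c \<in> A" "fst u \<in> cdom c" using TB_fst[OF slit_TB[OF u]] by blast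
    obtain \<phi> where \<phi>: "cutoff A c \<phi>" "\<phi> (fst u) > 0" using ex_cutoff[OF M c] by blast
    define N where "N = {q \<in> cdom c. \<phi> q \<in> - {0}}"
    have N: "atlas_open A N" unfolding N_def
      by (rule atlas_open_vimage[OF A atlas_open_cdom[OF A c(1)]
            Ck_mfun_subset[OF cutoff_smooth[OF \<phi>(1)]]]) (use cdom_carrier[OF c(1)] in auto)
    have Nc: "N \<subseteq> {q \<in> cdom c. \<phi> q \<noteq> 0}" by (auto simp: N_def)
    note O = atlas_open_slit_over[OF A N]
    define z where "z w = snd (hmap A D (s w)) (tchart A c)" for w
    have fz: "fst (z w) = snd (snd (s w)) c" if "w \<in> slit_over A N" for w
      unfolding z_def using hmap_tangent(2)[OF M D su(1) c(1), of w] su(2)[of w] that Nc by auto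
    have sc: "Ck_mfun \<infinity> (tatlas A) (slit_over A N) (\<lambda>w. snd (snd (s w)) c)"
      by (rule Ck_mfun_subset[OF pb_sections_smooth[OF A s c(1)]]) (use Nc in auto)
    have kz: "conn_coord A D c \<phi> w (z w) = 0" if w: "w \<in> slit_over A N" for w
    proof -
      have w': "w \<in> slit A" "fst w \<in> cdom c" "\<phi> (fst w) \<noteq> 0" using w Nc by auto
      have "hmap A D (s w) \<in> hor A D w" using hmap_hor(1)[OF M D su(1)[OF w'(1)]] su(2)[OF w'(1)] by simp
      moreover have "hmap A D (s w) \<in> tangent_at A w"
        using hmap_tangent(1)[OF M D su(1)[OF w'(1)]] su(2)[OF w'(1)] by simp
      ultimately show ?thesis
        using hor_iff_conn_coord[OF M Dl _ w'(1) c(1) w'(2) \<phi>(1) w'(3)] unfolding z_def by blast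
    qed
    have eq: "conn_coord A D c \<phi> w (0, snd (z w)) = - conn_coord A D c \<phi> w (snd (snd (s w)) c, 0)"
      if w: "w \<in> slit_over A N" for w
    proof -
      have zw: "(snd (snd (s w)) c, 0) + (0, snd (z w)) = z w" using fz[OF w] by (simp add: prod_eq_iff)
      have "conn_coord A D c \<phi> w (snd (snd (s w)) c, 0) + conn_coord A D c \<phi> w (0, snd (z w)) = 0"
        unfolding linear_add[OF linear_conn_coord, symmetric] zw by (rule kz[OF w])
      then show ?thesis by (simp add: eq_neg_iff_add_eq_0 add.commute)
    qed
    have sz: "Ck_mfun \<infinity> (tatlas A) (slit_over A N) (\<lambda>w. snd (z w))"
    proof (rule Ck_mfun_linear_system[OF TA O, where T = "\<lambda>w v. conn_coord A D c \<phi> w (0, v)"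
          and h = "\<lambda>w. - conn_coord A D c \<phi> w (snd (snd (s w)) c, 0)"])
      show "linear (\<lambda>v. conn_coord A D c \<phi> w (0, v))" for w
      proof (rule linearI)
        show "conn_coord A D c \<phi> w (0, a + b) = conn_coord A D c \<phi> w (0, a) + conn_coord A D c \<phi> w (0, b)"
          for a b using linear_add[OF linear_conn_coord, of A D c \<phi> w "(0, a)" "(0, b)"] by simp
        show "conn_coord A D c \<phi> w (0, r *\<^sub>R b) = r *\<^sub>R conn_coord A D c \<phi> w (0, b)"
          for r b using linear_cmul[OF linear_conn_coord, of A D c \<phi> w r "(0, b)"] by simp
      qed
      show "v = 0" if "w \<in> slit_over A N" "conn_coord A D c \<phi> w (0, v) = 0" for w v
        using conn_coord_vertical_inj[OF M D _ c(1) _ \<phi>(1) _ that(2)] that(1) Nc by auto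
      show "Ck_mfun \<infinity> (tatlas A) (slit_over A N) (\<lambda>w. conn_coord A D c \<phi> w (0, b))" for b
        by (rule conn_coord_smooth[OF A c(1) Dl \<phi>(1) N Nc Ck_mfun_const])
      show "Ck_mfun \<infinity> (tatlas A) (slit_over A N) (\<lambda>w. - conn_coord A D c \<phi> w (snd (snd (s w)) c, 0))"
        by (intro Ck_mfun_compose_linear[OF bounded_linear_minus[OF bounded_linear_ident] O]
            conn_coord_smooth[OF A c(1) Dl \<phi>(1) N Nc] Ck_mfun_Pair[OF O sc] Ck_mfun_const)
    qed (rule eq)
    have "Ck_mfun \<infinity> (tatlas A) (slit_over A N)
        (\<lambda>w. snd ((\<lambda>u\<in>slit A. hmap A D (s u)) w) (tchart A c))"
      by (rule Ck_mfun_cong[OF TA O _ Ck_mfun_Pair[OF O sc sz]])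
        (use fz in \<open>auto simp: z_def prod_eq_iff\<close>)
    moreover have "fst u \<in> N" "N \<subseteq> cdom c" using c(2) \<phi>(2) by (auto simp: N_def)
    ultimately show "\<exists>c\<in>A. \<exists>N. atlas_open A N \<and> fst u \<in> N \<and> N \<subseteq> cdom c \<and>
        Ck_mfun \<infinity> (tatlas A) (slit_over A N)
          (\<lambda>w. snd ((\<lambda>u\<in>slit A. hmap A D (s u)) w) (tchart A c))"
      using c(1) N by blast
  qed simp
qed

section \<open>Second derivatives\<close>

lemma has_field_derivative_line:
  assumes "(f has_derivative f') (at (z + t *\<^sub>R v))"
  shows "((\<lambda>t. f (z + t *\<^sub>R v)) has_field_derivative (f' v :: real)) (at t)"
proof -
  have l: "((\<lambda>t. z + t *\<^sub>R v) has_derivative (\<lambda>h. h *\<^sub>R v)) (at t)"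
    by (auto intro!: derivative_eq_intros)
  have "((\<lambda>t. f (z + t *\<^sub>R v)) has_derivative (\<lambda>h. f' (h *\<^sub>R v))) (at t)"
    using diff_chain_at[OF l assms] by (simp add: o_def)
  moreover have "f' (h *\<^sub>R v) = f' v * h" for h
    using linear_cmul[OF has_derivative_linear[OF assms]] by simp
  ultimately show ?thesis by (simp add: has_field_derivative_def)
qed

text \<open>The mean value theorem, first along \<open>u\<close> and then along \<open>v\<close>, expresses the second difference by a
  mixed derivative at a nearby point. The left-hand side is symmetric in \<open>u\<close> and \<open>v\<close>.\<close>

lemma second_difference:
  fixes g :: "'a::real_normed_vector \<Rightarrow> real"
  assumes S: "ball x \<delta> \<subseteq> S" and g: "Ck_on \<infinity> S g" and h: "h > 0" "h * (norm u + norm v) < \<delta>"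
  shows "\<exists>y\<in>ball x \<delta>. g (x + h *\<^sub>R u + h *\<^sub>R v) - g (x + h *\<^sub>R u) - g (x + h *\<^sub>R v) + g x
    = h * h * fd (\<lambda>z. fd g z u) y v"
proof -
  have inb: "x + s *\<^sub>R u + t *\<^sub>R v \<in> ball x \<delta>" if "0 \<le> s" "s \<le> h" "0 \<le> t" "t \<le> h" for s t
  proof -
    have "norm (s *\<^sub>R u + t *\<^sub>R v) \<le> h * norm u + h * norm v"
      by (rule norm_triangle_le) (use that in \<open>auto intro!: add_mono mult_right_mono\<close>)
    moreover have "dist x (x + s *\<^sub>R u + t *\<^sub>R v) = norm (s *\<^sub>R u + t *\<^sub>R v)"
      by (subst dist_commute) (simp add: dist_norm add.assoc)
    ultimately show ?thesis using h(2) by (simp add: distrib_left)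
  qed
  have dg: "(g has_derivative fd g z) (at z)" if "z \<in> ball x \<delta>" for z
    using Ck_on_infty_differentiable[OF g] S that by (auto simp: frechet_derivative_works)
  have ddg: "((\<lambda>z. fd g z u) has_derivative fd (\<lambda>z. fd g z u) z) (at z)" if "z \<in> ball x \<delta>" for z
    using Ck_on_infty_differentiable[OF Ck_on_infty_fd[OF g]] S that
    by (auto simp: frechet_derivative_works)
  have D1: "((\<lambda>s. g (x + h *\<^sub>R v + s *\<^sub>R u) - g (x + s *\<^sub>R u)) has_field_derivative
      (fd g (x + h *\<^sub>R v + s *\<^sub>R u) u - fd g (x + s *\<^sub>R u) u)) (at s)" if s: "0 \<le> s" "s \<le> h" for s
  proof -
    have 1: "(g has_derivative fd g (x + h *\<^sub>R v + s *\<^sub>R u)) (at (x + h *\<^sub>R v + s *\<^sub>R u))"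
      using inb[of s h] s h(1) by (intro dg) (simp add: algebra_simps)
    have 2: "(g has_derivative fd g (x + s *\<^sub>R u)) (at (x + s *\<^sub>R u))"
      using inb[of s 0] s h(1) by (intro dg) simp
    show ?thesis
      by (rule DERIV_diff[OF has_field_derivative_line[OF 1] has_field_derivative_line[OF 2]])
  qed
  obtain \<sigma> where \<sigma>: "0 < \<sigma>" "\<sigma> < h" and e1:
    "(g (x + h *\<^sub>R v + h *\<^sub>R u) - g (x + h *\<^sub>R u)) - (g (x + h *\<^sub>R v + 0 *\<^sub>R u) - g (x + 0 *\<^sub>R u))
      = (h - 0) * (fd g (x + h *\<^sub>R v + \<sigma> *\<^sub>R u) u - fd g (x + \<sigma> *\<^sub>R u) u)"
    using MVT2[OF h(1) D1] by blast
  have D2: "((\<lambda>t. fd g (x + \<sigma> *\<^sub>R u + t *\<^sub>R v) u) has_field_derivative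
      fd (\<lambda>z. fd g z u) (x + \<sigma> *\<^sub>R u + t *\<^sub>R v) v) (at t)" if "0 \<le> t" "t \<le> h" for t
    using has_field_derivative_line[OF ddg[OF inb[of \<sigma> t]]] that \<sigma> by simp
  obtain \<tau> where \<tau>: "0 < \<tau>" "\<tau> < h" and e2:
    "fd g (x + \<sigma> *\<^sub>R u + h *\<^sub>R v) u - fd g (x + \<sigma> *\<^sub>R u + 0 *\<^sub>R v) u
      = (h - 0) * fd (\<lambda>z. fd g z u) (x + \<sigma> *\<^sub>R u + \<tau> *\<^sub>R v) v"
    using MVT2[OF h(1) D2] by blast
  show ?thesis
  proof (rule bexI[OF _ inb[of \<sigma> \<tau>]])
    have "fd g (x + h *\<^sub>R v + \<sigma> *\<^sub>R u) u - fd g (x + \<sigma> *\<^sub>R u) u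
        = h * fd (\<lambda>z. fd g z u) (x + \<sigma> *\<^sub>R u + \<tau> *\<^sub>R v) v"
      using e2 by (simp add: add_ac)
    with e1 show "g (x + h *\<^sub>R u + h *\<^sub>R v) - g (x + h *\<^sub>R u) - g (x + h *\<^sub>R v) + g x
        = h * h * fd (\<lambda>z. fd g z u) (x + \<sigma> *\<^sub>R u + \<tau> *\<^sub>R v) v"
      by (simp add: add_ac)
  qed (use \<sigma> \<tau> in auto)
qed

text \<open>Both mixed derivatives take a common value arbitrarily close to \<open>x\<close>, namely the same second
  difference quotient; by continuity they agree at \<open>x\<close>.\<close>

lemma second_derivative_symmetric_real:
  fixes g :: "'a::real_normed_vector \<Rightarrow> real"
  assumes S: "open S" "x \<in> S" and g: "Ck_on \<infinity> S g"
  shows "fd (\<lambda>z. fd g z u) x v = fd (\<lambda>z. fd g z v) x u"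
proof (rule ccontr)
  let ?P = "\<lambda>z. fd (\<lambda>z. fd g z u) z v" and ?Q = "\<lambda>z. fd (\<lambda>z. fd g z v) z u"
  assume ne: "?P x \<noteq> ?Q x"
  define \<epsilon> where "\<epsilon> = \<bar>?P x - ?Q x\<bar> / 2"
  have \<epsilon>: "\<epsilon> > 0" using ne by (simp add: \<epsilon>_def)
  have cont: "isCont (\<lambda>z. fd (\<lambda>z. fd g z a) z b) x" for a b
    using Ck_on_infty_differentiable[OF Ck_on_infty_fd[OF Ck_on_infty_fd[OF g]] S(2)]
    by (rule differentiable_imp_continuous_within)
  obtain d1 where d1: "d1 > 0" "\<And>y. dist y x < d1 \<Longrightarrow> dist (?P y) (?P x) < \<epsilon>"
    using cont[of u v] \<epsilon> unfolding continuous_at_eps_delta by blast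
  obtain d2 where d2: "d2 > 0" "\<And>y. dist y x < d2 \<Longrightarrow> dist (?Q y) (?Q x) < \<epsilon>"
    using cont[of v u] \<epsilon> unfolding continuous_at_eps_delta by blast
  obtain d3 where d3: "d3 > 0" "ball x d3 \<subseteq> S" using S open_contains_ball by blast
  define \<delta> where "\<delta> = min d1 (min d2 d3)"
  have \<delta>: "\<delta> > 0" "\<delta> \<le> d1" "\<delta> \<le> d2" "ball x \<delta> \<subseteq> S"
    using d1(1) d2(1) d3 by (auto simp: \<delta>_def)
  \<comment> \<open>The summand 1 keeps \<open>h\<close> positive when both directions vanish.\<close>
  define h where "h = \<delta> / (norm u + norm v + 1)"
  have n: "norm u + norm v + 1 > 0" by (simp add: add_nonneg_pos)
  have h: "h > 0" "h * (norm u + norm v) < \<delta>"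
    using \<delta>(1) n by (simp_all add: h_def pos_divide_less_eq) 
  obtain y where y: "y \<in> ball x \<delta>" "g (x + h *\<^sub>R u + h *\<^sub>R v) - g (x + h *\<^sub>R u) - g (x + h *\<^sub>R v) + g x = h * h * ?P y"
    using second_difference[OF \<delta>(4) g h] by blast
  have h': "h * (norm v + norm u) < \<delta>" using h(2) by (simp add: add.commute)
  obtain y' where y': "y' \<in> ball x \<delta>" "g (x + h *\<^sub>R v + h *\<^sub>R u) - g (x + h *\<^sub>R v) - g (x + h *\<^sub>R u) + g x = h * h * ?Q y'"
    using second_difference[OF \<delta>(4) g h(1) h'] by blast
  have "g (x + h *\<^sub>R v + h *\<^sub>R u) = g (x + h *\<^sub>R u + h *\<^sub>R v)" by (simp add: add_ac)
  then have "h * h * ?P y = h * h * ?Q y'" using y(2) y'(2) by linarith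
  then have PQ: "?P y = ?Q y'" using h(1) by simp
  have "dist (?P y) (?P x) < \<epsilon>" using d1(2)[of y] y(1) \<delta>(2) by (simp add: dist_commute)
  moreover have "dist (?Q y') (?Q x) < \<epsilon>" using d2(2)[of y'] y'(1) \<delta>(3) by (simp add: dist_commute)
  ultimately show False unfolding PQ \<epsilon>_def dist_real_def by (simp add: abs_if split: if_splits)
qed

text \<open>The scalar case applies to each coordinate of \<open>f\<close>.\<close>

lemma second_derivative_symmetric:
  fixes f :: "'a::real_normed_vector \<Rightarrow> 'b::euclidean_space"
  assumes S: "open S" "x \<in> S" and f: "Ck_on \<infinity> S f"
  shows "fd (\<lambda>z. fd f z u) x v = fd (\<lambda>z. fd f z v) x u"
proof (rule euclidean_eqI)
  fix b :: 'b assume b: "b \<in> Basis"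
  let ?g = "\<lambda>z. f z \<bullet> b"
  have fz: "(f has_derivative fd f z) (at z)" if "z \<in> S" for z
    using Ck_on_infty_differentiable[OF f that] by (simp add: frechet_derivative_works)
  have g1: "fd ?g z w = fd f z w \<bullet> b" if "z \<in> S" for z w
    using fd_eq[OF has_derivative_inner_left[OF fz[OF that]]] by simp
  have g2: "fd (\<lambda>z. fd ?g z w) x a = fd (\<lambda>z. fd f z w) x a \<bullet> b" for w a
  proof -
    have "((\<lambda>z. fd f z w) has_derivative fd (\<lambda>z. fd f z w) x) (at x)"
      using Ck_on_infty_differentiable[OF Ck_on_infty_fd[OF f] S(2)] by (simp add: frechet_derivative_works)
    from has_derivative_transform_open[OF has_derivative_inner_left[OF this, of b] S, of "\<lambda>z. fd ?g z w"]
    show ?thesis using g1 fd_eq by force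
  qed
  have "Ck_on \<infinity> S ?g" by (rule Ck_on_compose_linear[OF bounded_linear_inner_left S(1) f])
  from second_derivative_symmetric_real[OF S this, of u v]
  show "fd (\<lambda>z. fd f z u) x v \<bullet> b = fd (\<lambda>z. fd f z v) x u \<bullet> b" unfolding g2 .
qed

text \<open>Product rule for the pairing of a derivative with a moving vector. It produces the second
  derivatives in the coordinate expressions of brackets and of exterior derivatives.\<close>

lemma has_derivative_fd_apply:
  fixes e :: "'a::euclidean_space \<Rightarrow> 'b::real_normed_vector"
  assumes S: "open S" "e1 x \<in> S" and e: "Ck_on \<infinity> S e" and q: "(e1 has_derivative q) (at x)"
    and h: "(h has_derivative h') (at x)" and nb: "open T" "x \<in> T" "\<And>y. y \<in> T \<Longrightarrow> e1 y \<in> S"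
  shows "((\<lambda>y. fd e (e1 y) (h y)) has_derivative
      (\<lambda>a. fd (\<lambda>z. fd e z (h x)) (e1 x) (q a) + fd e (e1 x) (h' a))) (at x)"
proof -
  have lin: "linear (fd e z)" if "z \<in> S" for z
    by (rule linear_frechet_derivative[OF Ck_on_infty_differentiable[OF e that]])
  have d: "((\<lambda>z. fd e z w) has_derivative fd (\<lambda>z. fd e z w) (e1 x)) (at (e1 x))" for w
    using Ck_on_infty_differentiable[OF Ck_on_infty_fd[OF e] S(2)] by (simp add: frechet_derivative_works)
  have c: "((\<lambda>y. fd e (e1 y) w) has_derivative (\<lambda>a. fd (\<lambda>z. fd e z w) (e1 x) (q a))) (at x)" for w
    using diff_chain_at[OF q d] by (simp add: o_def)
  have "((\<lambda>y. \<Sum>b\<in>Basis. (h y \<bullet> b) *\<^sub>R fd e (e1 y) b) has_derivative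
      (\<lambda>a. \<Sum>b\<in>Basis. (h x \<bullet> b) *\<^sub>R fd (\<lambda>z. fd e z b) (e1 x) (q a) + (h' a \<bullet> b) *\<^sub>R fd e (e1 x) b)) (at x)"
    by (intro has_derivative_sum has_derivative_scaleR has_derivative_inner_left h c)
  then have "((\<lambda>y. fd e (e1 y) (h y)) has_derivative
      (\<lambda>a. \<Sum>b\<in>Basis. (h x \<bullet> b) *\<^sub>R fd (\<lambda>z. fd e z b) (e1 x) (q a) + (h' a \<bullet> b) *\<^sub>R fd e (e1 x) b)) (at x)"
    by (rule has_derivative_transform_open[OF _ nb(1,2)])
      (use linear_basis_expansion[OF lin[OF nb(3)]] in simp)
  moreover have "(\<Sum>b\<in>Basis. (h x \<bullet> b) *\<^sub>R fd (\<lambda>z. fd e z b) (e1 x) a) = fd (\<lambda>z. fd e z (h x)) (e1 x) a" for a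
  proof -
    have "((\<lambda>z. \<Sum>b\<in>Basis. (h x \<bullet> b) *\<^sub>R fd e z b) has_derivative
      (\<lambda>a. \<Sum>b\<in>Basis. (h x \<bullet> b) *\<^sub>R fd (\<lambda>z. fd e z b) (e1 x) a)) (at (e1 x))"
      by (intro has_derivative_sum has_derivative_scaleR_right d)
    then have "((\<lambda>z. fd e z (h x)) has_derivative
      (\<lambda>a. \<Sum>b\<in>Basis. (h x \<bullet> b) *\<^sub>R fd (\<lambda>z. fd e z b) (e1 x) a)) (at (e1 x))"
      by (rule has_derivative_transform_open[OF _ S])
        (use linear_basis_expansion[OF lin] in simp)
    from fd_eq[OF this] show ?thesis by simp
  qed
  moreover have "(\<Sum>b\<in>Basis. (h' a \<bullet> b) *\<^sub>R fd e (e1 x) b) = fd e (e1 x) (h' a)" for a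
    using linear_basis_expansion[OF lin[OF S(2)], of "h' a"] by simp
  ultimately show ?thesis by (simp add: sum.distrib)
qed

section \<open>Homogeneous energies on a vector space\<close>

text \<open>The second derivative of \<open>e\<close>, outer direction first. On vertical vectors \<open>(0, v)\<close> it is the Finsler
  metric.\<close>

definition hess :: "('a::euclidean_space \<Rightarrow> real) \<Rightarrow> 'a \<Rightarrow> 'a \<Rightarrow> 'a \<Rightarrow> real"
  where "hess e z a w = fd (\<lambda>z. fd e z w) z a"

text \<open>The 2-form \<open>d(d\<^sub>J e)\<close> in coordinates, where \<open>d\<^sub>J e (a) = De (0, fst a)\<close>.\<close>

definition ddJ :: "('e::euclidean_space \<times> 'e \<Rightarrow> real) \<Rightarrow> 'e \<times> 'e \<Rightarrow> 'e \<times> 'e \<Rightarrow> 'e \<times> 'e \<Rightarrow> real"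
  where "ddJ e z a b = hess e z a (0, fst b) - hess e z b (0, fst a)"

text \<open>The energy of a Finsler manifold in a chart, where \<open>U\<close> is the range of the chart of the base.\<close>

locale chart_energy =
  fixes U :: "'e::euclidean_space set" and e :: "'e \<times> 'e \<Rightarrow> real"
  assumes U: "open U"
    and e: "Ck_on \<infinity> (U \<times> (UNIV - {0})) e"
    and hom: "\<And>x y t. x \<in> U \<Longrightarrow> y \<noteq> 0 \<Longrightarrow> t > 0 \<Longrightarrow> e (x, t *\<^sub>R y) = t\<^sup>2 * e (x, y)"
    and pos: "\<And>z v. z \<in> U \<times> (UNIV - {0}) \<Longrightarrow> v \<noteq> 0 \<Longrightarrow> hess e z (0, v) (0, v) > 0"
begin

abbreviation "W \<equiv> U \<times> (UNIV - {0::'e})"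

lemma W: "open W"
  using U by (intro open_Times) auto

lemma de: "z \<in> W \<Longrightarrow> (e has_derivative fd e z) (at z)"
  using Ck_on_infty_differentiable[OF e] by (simp add: frechet_derivative_works)

lemma lin: "z \<in> W \<Longrightarrow> linear (fd e z)"
  using de has_derivative_linear by blast

lemma dde: "z \<in> W \<Longrightarrow> ((\<lambda>z. fd e z w) has_derivative (\<lambda>a. hess e z a w)) (at z)"
  using Ck_on_infty_differentiable[OF Ck_on_infty_fd[OF e]]
  by (simp add: frechet_derivative_works hess_def)

lemma linear_hess: "z \<in> W \<Longrightarrow> linear (\<lambda>a. hess e z a w)"
  using dde has_derivative_linear by blast

lemma linear_hess2:
  assumes z: "z \<in> W"
  shows "linear (\<lambda>w. hess e z a w)"
proof (rule linearI)
  show "hess e z a (v + w) = hess e z a v + hess e z a w" for v w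
  proof -
    have "((\<lambda>z. fd e z (v + w)) has_derivative (\<lambda>a. hess e z a v + hess e z a w)) (at z)"
      by (rule has_derivative_transform_open[OF has_derivative_add[OF dde[OF z] dde[OF z]] W z])
        (use linear_add[OF lin] in simp)
    then show ?thesis unfolding hess_def by (simp add: fd_eq)
  qed
  show "hess e z a (r *\<^sub>R w) = r *\<^sub>R hess e z a w" for r w
  proof -
    have "((\<lambda>z. fd e z (r *\<^sub>R w)) has_derivative (\<lambda>a. r *\<^sub>R hess e z a w)) (at z)"
      by (rule has_derivative_transform_open[OF has_derivative_scaleR_right[OF dde[OF z]] W z])
        (use linear_cmul[OF lin] in simp)
    then show ?thesis unfolding hess_def by (simp add: fd_eq)
  qed
qed

lemma has_derivative_scale_fibre:
  "((\<lambda>z::'e \<times> 'e. (fst z, t *\<^sub>R snd z)) has_derivative (\<lambda>z. (fst z, t *\<^sub>R snd z))) (at z)"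
  by (auto intro!: derivative_eq_intros)

lemma euler: "(x, y) \<in> W \<Longrightarrow> fd e (x, y) (0, y) = 2 * e (x, y)"
proof -
  assume z: "(x, y) \<in> W"
  have "((\<lambda>t. e ((x, 0) + t *\<^sub>R (0, y))) has_field_derivative fd e ((x, 0) + 1 *\<^sub>R (0, y)) (0, y)) (at 1)"
    by (rule has_field_derivative_line, rule de) (use z in simp)
  then have "((\<lambda>t. e (x, t *\<^sub>R y)) has_field_derivative fd e (x, y) (0, y)) (at 1)" by simp
  moreover have "((\<lambda>t. e (x, t *\<^sub>R y)) has_field_derivative 2 * e (x, y)) (at 1)"
  proof (rule has_field_derivative_transform_within_open[where S = "{0<..}" and f = "\<lambda>t. t\<^sup>2 * e (x, y)"])
    show "((\<lambda>t. t\<^sup>2 * e (x, y)) has_field_derivative 2 * e (x, y)) (at 1)"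
      by (auto intro!: derivative_eq_intros)
  qed (use z hom in auto)
  ultimately show ?thesis by (rule DERIV_unique)
qed

lemma fd_scale:
  assumes z: "x \<in> U" "y \<noteq> 0" and t: "t > 0"
  shows "fd e (x, t *\<^sub>R y) (a, t *\<^sub>R b) = t\<^sup>2 * fd e (x, y) (a, b)"
proof -
  have "(x, t *\<^sub>R y) \<in> W" using z t by auto
  then have "(e has_derivative fd e (x, t *\<^sub>R y)) (at ((\<lambda>z. (fst z, t *\<^sub>R snd z)) (x, y)))"
    using de by simp
  from diff_chain_at[OF has_derivative_scale_fibre this]
  have 1: "((\<lambda>z. e (fst z, t *\<^sub>R snd z)) has_derivative (\<lambda>v. fd e (x, t *\<^sub>R y) (fst v, t *\<^sub>R snd v))) (at (x, y))"
    by (simp add: o_def)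
  have xy: "(x, y) \<in> W" using z by auto
  have 2: "((\<lambda>z. t\<^sup>2 * e z) has_derivative (\<lambda>v. fd e (x, t *\<^sub>R y) (fst v, t *\<^sub>R snd v))) (at (x, y))"
    by (rule has_derivative_transform_open[OF 1 W xy])
      (use hom[OF _ _ t] in \<open>auto simp: mem_Times_iff\<close>)
  have 3: "((\<lambda>z. t\<^sup>2 * e z) has_derivative (\<lambda>v. t\<^sup>2 * fd e (x, y) v)) (at (x, y))"
    by (rule has_derivative_mult_right[OF de[OF xy]])
  show ?thesis using fun_cong[OF has_derivative_unique[OF 2 3], of "(a, b)"] by simp
qed

lemma hess_scale:
  assumes z: "x \<in> U" "y \<noteq> 0" and t: "t > 0"
  shows "hess e (x, t *\<^sub>R y) (a, t *\<^sub>R b) (c, t *\<^sub>R d) = t\<^sup>2 * hess e (x, y) (a, b) (c, d)"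
proof -
  have "(x, t *\<^sub>R y) \<in> W" using z t by auto
  then have "((\<lambda>z. fd e z (c, t *\<^sub>R d)) has_derivative (\<lambda>v. hess e (x, t *\<^sub>R y) v (c, t *\<^sub>R d)))
      (at ((\<lambda>z. (fst z, t *\<^sub>R snd z)) (x, y)))"
    using dde by simp
  from diff_chain_at[OF has_derivative_scale_fibre this]
  have 1: "((\<lambda>z. fd e (fst z, t *\<^sub>R snd z) (c, t *\<^sub>R d)) has_derivative
      (\<lambda>v. hess e (x, t *\<^sub>R y) (fst v, t *\<^sub>R snd v) (c, t *\<^sub>R d))) (at (x, y))"
    by (simp add: o_def)
  have xy: "(x, y) \<in> W" using z by auto
  have 2: "((\<lambda>z. t\<^sup>2 * fd e z (c, d)) has_derivative
      (\<lambda>v. hess e (x, t *\<^sub>R y) (fst v, t *\<^sub>R snd v) (c, t *\<^sub>R d))) (at (x, y))"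
    by (rule has_derivative_transform_open[OF 1 W xy])
      (use fd_scale[OF _ _ t] in \<open>auto simp: mem_Times_iff\<close>)
  have 3: "((\<lambda>z. t\<^sup>2 * fd e z (c, d)) has_derivative (\<lambda>v. t\<^sup>2 * hess e (x, y) v (c, d))) (at (x, y))"
    by (rule has_derivative_mult_right[OF dde[OF xy]])
  show ?thesis using fun_cong[OF has_derivative_unique[OF 2 3], of "(a, b)"] by simp
qed

text \<open>Differentiate Euler's relation \<open>De(0, y) = 2 e\<close> in the direction \<open>a\<close>.\<close>

lemma hess_fibre_right:
  assumes z: "z \<in> W"
  shows "hess e z a (0, snd z) = 2 * fd e z a - fd e z (0, snd a)"
proof -
  have i: "((\<lambda>z. z) has_derivative (\<lambda>a. a)) (at z)" by (rule has_derivative_ident)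
  have s: "((\<lambda>z::'e \<times> 'e. (0, snd z)) has_derivative (\<lambda>a. (0, snd a))) (at z)"
    by (auto intro!: derivative_eq_intros)
  have 1: "((\<lambda>z. fd e z (0, snd z)) has_derivative (\<lambda>a. fd (\<lambda>w. fd e w (0, snd z)) z a + fd e z (0, snd a))) (at z)"
    by (rule has_derivative_fd_apply[OF W z e i s W z])
  have eu: "fd e w (0, snd w) = 2 * e w" if "w \<in> W" for w
    using euler[of "fst w" "snd w"] that by simp
  have 2: "((\<lambda>z. 2 * e z) has_derivative (\<lambda>a. fd (\<lambda>w. fd e w (0, snd z)) z a + fd e z (0, snd a))) (at z)"
    by (rule has_derivative_transform_open[OF 1 W z]) (rule eu)
  have 3: "((\<lambda>z. 2 * e z) has_derivative (\<lambda>a. 2 * fd e z a)) (at z)"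
    by (rule has_derivative_mult_right[OF de[OF z]])
  show ?thesis using fun_cong[OF has_derivative_unique[OF 2 3], of a] by (simp add: hess_def)
qed

text \<open>Euler's relation for the fibre derivative of \<open>e\<close>, which is homogeneous of degree 1.\<close>

lemma hess_fibre_left:
  assumes z: "(x, y) \<in> W"
  shows "hess e (x, y) (0, y) (0, w) = fd e (x, y) (0, w)"
proof -
  have "((\<lambda>t. fd e ((x, 0) + t *\<^sub>R (0, y)) (0, w)) has_field_derivative
      hess e ((x, 0) + 1 *\<^sub>R (0, y)) (0, y) (0, w)) (at 1)"
    by (rule has_field_derivative_line, rule dde) (use z in simp)
  then have "((\<lambda>t. fd e (x, t *\<^sub>R y) (0, w)) has_field_derivative hess e (x, y) (0, y) (0, w)) (at 1)" by simp
  moreover have "((\<lambda>t. fd e (x, t *\<^sub>R y) (0, w)) has_field_derivative fd e (x, y) (0, w)) (at 1)"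
  proof (rule has_field_derivative_transform_within_open[where S = "{0<..}" and f = "\<lambda>t. t * fd e (x, y) (0, w)"])
    show "((\<lambda>t. t * fd e (x, y) (0, w)) has_field_derivative fd e (x, y) (0, w)) (at 1)"
      by (auto intro!: derivative_eq_intros)
    fix t :: real assume t: "t \<in> {0<..}"
    have "fd e (x, t *\<^sub>R y) (0, t *\<^sub>R (w /\<^sub>R t)) = t\<^sup>2 * fd e (x, y) (0, w /\<^sub>R t)"
      by (rule fd_scale) (use z t in auto)
    also have "fd e (x, y) (0, w /\<^sub>R t) = inverse t * fd e (x, y) (0, w)"
      using linear_cmul[OF lin[OF z], of "inverse t" "(0, w)"] by simp
    finally show "t * fd e (x, y) (0, w) = fd e (x, t *\<^sub>R y) (0, w)"
      using t by (simp add: power2_eq_square)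
  qed auto
  ultimately show ?thesis by (rule DERIV_unique)
qed

lemma hess_fibre_right_vertical: "z \<in> W \<Longrightarrow> hess e z (0, v) (0, snd z) = fd e z (0, v)"
  using hess_fibre_right[of z "(0, v)"] by simp

lemma ddJ_linear:
  assumes z: "z \<in> W"
  shows "ddJ e z (a + a') b = ddJ e z a b + ddJ e z a' b" "ddJ e z (r *\<^sub>R a) b = r * ddJ e z a b"
    "ddJ e z a (b + b') = ddJ e z a b + ddJ e z a b'"
  using linear_add[OF linear_hess[OF z]] linear_cmul[OF linear_hess[OF z]]
    linear_add[OF linear_hess2[OF z], of _ "(0, _)" "(0, _)"] linear_cmul[OF linear_hess2[OF z], of _ _ "(0, _)"]
  by (simp_all add: ddJ_def algebra_simps)

text \<open>Testing against the vertical vector \<open>(0, fst a)\<close> kills \<open>fst a\<close> by positivity; after that, testing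
  against \<open>(snd a, 0)\<close> kills \<open>snd a\<close>.\<close>

lemma ddJ_nondegenerate:
  assumes z: "z \<in> W" and a: "\<And>b. ddJ e z a b = 0"
  shows "a = 0"
proof -
  have h0: "hess e z b (0, 0) = 0" for b
    using linear_0[OF linear_hess2[OF z]] by (simp add: zero_prod_def)
  have "hess e z (0, fst a) (0, fst a) = 0" using a[of "(0, fst a)"] h0 by (simp add: ddJ_def)
  then have f: "fst a = 0" using pos[OF z] by force
  then have "a = (0, snd a)" by (simp add: prod_eq_iff)
  then have "ddJ e z a (snd a, 0) = hess e z (0, snd a) (0, snd a)"
    using f h0 unfolding ddJ_def by simp
  then have "snd a = 0" using a pos[OF z] by force
  then show ?thesis using f by (simp add: prod_eq_iff)
qed

lemma ddJ_unique:
  assumes z: "z \<in> W" and ab: "\<And>c. ddJ e z a c = ddJ e z b c"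
  shows "a = b"
proof -
  have "ddJ e z (a + (-1) *\<^sub>R b) c = 0" for c
    unfolding ddJ_linear[OF z] using ab[of c] by simp
  then have "a + (-1) *\<^sub>R b = 0" by (rule ddJ_nondegenerate[OF z])
  then show ?thesis by simp
qed

text \<open>The value does not depend on \<open>F\<close>: on vertical vectors the equation \<open>i\<^sub>X \<Omega> = -dE\<close> only tests the
  horizontal component of \<open>X\<close>.\<close>

lemma ddJ_vertical:
  assumes z: "z \<in> W"
  shows "ddJ e z (snd z, F) (0, w) = - fd e z (0, w)"
proof -
  have "hess e z (snd z, F) (0, 0) = 0"
    using linear_0[OF linear_hess2[OF z]] by (simp add: zero_prod_def)
  then show ?thesis using hess_fibre_right_vertical[OF z, of w] by (simp add: ddJ_def)
qed

text \<open>Scaling the fibre by \<open>t\<close> multiplies \<open>ddJ e\<close> by \<open>t\<close> and \<open>De\<close> by \<open>t\<^sup>2\<close>. Hence \<open>(t y, t\<^sup>2 F)\<close> solves the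
  equation at \<open>(x, t y)\<close>, and it is the only solution there.\<close>

lemma spray_coefficient_homogeneous:
  assumes z: "x \<in> U" "y \<noteq> 0" and t: "t > 0"
    and F: "\<And>b. ddJ e (x, y) (y, F) b = - fd e (x, y) b"
    and F': "\<And>b. ddJ e (x, t *\<^sub>R y) (t *\<^sub>R y, F') b = - fd e (x, t *\<^sub>R y) b"
  shows "F' = t\<^sup>2 *\<^sub>R F"
proof -
  have zt: "(x, t *\<^sub>R y) \<in> W" using z t by auto
  have sc: "ddJ e (x, t *\<^sub>R y) (a, t *\<^sub>R b) (c, t *\<^sub>R d) = t * ddJ e (x, y) (a, b) (c, d)" for a b c d
  proof -
    have "hess e (x, t *\<^sub>R y) (a, t *\<^sub>R b) (0, c) = t * hess e (x, y) (a, b) (0, c)" for a b c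
    proof -
      have "hess e (x, t *\<^sub>R y) (a, t *\<^sub>R b) (0, t *\<^sub>R (c /\<^sub>R t)) = t\<^sup>2 * hess e (x, y) (a, b) (0, c /\<^sub>R t)"
        by (rule hess_scale[OF z t])
      also have "hess e (x, y) (a, b) (0, c /\<^sub>R t) = inverse t * hess e (x, y) (a, b) (0, c)"
        using linear_cmul[OF linear_hess2, of "(x, y)" "(a, b)" "inverse t" "(0, c)"] z by simp
      finally show ?thesis using t by (simp add: power2_eq_square)
    qed
    then show ?thesis by (simp add: ddJ_def algebra_simps)
  qed
  have "ddJ e (x, t *\<^sub>R y) (t *\<^sub>R y, t\<^sup>2 *\<^sub>R F) b = - fd e (x, t *\<^sub>R y) b" for b
  proof -
    have b: "b = (fst b, t *\<^sub>R (snd b /\<^sub>R t))" using t by simp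
    have "ddJ e (x, t *\<^sub>R y) (t *\<^sub>R (y, t *\<^sub>R F)) b = t * (t * ddJ e (x, y) (y, F) (fst b, snd b /\<^sub>R t))"
      unfolding ddJ_linear(2)[OF zt] by (subst b) (simp only: sc)
    also have "\<dots> = - (t\<^sup>2 * fd e (x, y) (fst b, snd b /\<^sub>R t))" unfolding F by (simp add: power2_eq_square)
    also have "t\<^sup>2 * fd e (x, y) (fst b, snd b /\<^sub>R t) = fd e (x, t *\<^sub>R y) b"
      by (subst (2) b) (simp only: fd_scale[OF z t])
    finally show ?thesis by (simp add: power2_eq_square)
  qed
  then have "(t *\<^sub>R y, F') = (t *\<^sub>R y, t\<^sup>2 *\<^sub>R F)" using F' by (intro ddJ_unique[OF zt]) simp
  then show ?thesis by simp
qed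

end

section \<open>The Lie bracket in charts\<close>

lemma tangent2_fst_change:
  assumes A: "smooth_atlas A" and x: "x \<in> TB (tatlas A)" and b: "b \<in> A" "fst (fst x) \<in> cdom b"
    and c: "c \<in> A" "fst (fst x) \<in> cdom c"
  shows "fst (snd x (tchart A c)) = fd (chg b c) (cmap b (fst (fst x))) (fst (snd x (tchart A b)))"
proof -
  have "tvec A c (fst (fst x)) (fst (snd x (tchart A c))) = tvec A b (fst (fst x)) (fst (snd x (tchart A b)))"
    using rho_chart[OF A x b] rho_chart[OF A x c] by simp
  then have "snd (tvec A c (fst (fst x)) (fst (snd x (tchart A c)))) c =
      snd (tvec A b (fst (fst x)) (fst (snd x (tchart A b)))) c" by simp
  then show ?thesis using tvec_comp[OF A c] c by (simp add: tvec_def)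
qed

definition field_coord :: "('m, 'e::euclidean_space) chart set \<Rightarrow> ('m, 'e) chart \<Rightarrow> ('m, 'e) vfield \<Rightarrow>
    'e \<times> 'e \<Rightarrow> 'e \<times> 'e"
  where "field_coord A c X z = snd (X (cinv (tchart A c) z)) (tchart A c)"

lemma cinv_tchart_point:
  assumes "smooth_atlas A" "c \<in> A" "u \<in> TB A" "fst u \<in> cdom c"
  shows "cinv (tchart A c) (cmap (tchart A c) u) = u"
  using cinv_cmap[OF smooth_atlas_tatlas[OF assms(1)] tchart_in[OF assms(2)], of u] assms(3,4) by simp

lemma field_coord_at:
  assumes "smooth_atlas A" "c \<in> A" "u \<in> TB A" "fst u \<in> cdom c"
  shows "field_coord A c X (cmap (tchart A c) u) = snd (X u) (tchart A c)"
  unfolding field_coord_def cinv_tchart_point[OF assms] ..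

abbreviation slit_image :: "('m, 'e::euclidean_space) chart \<Rightarrow> ('e \<times> 'e) set"
  where "slit_image c \<equiv> cmap c ` cdom c \<times> (UNIV - {0})"

lemma open_slit_image: "smooth_atlas A \<Longrightarrow> c \<in> A \<Longrightarrow> open (slit_image c)"
  by (intro open_Times) (auto simp: smooth_atlas_def)

lemma slit_imageE:
  assumes A: "smooth_atlas A" "c \<in> A" and z: "z \<in> slit_image c"
  obtains u where "u \<in> slit A" "fst u \<in> cdom c" "z = cmap (tchart A c) u" "cinv (tchart A c) z = u"
proof -
  obtain u where "z = cmap (tchart A c) u" "u \<in> slit A \<inter> cdom (tchart A c)"
    using z unfolding tchart_image_slit[OF A, symmetric] by (rule imageE)
  then show ?thesis using that[of u] cinv_tchart_point[OF A, of u] by simp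
qed

lemma slit_image_point:
  assumes A: "smooth_atlas A" "c \<in> A" and u: "u \<in> slit A" "fst u \<in> cdom c"
  shows "cmap (tchart A c) u \<in> slit_image c"
  using slit_iff[OF A u(2)] u by auto

lemma Ck_mfun_slit_coord:
  assumes A: "smooth_atlas A" "c \<in> A" and f: "Ck_mfun k (tatlas A) (slit_over A (cdom c)) f"
  shows "Ck_on k (slit_image c) (\<lambda>z. f (cinv (tchart A c) z))"
proof -
  have "slit_over A (cdom c) \<inter> cdom (tchart A c) = slit A \<inter> cdom (tchart A c)" by auto
  then show ?thesis
    using Ck_mfunD[OF f tchart_in[OF A(2)]] tchart_image_slit[OF A] by (simp del: tchart_simps)
qed

lemma field_coord_smooth:
  assumes A: "smooth_atlas A" "c \<in> A" and X: "X \<in> slit_fields A"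
  shows "Ck_on \<infinity> (slit_image c) (field_coord A c X)"
  using Ck_mfun_slit_coord[OF A slit_fields_smooth[OF A X]] by (simp add: field_coord_def[abs_def])

lemma field_coord_deriv:
  assumes A: "smooth_atlas A" "c \<in> A" and X: "X \<in> slit_fields A" and z: "z \<in> slit_image c"
  shows "(field_coord A c X has_derivative fd (field_coord A c X) z) (at z)"
  using Ck_on_infty_differentiable[OF field_coord_smooth[OF A X] z] by (simp add: frechet_derivative_works)

lemma lie_bracket_coord:
  assumes A: "smooth_atlas A" "c \<in> A" and u: "u \<in> TB A" "fst u \<in> cdom c"
  shows "snd (lie_bracket (tatlas A) X Y u) (tchart A c) =
    fd (field_coord A c Y) (cmap (tchart A c) u) (snd (X u) (tchart A c)) -
    fd (field_coord A c X) (cmap (tchart A c) u) (snd (Y u) (tchart A c))"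
proof -
  have "u \<in> cdom (tchart A c)" using u by simp
  then show ?thesis
    using tchart_in[OF A(2)] cinv_tchart_point[OF A u]
    by (simp add: lie_bracket_def Let_def field_coord_def[abs_def] del: tchart_simps)
qed

lemma fst_lie_bracket [simp]: "fst (lie_bracket B X Y p) = p"
  by (simp add: lie_bracket_def)

text \<open>Differentiate the transformation law of the first components of \<open>Y\<close> along \<open>X\<close>. The first summand
  is the second derivative of the coordinate change, in the first components of \<open>X\<close> and \<open>Y\<close>.\<close>

lemma derivative_base_change:
  assumes A: "smooth_atlas A" and b: "b \<in> A" "fst u \<in> cdom b" and c: "c \<in> A" "fst u \<in> cdom c"
    and u: "u \<in> slit A" and X: "X \<in> slit_fields A" "Y \<in> slit_fields A"
  shows "fst (fd (field_coord A c Y) (cmap (tchart A c) u) (snd (X u) (tchart A c))) =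
    fd (\<lambda>x. fd (chg b c) x (fst (snd (Y u) (tchart A b)))) (cmap b (fst u)) (fst (snd (X u) (tchart A b))) +
    fd (chg b c) (cmap b (fst u)) (fst (fd (field_coord A b Y) (cmap (tchart A b) u) (snd (X u) (tchart A b))))"
proof -
  note TA = smooth_atlas_tatlas[OF A]
  let ?B = "tchart A b" and ?C = "tchart A c"
  let ?z = "cmap ?B u"
  let ?\<Phi> = "chg ?B ?C"
  let ?O = "cmap ?B ` (slit A \<inter> cdom ?C \<inter> cdom ?B)"
  have uTB: "u \<in> TB A" by (rule slit_TB[OF u])
  have uBC: "u \<in> cdom ?B" "u \<in> cdom ?C" using uTB b c by auto
  have O: "open ?O"
    by (rule atlas_openD[OF atlas_open_Int_cdom[OF TA atlas_open_slit[OF A] tchart_in[OF c(1)]] tchart_in[OF b(1)]])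
  have zO: "?z \<in> ?O" using u uBC by blast
  have \<Phi>z: "?\<Phi> ?z = cmap ?C u" using cinv_tchart_point[OF A b(1) uTB b(2)] by (simp del: tchart_simps)
  have d\<Phi>: "(?\<Phi> has_derivative fd ?\<Phi> ?z) (at ?z)"
    by (rule chg_has_derivative[OF TA tchart_in[OF b(1)] tchart_in[OF c(1)] uBC])
  have Xc: "fd ?\<Phi> ?z (snd (X u) ?B) = snd (X u) ?C"
    using TB_comp[OF slit_fieldsD(3)[OF X(1) u] tchart_in[OF b(1)] tchart_in[OF c(1)]] uBC
      slit_fieldsD(4)[OF X(1) u] by (simp del: tchart_simps)
  have "(field_coord A c Y has_derivative fd (field_coord A c Y) (cmap ?C u)) (at (?\<Phi> ?z))"
    unfolding \<Phi>z by (rule field_coord_deriv[OF A c(1) X(2) slit_image_point[OF A c(1) u c(2)]])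
  from has_derivative_fst[OF diff_chain_at[OF d\<Phi> this]]
  have 1: "((\<lambda>z. fst (field_coord A c Y (?\<Phi> z))) has_derivative
      (\<lambda>a. fst (fd (field_coord A c Y) (cmap ?C u) (fd ?\<Phi> ?z a)))) (at ?z)" by (simp add: o_def)
  have 2: "((\<lambda>z. fd (chg b c) (fst z) (fst (field_coord A b Y z))) has_derivative
      (\<lambda>a. fst (fd (field_coord A c Y) (cmap ?C u) (fd ?\<Phi> ?z a)))) (at ?z)"
  proof (rule has_derivative_transform_open[OF 1 O zO])
    fix z assume "z \<in> ?O"
    then obtain w where w: "w \<in> slit A" "w \<in> cdom ?C" "w \<in> cdom ?B" "z = cmap ?B w" by blast
    have wb: "fst w \<in> cdom b" "fst w \<in> cdom c" using w by auto
    have zw: "cinv ?B z = w" unfolding w(4) by (rule cinv_tchart_point[OF A b(1) slit_TB[OF w(1)] wb(1)])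
    have "?\<Phi> z = cmap ?C w" using zw by (simp del: tchart_simps)
    then have "fst (field_coord A c Y (?\<Phi> z)) = fst (snd (Y w) ?C)"
      using field_coord_at[OF A c(1) slit_TB[OF w(1)] wb(2)] by (simp del: tchart_simps)
    also have "\<dots> = fd (chg b c) (cmap b (fst w)) (fst (snd (Y w) ?B))"
      using tangent2_fst_change[OF A slit_fieldsD(3)[OF X(2) w(1)] b(1) _ c(1)] wb
        slit_fieldsD(4)[OF X(2) w(1)] by simp
    also have "\<dots> = fd (chg b c) (fst z) (fst (field_coord A b Y z))"
      unfolding field_coord_def zw by (simp add: w(4))
    finally show "fst (field_coord A c Y (?\<Phi> z)) = fd (chg b c) (fst z) (fst (field_coord A b Y z))" .
  qed
  have f: "(fst has_derivative fst) (at ?z)" by (intro derivative_eq_intros) auto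
  have V: "open (cmap b ` (cdom b \<inter> cdom c))" by (rule open_chg_dom[OF A b(1) c(1)])
  have 3: "((\<lambda>z. fd (chg b c) (fst z) (fst (field_coord A b Y z))) has_derivative
      (\<lambda>a. fd (\<lambda>x. fd (chg b c) x (fst (field_coord A b Y ?z))) (fst ?z) (fst a) +
        fd (chg b c) (fst ?z) (fst (fd (field_coord A b Y) ?z a)))) (at ?z)"
  proof (rule has_derivative_fd_apply[OF V _ chg_smooth[OF A b(1) c(1)] f
        has_derivative_fst[OF field_coord_deriv[OF A b(1) X(2) slit_image_point[OF A b(1) u b(2)]]] O zO])
    show "fst y \<in> cmap b ` (cdom b \<inter> cdom c)" if "y \<in> ?O" for y using that by auto
    then show "fst ?z \<in> cmap b ` (cdom b \<inter> cdom c)" using zO by blast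
  qed
  have "fst (fd (field_coord A c Y) (cmap ?C u) (fd ?\<Phi> ?z (snd (X u) ?B))) =
     fd (\<lambda>x. fd (chg b c) x (fst (field_coord A b Y ?z))) (fst ?z) (fst (snd (X u) ?B)) +
        fd (chg b c) (fst ?z) (fst (fd (field_coord A b Y) ?z (snd (X u) ?B)))"
    by (rule fun_cong[OF has_derivative_unique[OF 2 3]])
  then show ?thesis unfolding Xc field_coord_at[OF A b(1) uTB b(2)] by simp
qed

text \<open>The second derivatives of the coordinate change cancel by symmetry. The first component of the
  bracket is the part that \<open>\<rho>\<close> sees.\<close>

lemma lie_bracket_base_change:
  assumes A: "smooth_atlas A" and b: "b \<in> A" "fst u \<in> cdom b" and c: "c \<in> A" "fst u \<in> cdom c"
    and u: "u \<in> slit A" and X: "X \<in> slit_fields A" "Y \<in> slit_fields A"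
  shows "fst (snd (lie_bracket (tatlas A) X Y u) (tchart A c)) =
    fd (chg b c) (cmap b (fst u)) (fst (snd (lie_bracket (tatlas A) X Y u) (tchart A b)))"
proof -
  let ?V = "cmap b ` (cdom b \<inter> cdom c)"
  have sym: "fd (\<lambda>x. fd (chg b c) x v) (cmap b (fst u)) w = fd (\<lambda>x. fd (chg b c) x w) (cmap b (fst u)) v" for v w
    by (rule second_derivative_symmetric[OF open_chg_dom[OF A b(1) c(1)] _ chg_smooth[OF A b(1) c(1)]])
      (use b c in auto)
  show ?thesis
    unfolding lie_bracket_coord[OF A c(1) slit_TB[OF u] c(2)] lie_bracket_coord[OF A b(1) slit_TB[OF u] b(2)]
      fst_diff derivative_base_change[OF A b c u X] derivative_base_change[OF A b c u X(2,1)]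
      linear_diff[OF chg_linear[OF A b(1) c(1) b(2) c(2)]]
      sym[of "fst (snd (Y u) (tchart A b))" "fst (snd (X u) (tchart A b))"]
    by simp
qed

lemma rho_lie_bracket:
  assumes A: "smooth_atlas A" and u: "u \<in> slit A" and X: "X \<in> slit_fields A" "Y \<in> slit_fields A"
  shows "rho A (lie_bracket (tatlas A) X Y u) \<in> pb A"
    "fst (rho A (lie_bracket (tatlas A) X Y u)) = u"
    "\<And>c. c \<in> A \<Longrightarrow> fst u \<in> cdom c \<Longrightarrow> snd (snd (rho A (lie_bracket (tatlas A) X Y u))) c =
      fst (snd (lie_bracket (tatlas A) X Y u) (tchart A c))"
proof -
  let ?x = "lie_bracket (tatlas A) X Y u"
  obtain b where b: "b \<in> A" "chart_at (tatlas A) u = tchart A b" "fst u \<in> cdom b"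
    using base_chart[OF slit_TB[OF u]] by blast
  have r: "rho A ?x = (u, tvec A b (fst u) (fst (snd ?x (tchart A b))))"
    using rho_base_chart[OF A, of ?x b] slit_TB[OF u] b by simp
  show "rho A ?x \<in> pb A" "fst (rho A ?x) = u"
    unfolding r using tvec_in_TB[OF A b(1,3)] u by (simp_all add: pb_iff)
  show "snd (snd (rho A ?x)) c = fst (snd ?x (tchart A c))" if c: "c \<in> A" "fst u \<in> cdom c" for c
    unfolding r lie_bracket_base_change[OF A b(1,3) c u X] using c by (simp add: tvec_def)
qed

section \<open>The energy of a Finsler manifold\<close>

locale finsler =
  fixes A :: "('m, 'e::euclidean_space) chart set" and L :: "('m, 'e) tangent \<Rightarrow> real"
  assumes finsler: "finsler_manifold A L"
begin

lemma M: "smooth_manifold A" and A: "smooth_atlas A"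
  using finsler by (auto simp: finsler_manifold_def smooth_manifold_def)

lemma TA: "smooth_atlas (tatlas A)"
  by (rule smooth_atlas_tatlas[OF A])

lemma energy_smooth: "Ck_mfun \<infinity> (tatlas A) (slit A) (energy L)"
proof -
  have L: "Ck_mfun \<infinity> (tatlas A) (slit A) L"
    using finsler by (simp add: finsler_manifold_def Ck_fun_eq_mfun)
  note O = atlas_open_slit[OF A]
  have "Ck_mfun \<infinity> (tatlas A) (slit A) (\<lambda>u. (L u * L u) / 2)"
    by (rule Ck_mfun_compose_linear[OF bounded_linear_divide O Ck_mfun_bilinear[OF bounded_bilinear_mult O L L]])
  then show ?thesis by (simp add: energy_def[abs_def] power2_eq_square)
qed

lemma energy_scale: "u \<in> TB A \<Longrightarrow> r > 0 \<Longrightarrow> energy L (tscale r u) = r\<^sup>2 * energy L u"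
  using finsler by (simp add: finsler_manifold_def energy_def power_mult_distrib)

text \<open>The energy in a chart. Outside the range of the chart the values are arbitrary.\<close>

definition En :: "('m, 'e) chart \<Rightarrow> 'e \<times> 'e \<Rightarrow> real"
  where "En c z = energy L (cinv (tchart A c) z)"

lemma En_smooth: "c \<in> A \<Longrightarrow> Ck_on \<infinity> (slit_image c) (En c)"
  using Ck_mfun_slit_coord[OF A _ Ck_mfun_subset[OF energy_smooth]] unfolding En_def[abs_def] by simp

lemma En_point:
  assumes "c \<in> A" "u \<in> TB A" "fst u \<in> cdom c"
  shows "En c (cmap (tchart A c) u) = energy L u"
  unfolding En_def cinv_tchart_point[OF A assms] ..

text \<open>Moving along fibres by \<open>s\<close> and \<open>t\<close> is moving along the lines with directions \<open>(0, v)\<close> and \<open>(0, w)\<close>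
  in the chart; the iterated derivative along them is the second derivative.\<close>

lemma fmetric_hess:
  assumes c: "c \<in> A" "fst u \<in> cdom c" and u: "u \<in> slit A"
    and a: "a \<in> pb A" "fst a = u" and b: "b \<in> pb A" "fst b = u"
  shows "fmetric L a b = hess (En c) (cmap (tchart A c) u) (0, snd (snd a) c) (0, snd (snd b) c)"
proof -
  let ?z = "cmap (tchart A c) u"
  let ?v = "snd (snd a) c" and ?w = "snd (snd b) c"
  have TBs: "u \<in> TB A" "snd a \<in> TB A" "snd b \<in> TB A" "fst (snd a) = fst u" "fst (snd b) = fst u"
    using slit_TB[OF u] a b by (auto simp: pb_iff)
  have en: "energy L (tadd (tadd u (tscale s (snd a))) (tscale t (snd b))) =
      En c (?z + s *\<^sub>R (0, ?v) + t *\<^sub>R (0, ?w))" for s t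
  proof -
    let ?q = "tadd (tadd u (tscale s (snd a))) (tscale t (snd b))"
    have "?q \<in> TB A" using TBs by (intro tadd_TB[OF A] tscale_TB[OF A]) auto
    then have "En c (cmap (tchart A c) ?q) = energy L ?q" using c by (intro En_point) auto
    then show ?thesis by simp
  qed
  have d: "(En c has_derivative fd (En c) z) (at z)"
    "((\<lambda>z. fd (En c) z w) has_derivative (\<lambda>a. hess (En c) z a w)) (at z)" if "z \<in> slit_image c" for z w
    using Ck_on_infty_differentiable[OF En_smooth[OF c(1)] that]
      Ck_on_infty_differentiable[OF Ck_on_infty_fd[OF En_smooth[OF c(1)]] that]
    by (simp_all add: frechet_derivative_works hess_def)
  have z: "?z \<in> slit_image c" by (rule slit_image_point[OF A c(1) u c(2)])
  have inner: "deriv (\<lambda>t. En c (?z + s *\<^sub>R (0, ?v) + t *\<^sub>R (0, ?w))) 0 = fd (En c) (?z + s *\<^sub>R (0, ?v)) (0, ?w)"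
    if "?z + s *\<^sub>R (0, ?v) \<in> slit_image c" for s
    by (rule DERIV_imp_deriv, rule has_field_derivative_line) (use d(1)[OF that] in simp)
  have line: "((\<lambda>s. ?z + s *\<^sub>R (0, ?v)) \<longlongrightarrow> ?z + 0 *\<^sub>R (0, ?v)) (nhds (0::real))"
    by (intro tendsto_add tendsto_const tendsto_scaleR filterlim_ident)
  have "\<forall>\<^sub>F s in nhds 0. ?z + s *\<^sub>R (0, ?v) \<in> slit_image c"
    by (rule topological_tendstoD[OF line open_slit_image[OF A c(1)]])
      (simp only: scaleR_zero_left add_0_right z)
  \<comment> \<open>Only for small \<open>s\<close> does the point stay off the zero section, where \<open>En c\<close> is smooth.\<close>
  then have ev: "\<forall>\<^sub>F s in nhds 0. deriv (\<lambda>t. En c (?z + s *\<^sub>R (0, ?v) + t *\<^sub>R (0, ?w))) 0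
      = fd (En c) (?z + s *\<^sub>R (0, ?v)) (0, ?w)"
    by (rule eventually_mono) (rule inner)
  have "fmetric L a b = deriv (\<lambda>s. deriv (\<lambda>t. En c (?z + s *\<^sub>R (0, ?v) + t *\<^sub>R (0, ?w))) 0) 0"
    unfolding fmetric_def a(2) en ..
  also have "\<dots> = deriv (\<lambda>s. fd (En c) (?z + s *\<^sub>R (0, ?v)) (0, ?w)) 0"
    by (rule deriv_cong_ev[OF ev refl])
  also have "\<dots> = hess (En c) ?z (0, ?v) (0, ?w)"
    by (rule DERIV_imp_deriv, rule has_field_derivative_line) (use d(2)[OF z] in simp)
  finally show ?thesis .
qed

lemma tvec_pb:
  assumes c: "c \<in> A" "fst u \<in> cdom c" and u: "u \<in> slit A"
  shows "(u, tvec A c (fst u) v) \<in> pb A" "snd (snd (u, tvec A c (fst u) v)) c = v"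
  using tvec_in_TB[OF A c] tvec_comp[OF A c] u by (simp_all add: pb_iff)

lemma chart_energy_En:
  assumes c: "c \<in> A"
  shows "chart_energy (cmap c ` cdom c) (En c)"
proof
  show "open (cmap c ` cdom c)" using A c by (auto simp: smooth_atlas_def)
  show "Ck_on \<infinity> (slit_image c) (En c)" by (rule En_smooth[OF c])
  show "En c (x, t *\<^sub>R y) = t\<^sup>2 * En c (x, y)" if "x \<in> cmap c ` cdom c" "y \<noteq> 0" "t > 0" for x y t
  proof -
    note p = cinv_in[OF that(1)]
    let ?v = "tvec A c (cinv c x) y"
    have v: "?v \<in> TB A" "fst ?v \<in> cdom c" using tvec_in_TB[OF A c] p by auto
    have "cmap (tchart A c) (tscale t ?v) = (x, t *\<^sub>R y)" "cmap (tchart A c) ?v = (x, y)"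
      using p tvec_comp[OF A c] by simp_all
    then show ?thesis
      using En_point[OF c tscale_TB[OF A v(1), of t]] En_point[OF c v] v energy_scale[OF v(1) that(3)] by simp
  qed
  show "hess (En c) z (0, v) (0, v) > 0" if z: "z \<in> slit_image c" and v: "v \<noteq> 0" for z v
  proof -
    obtain u where u: "u \<in> slit A" "fst u \<in> cdom c" "z = cmap (tchart A c) u"
      using z by (rule slit_imageE[OF A c])
    let ?a = "(u, tvec A c (fst u) v)"
    note a = tvec_pb[OF c u(2,1), of v]
    have "?a \<noteq> pzero u" using a(2) v by (metis snd_pullback_ops(3) snd_tangent_ops(3))
    then have "fmetric L ?a ?a > 0" using finsler a(1) unfolding finsler_manifold_def by simp
    then show ?thesis using fmetric_hess[OF c u(2,1) a(1) _ a(1)] a(2) u(3) by simp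
  qed
qed

lemma dfun_energy:
  assumes c: "c \<in> A" "fst u \<in> cdom c" and u: "u \<in> slit A" and x: "x \<in> tangent_at A u"
  shows "dfun (tatlas A) (energy L) x = fd (En c) (cmap (tchart A c) u) (snd x (tchart A c))"
proof -
  have x': "x \<in> TB (tatlas A)" "fst x = u" using x by (simp_all add: tangent_at_iff)
  have "u \<in> cdom (tchart A c)" using c slit_TB[OF u] by simp
  then have "dfun (tatlas A) (energy L) x = fd (energy L \<circ> cinv (tchart A c)) (cmap (tchart A c) u) (snd x (tchart A c))"
    using dfun_chart[OF TA tchart_in[OF c(1)] x'(1)] Ck_mfun_differentiable[OF energy_smooth tchart_in[OF c(1)] u]
    unfolding x'(2) by blast
  then show ?thesis by (simp add: En_def[abs_def] o_def)
qed

lemma dfun_energy_gam: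
  assumes a: "a \<in> pb A" and c: "c \<in> A" "fst (fst a) \<in> cdom c"
  shows "dfun (tatlas A) (energy L) (gam A a) = fd (En c) (cmap (tchart A c) (fst a)) (0, snd (snd a) c)"
  using dfun_energy[OF c _ gam_comp(1)[OF A a]] gam_comp(2)[OF A a c] a by (simp add: pb_iff)

lemma eta_pb: "u \<in> slit A \<Longrightarrow> eta A u \<in> pb A" "u \<in> slit A \<Longrightarrow> fst (eta A u) = u"
  "u \<in> slit A \<Longrightarrow> snd (snd (eta A u)) c = snd u c"
  by (auto simp: eta_def pb_iff slit_def)

text \<open>The second of the two basic identities, \<open>dE (\<gamma> v) = g(v, \<eta>)\<close>, in both arguments of \<open>g\<close>. Euler's
  relation for \<open>e\<close>, differentiated along the fibre, gives one of them; the other is Euler's relation for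
  the derivative of \<open>e\<close>.\<close>

lemma fmetric_eta:
  assumes a: "a \<in> pb A"
  shows "fmetric L a (eta A (fst a)) = dfun (tatlas A) (energy L) (gam A a)"
    "fmetric L (eta A (fst a)) a = dfun (tatlas A) (energy L) (gam A a)"
proof -
  have u: "fst a \<in> slit A" using a by (simp add: pb_iff)
  obtain c where c: "c \<in> A" "fst (fst a) \<in> cdom c" using TB_fst[OF slit_TB[OF u]] by blast
  interpret chart_energy "cmap c ` cdom c" "En c" by (rule chart_energy_En[OF c(1)])
  let ?z = "cmap (tchart A c) (fst a)"
  have z: "?z \<in> slit_image c" by (rule slit_image_point[OF A c(1) u c(2)])
  have s: "snd ?z = snd (fst a) c" by simp
  show "fmetric L a (eta A (fst a)) = dfun (tatlas A) (energy L) (gam A a)"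
    unfolding fmetric_hess[OF c u a refl eta_pb(1,2)[OF u]] dfun_energy_gam[OF a c] eta_pb(3)[OF u]
    using hess_fibre_right_vertical[OF z] s by simp
  show "fmetric L (eta A (fst a)) a = dfun (tatlas A) (energy L) (gam A a)"
    unfolding fmetric_hess[OF c u eta_pb(1,2)[OF u] a refl] dfun_energy_gam[OF a c] eta_pb(3)[OF u]
    using hess_fibre_left[of "fst ?z" "snd ?z"] z by simp
qed

lemma fmetric_eta_eta:
  assumes u: "u \<in> slit A"
  shows "fmetric L (eta A u) (eta A u) = 2 * energy L u"
proof -
  obtain c where c: "c \<in> A" "fst u \<in> cdom c" using TB_fst[OF slit_TB[OF u]] by blast
  interpret chart_energy "cmap c ` cdom c" "En c" by (rule chart_energy_En[OF c(1)])
  let ?z = "cmap (tchart A c) u"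
  have z: "?z \<in> slit_image c" by (rule slit_image_point[OF A c(1) u c(2)])
  have "fmetric L (eta A u) (eta A u) = fd (En c) ?z (0, snd u c)"
    using fmetric_eta(1)[OF eta_pb(1)[OF u]] dfun_energy_gam[OF eta_pb(1)[OF u] c(1)] eta_pb(2,3)[OF u] c(2) by simp
  also have "\<dots> = 2 * energy L u"
    using euler[of "fst ?z" "snd ?z"] z En_point[OF c(1) slit_TB[OF u] c(2)] by simp
  finally show ?thesis .
qed

lemma fmetric_pzero:
  assumes u: "u \<in> slit A" and b: "b \<in> pb A" "fst b = u"
  shows "fmetric L (pzero u) b = 0" "fmetric L b (pzero u) = 0"
proof -
  obtain c where c: "c \<in> A" "fst u \<in> cdom c" using TB_fst[OF slit_TB[OF u]] by blast
  interpret chart_energy "cmap c ` cdom c" "En c" by (rule chart_energy_En[OF c(1)])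
  have z: "cmap (tchart A c) u \<in> slit_image c" by (rule slit_image_point[OF A c(1) u c(2)])
  note p = pzero_pb[OF A u] fst_pullback_ops(4)[of u]
  show "fmetric L (pzero u) b = 0" "fmetric L b (pzero u) = 0"
    unfolding fmetric_hess[OF c u p b] fmetric_hess[OF c u b p]
    using linear_0[OF linear_hess[OF z]] linear_0[OF linear_hess2[OF z]] by (simp_all add: zero_prod_def)
qed

lemma dJ_energy:
  assumes x: "x \<in> tangent_at A u" and u: "u \<in> slit A" and c: "c \<in> A" "fst u \<in> cdom c"
  shows "dfun (tatlas A) (energy L) (J A x) = fd (En c) (cmap (tchart A c) u) (0, fst (snd x (tchart A c)))"
  unfolding J_def
  using dfun_energy_gam[OF rho_pb(1)[OF A x u] c(1)] rho_pb(2)[OF A x u] rho_pb(3)[OF A x u c] c(2) by simp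

lemma dJ_energy_smooth:
  assumes Y: "Y \<in> slit_fields A"
  shows "Ck_mfun \<infinity> (tatlas A) (slit A) (\<lambda>q. dfun (tatlas A) (energy L) (J A (Y q)))"
proof (rule Ck_mfun_local)
  fix u assume u: "u \<in> slit A"
  obtain c where c: "c \<in> A" "fst u \<in> cdom c" using TB_fst[OF slit_TB[OF u]] by blast
  note O = atlas_open_slit_over[OF A atlas_open_cdom[OF A c(1)]]
  have C: "Ck_mfun \<infinity> (tatlas A) (slit_over A (cdom c)) (cmap (tchart A c))"
    by (rule Ck_mfun_subset[OF Ck_mfun_cmap[OF TA tchart_in[OF c(1)]]]) (auto simp: slit_def)
  have "Ck_mfun \<infinity> (tatlas A) (slit_over A (cdom c))
      (\<lambda>q. fd (En c) (cmap (tchart A c) q) (0, fst (snd (Y q) (tchart A c))))"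
  proof (rule Ck_mfun_linear_family[OF TA O, where T = "\<lambda>q. fd (En c) (cmap (tchart A c) q)"])
    show "linear (fd (En c) (cmap (tchart A c) q))" if "q \<in> slit_over A (cdom c)" for q
      by (rule linear_frechet_derivative[OF Ck_on_infty_differentiable[OF En_smooth[OF c(1)]]])
        (use slit_image_point[OF A c(1), of q] that in blast)
    show "Ck_mfun \<infinity> (tatlas A) (slit_over A (cdom c)) (\<lambda>q. fd (En c) (cmap (tchart A c) q) b)" for b
      by (rule Ck_mfun_compose[OF TA O open_slit_image[OF A c(1)] _ Ck_on_infty_fd[OF En_smooth[OF c(1)]] C])
        (use slit_image_point[OF A c(1)] in blast)
    show "Ck_mfun \<infinity> (tatlas A) (slit_over A (cdom c)) (\<lambda>q. (0, fst (snd (Y q) (tchart A c))))"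
      by (rule Ck_mfun_Pair[OF O Ck_mfun_const Ck_mfun_compose_linear[OF bounded_linear_fst O
              slit_fields_smooth[OF A c(1) Y]]])
  qed
  then have "Ck_mfun \<infinity> (tatlas A) (slit_over A (cdom c)) (\<lambda>q. dfun (tatlas A) (energy L) (J A (Y q)))"
    by (rule Ck_mfun_cong[OF TA O, rotated]) (use dJ_energy[OF slit_fieldsD(2)[OF Y] _ c(1)] in auto)
  then show "\<exists>N. atlas_open (tatlas A) N \<and> u \<in> N \<and>
      Ck_mfun \<infinity> (tatlas A) N (\<lambda>q. dfun (tatlas A) (energy L) (J A (Y q)))"
    using O u c(2) by blast
qed

text \<open>The derivative of \<open>d\<^sub>J E (Y)\<close> along \<open>X\<close>, by the product rule in a chart.\<close>

lemma dfun_dJ_energy: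
  assumes X: "X \<in> slit_fields A" and Y: "Y \<in> slit_fields A" and u: "u \<in> slit A"
    and c: "c \<in> A" "fst u \<in> cdom c"
  shows "dfun (tatlas A) (\<lambda>q. dfun (tatlas A) (energy L) (J A (Y q))) (X u) =
    hess (En c) (cmap (tchart A c) u) (snd (X u) (tchart A c)) (0, fst (snd (Y u) (tchart A c))) +
    fd (En c) (cmap (tchart A c) u)
      (0, fst (fd (field_coord A c Y) (cmap (tchart A c) u) (snd (X u) (tchart A c))))"
proof -
  let ?f = "\<lambda>q. dfun (tatlas A) (energy L) (J A (Y q))"
  let ?C = "tchart A c"
  let ?z = "cmap ?C u"
  note W = open_slit_image[OF A c(1)] and z = slit_image_point[OF A c(1) u c(2)]
  have uC: "u \<in> cdom ?C" using slit_TB[OF u] c by simp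
  have "dfun (tatlas A) ?f (X u) = fd (?f \<circ> cinv ?C) ?z (snd (X u) ?C)"
    using dfun_chart[OF TA tchart_in[OF c(1)] slit_fieldsD(3)[OF X u]]
      Ck_mfun_differentiable[OF dJ_energy_smooth[OF Y] tchart_in[OF c(1)] u uC] uC
    unfolding slit_fieldsD(4)[OF X u] by blast
  have i: "((\<lambda>z. z) has_derivative (\<lambda>a. a)) (at ?z)" by (rule has_derivative_ident)
  have p: "((\<lambda>z. (0::'e, fst (field_coord A c Y z))) has_derivative
      (\<lambda>a. (0, fst (fd (field_coord A c Y) ?z a)))) (at ?z)"
    by (intro has_derivative_Pair has_derivative_const has_derivative_fst field_coord_deriv[OF A c(1) Y z])
  have "((\<lambda>z. fd (En c) z (0, fst (field_coord A c Y z))) has_derivative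
      (\<lambda>a. fd (\<lambda>z. fd (En c) z (0, fst (field_coord A c Y ?z))) ?z a +
        fd (En c) ?z (0, fst (fd (field_coord A c Y) ?z a)))) (at ?z)"
    by (rule has_derivative_fd_apply[OF W z En_smooth[OF c(1)] i p W z])
  then have "((?f \<circ> cinv ?C) has_derivative
      (\<lambda>a. fd (\<lambda>z. fd (En c) z (0, fst (field_coord A c Y ?z))) ?z a +
        fd (En c) ?z (0, fst (fd (field_coord A c Y) ?z a)))) (at ?z)"
  proof (rule has_derivative_transform_open[OF _ W z])
    fix w assume "w \<in> slit_image c"
    then obtain q where q: "q \<in> slit A" "fst q \<in> cdom c" "w = cmap ?C q" "cinv ?C w = q"
      by (rule slit_imageE[OF A c(1)])
    show "fd (En c) w (0, fst (field_coord A c Y w)) = (?f \<circ> cinv ?C) w"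
      using dJ_energy[OF slit_fieldsD(2)[OF Y q(1)] q(1) c(1) q(2)] q(3,4)
      by (simp add: field_coord_def del: tchart_simps)
  qed
  then show ?thesis
    using \<open>dfun (tatlas A) ?f (X u) = fd (?f \<circ> cinv ?C) ?z (snd (X u) ?C)\<close>
    unfolding hess_def field_coord_at[OF A c(1) slit_TB[OF u] c(2)] by (simp add: fd_eq)
qed

text \<open>The first derivatives of the fields cancel against the bracket, so \<open>\<Omega>\<close> is a tensor and may be
  evaluated on components.\<close>

lemma Omega_coord:
  assumes X: "X \<in> slit_fields A" and Y: "Y \<in> slit_fields A" and u: "u \<in> slit A"
    and c: "c \<in> A" "fst u \<in> cdom c"
  shows "Omega A L X Y u =
    ddJ (En c) (cmap (tchart A c) u) (snd (X u) (tchart A c)) (snd (Y u) (tchart A c))"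
proof -
  interpret chart_energy "cmap c ` cdom c" "En c" by (rule chart_energy_En[OF c(1)])
  let ?z = "cmap (tchart A c) u" and ?br = "lie_bracket (tatlas A) X Y u"
  let ?b = "\<lambda>X Y. fst (fd (field_coord A c Y) ?z (snd (X u) (tchart A c)))"
  have z: "?z \<in> slit_image c" by (rule slit_image_point[OF A c(1) u c(2)])
  note r = rho_lie_bracket[OF A u X Y]
  have "dfun (tatlas A) (energy L) (J A ?br) = fd (En c) ?z (0, fst (snd ?br (tchart A c)))"
    unfolding J_def using dfun_energy_gam[OF r(1) c(1)] c(2) unfolding r(2) r(3)[OF c] by blast
  also have "(0, fst (snd ?br (tchart A c))) = (0, ?b X Y) - (0::'e, ?b Y X)"
    unfolding lie_bracket_coord[OF A c(1) slit_TB[OF u] c(2)] by simp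
  also have "fd (En c) ?z ((0, ?b X Y) - (0, ?b Y X)) = fd (En c) ?z (0, ?b X Y) - fd (En c) ?z (0, ?b Y X)"
    by (rule linear_diff[OF lin[OF z]])
  finally show ?thesis
    unfolding Omega_def ext_d_def dfun_dJ_energy[OF X Y u c] dfun_dJ_energy[OF Y X u c] ddJ_def by simp
qed

end

section \<open>The canonical spray\<close>

lemma rho_section:
  assumes A: "smooth_atlas A" and Y: "Y \<in> slit_fields A"
  shows "(\<lambda>u\<in>slit A. rho A (Y u)) \<in> pb_sections A"
proof (rule pb_sectionsI[OF A])
  fix d assume d: "d \<in> A"
  note O = atlas_open_slit_over[OF A atlas_open_cdom[OF A d]]
  show "Ck_mfun \<infinity> (tatlas A) (slit_over A (cdom d)) (\<lambda>u. snd (snd ((\<lambda>u\<in>slit A. rho A (Y u)) u)) d)"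
    by (rule Ck_mfun_cong[OF smooth_atlas_tatlas[OF A] O _
          Ck_mfun_compose_linear[OF bounded_linear_fst O slit_fields_smooth[OF A d Y]]])
      (use rho_pb(3)[OF A slit_fieldsD(2)[OF Y] _ d] in simp)
qed (use rho_pb(1,2)[OF A slit_fieldsD(2)[OF Y]] in simp_all)

locale hor_torsion_free_connection = finsler A L
  for A :: "('m, 'e::euclidean_space) chart set" and L +
  fixes D :: "('m, 'e) vfield \<Rightarrow> ('m, 'e) pbsection \<Rightarrow> ('m, 'e) pbsection"
  assumes regular: "regular_connection A D"
    and metric: "metric_connection A L D"
    and torsion0: "\<And>s t u. s \<in> pb_sections A \<Longrightarrow> t \<in> pb_sections A \<Longrightarrow> u \<in> slit A \<Longrightarrow>
      hor_torsion A D s t u = pzero u"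
begin

abbreviation S :: "('m, 'e) vfield" where "S \<equiv> assoc_semispray A D"

abbreviation E :: "('m, 'e) tangent2 \<Rightarrow> real" where "E \<equiv> dfun (tatlas A) (energy L)"

lemma D: "linear_connection A D"
  by (rule regular_linear[OF regular])

lemma eta: "eta A \<in> pb_sections A"
  by (rule eta_section[OF A])

lemma hmap_field: "t \<in> pb_sections A \<Longrightarrow> (\<lambda>u\<in>slit A. hmap A D (t u)) \<in> slit_fields A"
  by (rule hmap_smooth[OF M regular])

lemma S_field: "S \<in> slit_fields A"
  unfolding assoc_semispray_def by (rule hmap_field[OF eta])

lemma metricD:
  assumes "X \<in> slit_fields A" "s \<in> pb_sections A" "t \<in> pb_sections A" "u \<in> slit A"
  shows "dfun (tatlas A) (\<lambda>w. fmetric L (s w) (t w)) (X u) =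
    fmetric L (D X s u) (t u) + fmetric L (s u) (D X t u)"
  using metric assms by (simp add: metric_connection_def)

lemma D_pb:
  assumes "X \<in> slit_fields A" "s \<in> pb_sections A" "u \<in> slit A"
  shows "D X s u \<in> pb A" "fst (D X s u) = u"
  using pb_sectionsD(2,3)[OF connection_closed[OF D assms(1,2)] assms(3)] .

lemma D_eta_horizontal:
  assumes X: "X \<in> slit_fields A" and u: "u \<in> slit A" and h: "X u \<in> hor A D u"
  shows "D X (eta A) u = pzero u"
  using h unfolding conn_map_eq[OF M D X u] by (simp add: hor_def)

text \<open>Since \<open>2 E = g(\<eta>, \<eta>)\<close> and \<open>D\<close> is metric, the derivative of \<open>E\<close> along \<open>X\<close> pairs \<open>D\<^sub>X \<eta> = 0\<close> with \<open>\<eta>\<close>.\<close>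

lemma energy_horizontal:
  assumes X: "X \<in> slit_fields A" and u: "u \<in> slit A" and h: "X u \<in> hor A D u"
  shows "E (X u) = 0"
proof -
  note Xu = slit_fieldsD(3,4)[OF X u]
  obtain c where c: "c \<in> A" "fst u \<in> cdom c" using TB_fst[OF slit_TB[OF u]] by blast
  have uC: "u \<in> cdom (tchart A c)" using slit_TB[OF u] c by simp
  have sm: "Ck_mfun \<infinity> (tatlas A) (slit A) (\<lambda>w. 2 * energy L w)"
    by (rule Ck_mfun_compose_linear[OF bounded_linear_mult_right atlas_open_slit[OF A] energy_smooth])
  have "dfun (tatlas A) (\<lambda>w. fmetric L (eta A w) (eta A w)) (X u) = 0"
    unfolding metricD[OF X eta eta u] D_eta_horizontal[OF X u h]
    using fmetric_pzero[OF u eta_pb(1,2)[OF u]] by simp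
  moreover have "dfun (tatlas A) (\<lambda>w. fmetric L (eta A w) (eta A w)) (X u) =
      dfun (tatlas A) (\<lambda>w. 2 * energy L w) (X u)"
    by (rule dfun_cong[OF TA Xu(1) atlas_open_slit[OF A] _ _ sm]) (use Xu(2) u fmetric_eta_eta in auto)
  moreover have "dfun (tatlas A) (\<lambda>w. 2 * energy L w) (X u) = 2 * E (X u)"
  proof -
    let ?z = "cmap (tchart A c) u"
    have d: "(energy L \<circ> cinv (tchart A c)) differentiable (at ?z)"
      "((\<lambda>w. 2 * energy L w) \<circ> cinv (tchart A c)) differentiable (at ?z)"
      using Ck_mfun_differentiable[OF energy_smooth tchart_in[OF c(1)] u uC]
        Ck_mfun_differentiable[OF sm tchart_in[OF c(1)] u uC] .
    have e: "((energy L \<circ> cinv (tchart A c)) has_derivative fd (energy L \<circ> cinv (tchart A c)) ?z) (at ?z)"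
      using d(1) by (simp only: frechet_derivative_works)
    have f: "(\<lambda>w. 2 * energy L w) \<circ> cinv (tchart A c) = (\<lambda>z. 2 * (energy L \<circ> cinv (tchart A c)) z)"
      by (simp add: fun_eq_iff)
    have "dfun (tatlas A) (\<lambda>w. 2 * energy L w) (X u)
        = fd ((\<lambda>w. 2 * energy L w) \<circ> cinv (tchart A c)) ?z (snd (X u) (tchart A c))"
      using dfun_chart[OF TA tchart_in[OF c(1)] Xu(1)] d(2) uC unfolding Xu(2) by blast
    moreover have "E (X u) = fd (energy L \<circ> cinv (tchart A c)) ?z (snd (X u) (tchart A c))"
      using dfun_chart[OF TA tchart_in[OF c(1)] Xu(1)] d(1) uC unfolding Xu(2) by blast
    ultimately show ?thesis unfolding f fd_eq[OF has_derivative_mult_right[OF e]] by simp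
  qed
  ultimately show ?thesis by simp
qed

lemma horizontal_lift:
  assumes t: "t \<in> pb_sections A" and u: "u \<in> slit A"
  shows "(\<lambda>u\<in>slit A. hmap A D (t u)) u \<in> hor A D u" "rho A ((\<lambda>u\<in>slit A. hmap A D (t u)) u) = t u"
  using hmap_hor[OF M regular pb_sectionsD(2)[OF t u]] pb_sectionsD(3)[OF t u] u by simp_all

text \<open>The identity \<open>d\<^sub>J E (\<beta> t) = g(t, \<eta>)\<close>, in the form needed to differentiate it with a metric connection.\<close>

lemma dJ_energy_metric:
  assumes t: "t \<in> pb_sections A" and u: "u \<in> slit A" and X: "X \<in> slit_fields A"
  shows "dfun (tatlas A) (\<lambda>q. E (J A ((\<lambda>u\<in>slit A. hmap A D (t u)) q))) (X u) =
    dfun (tatlas A) (\<lambda>q. fmetric L (t q) (eta A q)) (X u)"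
proof (rule sym, rule dfun_cong[OF TA slit_fieldsD(3)[OF X u] atlas_open_slit[OF A] _ _
      dJ_energy_smooth[OF hmap_field[OF t]]])
  show "fst (X u) \<in> slit A" using slit_fieldsD(4)[OF X u] u by simp
  show "E (J A ((\<lambda>u\<in>slit A. hmap A D (t u)) q)) = fmetric L (t q) (eta A q)" if q: "q \<in> slit A" for q
    unfolding J_def horizontal_lift(2)[OF t q]
    using fmetric_eta(1)[OF pb_sectionsD(2)[OF t q]] pb_sectionsD(3)[OF t q] by simp
qed

text \<open>All derivatives of \<open>\<eta>\<close> vanish along horizontal fields, and vanishing of the horizontal torsion says
  \<open>D\<^sub>S t = \<rho>[S, \<beta> t]\<close>. The two remaining terms of \<open>\<Omega>(S, \<beta> t)\<close> cancel.\<close>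

lemma Omega_horizontal:
  assumes t: "t \<in> pb_sections A" and u: "u \<in> slit A"
  shows "Omega A L S (\<lambda>u\<in>slit A. hmap A D (t u)) u = 0"
proof -
  let ?Y = "\<lambda>u\<in>slit A. hmap A D (t u)"
  note Y = hmap_field[OF t]
  have S_lift: "S = (\<lambda>u\<in>slit A. hmap A D (eta A u))" by (simp add: assoc_semispray_def)
  have DSeta: "D S (eta A) u = pzero u"
    by (rule D_eta_horizontal[OF S_field u]) (use horizontal_lift(1)[OF eta u] S_lift in simp)
  have DYeta: "D ?Y (eta A) u = pzero u"
    by (rule D_eta_horizontal[OF Y u horizontal_lift(1)[OF t u]])
  have rY: "(\<lambda>u\<in>slit A. rho A (?Y u)) = t"
    by (rule extensionalityI[of _ "slit A"]) (use horizontal_lift(2)[OF t] pb_sectionsD(1)[OF t] in simp_all)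
  have rS: "(\<lambda>u\<in>slit A. rho A (S u)) = eta A"
    by (rule extensionalityI[of _ "slit A"])
      (use horizontal_lift(2)[OF eta] pb_sectionsD(1)[OF eta] S_lift in simp_all)
  let ?br = "lie_bracket (tatlas A) S ?Y u"
  note br = rho_lie_bracket[OF A u S_field Y]
  have "psub (psub (D S t u) (D ?Y (eta A) u)) (rho A ?br) = pzero u"
    using torsion0[OF eta t u] u unfolding hor_torsion_def torsion_def S_lift[symmetric] rY rS by simp
  then have p: "psub (psub (D S t u) (pzero u)) (rho A ?br) = pzero u" unfolding DYeta .
  have tor: "D S t u = rho A ?br"
  proof -
    obtain c where c: "c \<in> A" "fst u \<in> cdom c" using TB_fst[OF slit_TB[OF u]] by blast
    have "snd (snd (psub (psub (D S t u) (pzero u)) (rho A ?br))) c = 0" unfolding p by simp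
    then have "snd (snd (D S t u)) c = snd (snd (rho A ?br)) c" by simp
    then show ?thesis
      by (intro pb_eqI[OF A c(1) D_pb(1)[OF S_field t u] br(1)])
        (simp_all only: D_pb(2)[OF S_field t u] br(2) c(2))
  qed
  have 1: "dfun (tatlas A) (\<lambda>q. E (J A (?Y q))) (S u) = fmetric L (rho A ?br) (eta A u)"
    unfolding dJ_energy_metric[OF t u S_field] metricD[OF S_field t eta u] DSeta tor
    using fmetric_pzero(2)[OF u pb_sectionsD(2,3)[OF t u]] by simp
  have 2: "dfun (tatlas A) (\<lambda>q. E (J A (S q))) (?Y u) = 0"
    unfolding S_lift dJ_energy_metric[OF eta u Y] metricD[OF Y eta eta u] DYeta
    using fmetric_pzero[OF u eta_pb(1,2)[OF u]] by simp
  have 3: "E (J A ?br) = fmetric L (rho A ?br) (eta A u)"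
    unfolding J_def using fmetric_eta(1)[OF br(1)] unfolding br(2) by simp
  show ?thesis unfolding Omega_def ext_d_def 1 2 3 by simp
qed

lemma S_coord:
  assumes u: "u \<in> slit A" and c: "c \<in> A" "fst u \<in> cdom c"
  shows "fst (snd (S u) (tchart A c)) = snd u c"
  using hmap_tangent(2)[OF M regular eta_pb(1)[OF u] c(1)] c(2) u eta_pb(2,3)[OF u]
  by (simp add: assoc_semispray_def)

text \<open>At \<open>u\<close> the vector \<open>Y u\<close> is the sum of the horizontal lift of \<open>\<rho> (Y u)\<close> and a vertical vector \<open>(0, w)\<close>.
  Both sides of the equation are additive in \<open>Y u\<close>.\<close>

lemma S_canonical:
  assumes Y: "Y \<in> slit_fields A" and u: "u \<in> slit A"
  shows "Omega A L S Y u = - E (Y u)"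
proof -
  obtain c where c: "c \<in> A" "fst u \<in> cdom c" using TB_fst[OF slit_TB[OF u]] by blast
  interpret chart_energy "cmap c ` cdom c" "En c" by (rule chart_energy_En[OF c(1)])
  let ?C = "tchart A c"
  let ?z = "cmap ?C u"
  have z: "?z \<in> slit_image c" by (rule slit_image_point[OF A c(1) u c(2)])
  let ?t = "\<lambda>u\<in>slit A. rho A (Y u)"
  let ?H = "\<lambda>u\<in>slit A. hmap A D (?t u)"
  have t: "?t \<in> pb_sections A" by (rule rho_section[OF A Y])
  note H = hmap_field[OF t] and hu = horizontal_lift[OF t u]
  have "fst (snd (?H u) ?C) = fst (snd (Y u) ?C)"
    using rho_pb(3)[OF A slit_fieldsD(2)[OF H u] u c] rho_pb(3)[OF A slit_fieldsD(2)[OF Y u] u c] hu(2) u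
    by simp
  then have Yc: "snd (Y u) ?C = snd (?H u) ?C + (0, snd (snd (Y u) ?C) - snd (snd (?H u) ?C))"
    (is "_ = _ + (0, ?w)") by (simp add: prod_eq_iff)
  have Sc: "snd (S u) ?C = (snd ?z, snd (snd (S u) ?C))" using S_coord[OF u c] by (simp add: prod_eq_iff)
  have "Omega A L S Y u = ddJ (En c) ?z (snd (S u) ?C) (snd (?H u) ?C) + ddJ (En c) ?z (snd (S u) ?C) (0, ?w)"
    unfolding Omega_coord[OF S_field Y u c] by (subst Yc) (rule ddJ_linear(3)[OF z])
  also have "ddJ (En c) ?z (snd (S u) ?C) (snd (?H u) ?C) = 0"
    using Omega_horizontal[OF t u] unfolding Omega_coord[OF S_field H u c] .
  also have "ddJ (En c) ?z (snd (S u) ?C) (0, ?w) = - fd (En c) ?z (0, ?w)"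
    by (subst Sc) (rule ddJ_vertical[OF z])
  finally have O: "Omega A L S Y u = - fd (En c) ?z (0, ?w)" by simp
  have "E (Y u) = fd (En c) ?z (snd (?H u) ?C) + fd (En c) ?z (0, ?w)"
    unfolding dfun_energy[OF c u slit_fieldsD(2)[OF Y u]] by (subst Yc) (rule linear_add[OF lin[OF z]])
  also have "fd (En c) ?z (snd (?H u) ?C) = 0"
    using energy_horizontal[OF H u hu(1)] unfolding dfun_energy[OF c u slit_fieldsD(2)[OF H u]] .
  finally show ?thesis using O by simp
qed

lemma canonical_unique:
  assumes G: "is_canonical_spray A L G"
  shows "G = S"
proof (rule extensionalityI[of _ "slit A"])
  have Gf: "G \<in> slit_fields A" using G by (simp add: is_canonical_spray_def)
  show "G \<in> extensional (slit A)" by (rule slit_fieldsD(1)[OF Gf])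
  show "S \<in> extensional (slit A)" by (rule slit_fieldsD(1)[OF S_field])
  fix u assume u: "u \<in> slit A"
  obtain c where c: "c \<in> A" "fst u \<in> cdom c" using TB_fst[OF slit_TB[OF u]] by blast
  interpret chart_energy "cmap c ` cdom c" "En c" by (rule chart_energy_En[OF c(1)])
  let ?C = "tchart A c"
  have z: "cmap ?C u \<in> slit_image c" by (rule slit_image_point[OF A c(1) u c(2)])
  have "snd (G u) ?C = snd (S u) ?C"
  proof (rule ddJ_unique[OF z])
    fix b
    note x = tvec_tangent_at[OF A c slit_TB[OF u], of b]
    obtain Y where Y: "Y \<in> slit_fields A" "Y u = tvec (tatlas A) ?C u b"
      using ex_field_through[OF M x(1) u] by blast
    have "Omega A L G Y u = - E (Y u)" using G Y(1) u by (simp add: is_canonical_spray_def)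
    then have "Omega A L G Y u = Omega A L S Y u" using S_canonical[OF Y(1) u] by simp
    then show "ddJ (En c) (cmap ?C u) (snd (G u) ?C) b = ddJ (En c) (cmap ?C u) (snd (S u) ?C) b"
      unfolding Omega_coord[OF Gf Y(1) u c] Omega_coord[OF S_field Y(1) u c] Y(2) x(2) .
  qed
  moreover have "fst (G u) \<in> cdom ?C" unfolding slit_fieldsD(4)[OF Gf u] using c(2) slit_TB[OF u] by simp
  ultimately show "G u = S u"
    by (intro TB_eqI[OF TA tchart_in[OF c(1)] slit_fieldsD(3)[OF Gf u] slit_fieldsD(3)[OF S_field u]])
      (simp_all only: slit_fieldsD(4)[OF Gf u] slit_fieldsD(4)[OF S_field u])
qed

subsection \<open>Homogeneity\<close>

text \<open>The value 0 on the zero section is the one that makes the function continuous.\<close>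

definition spray_coeff :: "('m, 'e) chart \<Rightarrow> 'e \<times> 'e \<Rightarrow> 'e"
  where "spray_coeff c z = (if snd z = 0 then 0 else snd (field_coord A c S z))"

lemma spray_coeff_point:
  assumes u: "u \<in> slit A" and c: "c \<in> A" "fst u \<in> cdom c"
  shows "snd (S u) (tchart A c) = (snd u c, spray_coeff c (cmap (tchart A c) u))"
  using S_coord[OF u c] field_coord_at[OF A c(1) slit_TB[OF u] c(2), of S] slit_iff[OF A c] u
  by (simp add: spray_coeff_def prod_eq_iff)

lemma spray_coeff_homogeneous:
  assumes c: "c \<in> A" and x: "x \<in> cmap c ` cdom c" and y: "y \<noteq> 0" and t: "t > 0"
  shows "spray_coeff c (x, t *\<^sub>R y) = t\<^sup>2 *\<^sub>R spray_coeff c (x, y)"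
proof -
  interpret chart_energy "cmap c ` cdom c" "En c" by (rule chart_energy_En[OF c])
  have eq: "ddJ (En c) z (snd z, spray_coeff c z) b = - fd (En c) z b" if z: "z \<in> slit_image c" for z b
  proof -
    obtain u where u: "u \<in> slit A" "fst u \<in> cdom c" "z = cmap (tchart A c) u"
      using z by (rule slit_imageE[OF A c])
    note v = tvec_tangent_at[OF A c u(2) slit_TB[OF u(1)], of b]
    obtain Y where Y: "Y \<in> slit_fields A" "Y u = tvec (tatlas A) (tchart A c) u b"
      using ex_field_through[OF M v(1) u(1)] by blast
    have "ddJ (En c) z (snd (S u) (tchart A c)) (snd (Y u) (tchart A c)) = - fd (En c) z (snd (Y u) (tchart A c))"
      using S_canonical[OF Y(1) u(1)]
      unfolding Omega_coord[OF S_field Y(1) u(1) c u(2)]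
        dfun_energy[OF c u(2,1) slit_fieldsD(2)[OF Y(1) u(1)]] u(3) .
    then show ?thesis unfolding Y(2) v(2) spray_coeff_point[OF u(1) c u(2)] u(3) by simp
  qed
  show ?thesis
    by (rule spray_coefficient_homogeneous[OF x y t]) (use eq[of "(x, y)"] eq[of "(x, t *\<^sub>R y)"] x y t in auto)
qed

lemma spray_coeff_smooth:
  assumes c: "c \<in> A"
  shows "Ck_on \<infinity> (slit_image c) (spray_coeff c)"
  by (rule Ck_on_cong[OF open_slit_image[OF A c] _ Ck_on_compose_linear[OF bounded_linear_snd
          open_slit_image[OF A c] field_coord_smooth[OF A c S_field]]])
    (auto simp: spray_coeff_def)

lemma spray_coeff_C1:
  assumes c: "c \<in> A"
  shows "Ck_on 1 (cmap c ` cdom c \<times> UNIV) (spray_coeff c)"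
  unfolding Ck_on_1
proof (rule quadratic_extension_C1)
  show "open (cmap c ` cdom c)" using A c by (auto simp: smooth_atlas_def)
  show "Cn_on 1 (slit_image c) (spray_coeff c)" using spray_coeff_smooth[OF c] by (simp only: Ck_on_infty)
  show "spray_coeff c (x, t *\<^sub>R y) = t\<^sup>2 *\<^sub>R spray_coeff c (x, y)"
    if "x \<in> cmap c ` cdom c" "y \<noteq> 0" "t > 0" for x y t by (rule spray_coeff_homogeneous[OF c that])
qed (simp add: spray_coeff_def)

text \<open>Differentiate the homogeneity relation with respect to the factor at 1.\<close>

lemma spray_coeff_euler:
  assumes c: "c \<in> A" and z: "z \<in> slit_image c"
  shows "fd (spray_coeff c) z (0, snd z) = 2 *\<^sub>R spray_coeff c z"
proof -
  have x: "fst z \<in> cmap c ` cdom c" "snd z \<noteq> 0" using z by auto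
  have "(spray_coeff c has_derivative fd (spray_coeff c) z) (at ((fst z, 0) + 1 *\<^sub>R (0, snd z)))"
    using Ck_on_infty_differentiable[OF spray_coeff_smooth[OF c] z] by (simp add: frechet_derivative_works)
  moreover have "((\<lambda>t. (fst z, 0) + t *\<^sub>R (0, snd z)) has_derivative (\<lambda>h. h *\<^sub>R (0, snd z))) (at (1::real))"
    by (auto intro!: derivative_eq_intros)
  ultimately have "((spray_coeff c \<circ> (\<lambda>t. (fst z, 0) + t *\<^sub>R (0, snd z))) has_derivative
      (fd (spray_coeff c) z \<circ> (\<lambda>h. h *\<^sub>R (0, snd z)))) (at (1::real))"
    by (intro diff_chain_at)
  then have 1: "((\<lambda>t. t\<^sup>2 *\<^sub>R spray_coeff c z) has_derivative (fd (spray_coeff c) z \<circ> (\<lambda>h. h *\<^sub>R (0, snd z)))) (at (1::real))"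
  proof (rule has_derivative_transform_open[where S = "{0<..}"])
    show "(spray_coeff c \<circ> (\<lambda>t. (fst z, 0) + t *\<^sub>R (0, snd z))) t = t\<^sup>2 *\<^sub>R spray_coeff c z" if "t \<in> {0<..}" for t :: real
      using spray_coeff_homogeneous[OF c x, of t] that by simp
  qed auto
  have 2: "((\<lambda>t. t\<^sup>2 *\<^sub>R spray_coeff c z) has_derivative (\<lambda>h. (2 * h) *\<^sub>R spray_coeff c z)) (at (1::real))"
    by (auto intro!: derivative_eq_intros)
  show ?thesis using fun_cong[OF has_derivative_unique[OF 1 2], of 1] by simp
qed

definition S_ext :: "('m, 'e) vfield"
  where "S_ext = (\<lambda>u\<in>TB A. if u \<in> slit A then S u else tzero u)"

lemma S_ext_slit: "u \<in> slit A \<Longrightarrow> S_ext u = S u"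
  using slit_TB[of u A] by (simp add: S_ext_def)

lemma restrict_S_ext: "restrict S_ext (slit A) = S"
  by (rule extensionalityI[of _ "slit A"]) (use S_ext_slit slit_fieldsD(1)[OF S_field] in simp_all)

lemma S_ext_TB:
  assumes u: "u \<in> TB A"
  shows "S_ext u \<in> TB (tatlas A)" "fst (S_ext u) = u"
  using slit_fieldsD(3,4)[OF S_field, of u] tzero_TB[OF TA, of u] u
  by (simp_all add: S_ext_def carrier_tatlas)

lemma S_ext_coord:
  assumes u: "u \<in> TB A" and c: "c \<in> A" "fst u \<in> cdom c"
  shows "snd (S_ext u) (tchart A c) = (snd u c, spray_coeff c (cmap (tchart A c) u))"
proof (cases "u \<in> slit A")
  case True
  then show ?thesis using spray_coeff_point[OF True c] S_ext_slit by simp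
next
  case False
  then have "snd u c = 0" using slit_iff[OF A c] u by simp
  then show ?thesis using False u by (simp add: S_ext_def spray_coeff_def zero_prod_def)
qed

lemma S_ext_C1: "S_ext \<in> vfields 1 (tatlas A) (TB A)"
proof (rule vfieldsI_local[OF TA])
  show "atlas_open (tatlas A) (TB A)" using atlas_open_carrier[OF TA] by (simp add: carrier_tatlas)
  show "S_ext \<in> extensional (TB A)" by (simp add: S_ext_def)
  fix u assume u: "u \<in> TB A"
  show "S_ext u \<in> TB (tatlas A)" "fst (S_ext u) = u" using S_ext_TB[OF u] .
  obtain c where c: "c \<in> A" "fst u \<in> cdom c" using TB_fst[OF u] by blast
  let ?C = "tchart A c" and ?V = "cmap c ` cdom c \<times> (UNIV::'e set)"
  have im: "cmap ?C ` cdom ?C = ?V"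
    using tchart_image[OF A c(1), of "cdom c"] by simp
  have V: "open ?V" using A c(1) by (intro open_Times) (auto simp: smooth_atlas_def)
  have "Ck_mfun 1 (tatlas A) (cdom ?C) (\<lambda>p. snd (S_ext p) ?C)"
  proof (rule Ck_mfun_chart[OF TA tchart_in[OF c(1)] atlas_open_cdom[OF TA tchart_in[OF c(1)]] order_refl])
    show "Ck_on 1 (cmap ?C ` cdom ?C) (\<lambda>z. snd (S_ext (cinv ?C z)) ?C)"
      unfolding im
    proof (rule Ck_on_cong[OF V _ Ck_on_Pair[OF V Ck_on_bounded_linear[OF bounded_linear_snd V] spray_coeff_C1[OF c(1)]]])
      fix z assume "z \<in> ?V"
      then obtain w where w: "w \<in> cdom ?C" "z = cmap ?C w" unfolding im[symmetric] by blast
      then have w': "w \<in> TB A" "fst w \<in> cdom c" by auto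
      have zw: "cinv ?C z = w" unfolding w(2) by (rule cinv_tchart_point[OF A c(1) w'])
      show "(snd z, spray_coeff c z) = snd (S_ext (cinv ?C z)) ?C"
        unfolding zw S_ext_coord[OF w'(1) c(1) w'(2)] by (simp add: w(2))
    qed
  qed
  moreover have "u \<in> cdom ?C" "cdom ?C \<subseteq> TB A \<inter> cdom ?C" using u c(2) by auto
  ultimately show "\<exists>C\<in>tatlas A. \<exists>N. atlas_open (tatlas A) N \<and> u \<in> N \<and> N \<subseteq> TB A \<inter> cdom C \<and>
      Ck_mfun 1 (tatlas A) N (\<lambda>p. snd (S_ext p) C)"
    using tchart_in[OF c(1)] atlas_open_cdom[OF TA tchart_in[OF c(1)]] by blast
qed

text \<open>In a chart the Liouville field is \<open>(0, y)\<close> and the bracket with \<open>(y, F)\<close> is \<open>(y, D F (0, y) - F)\<close>.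
  Euler's relation for \<open>F\<close> turns it into \<open>(y, F)\<close>.\<close>

lemma bracket_liouville:
  assumes u: "u \<in> slit A"
  shows "lie_bracket (tatlas A) (liouville A) S_ext u = S_ext u"
proof (rule prod_eqI)
  note uTB = slit_TB[OF u]
  show "fst (lie_bracket (tatlas A) (liouville A) S_ext u) = fst (S_ext u)" using S_ext_TB[OF uTB] by simp
  show "snd (lie_bracket (tatlas A) (liouville A) S_ext u) = snd (S_ext u)"
  proof
    fix C
    show "snd (lie_bracket (tatlas A) (liouville A) S_ext u) C = snd (S_ext u) C"
    proof (cases "C \<in> tatlas A \<and> u \<in> cdom C")
      case False
      then show ?thesis
        using TB_comp_out[OF S_ext_TB(1)[OF uTB], of C] S_ext_TB(2)[OF uTB]
        by (auto simp: lie_bracket_def)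
    next
      case True
      then obtain c where c: "c \<in> A" "C = tchart A c" by (elim conjE tatlasE)
      have uc: "fst u \<in> cdom c" using True c(2) by simp
      let ?z = "cmap C u"
      have z: "?z \<in> slit_image c" unfolding c(2) by (rule slit_image_point[OF A c(1) u uc])
      note W = open_slit_image[OF A c(1)]
      have lc: "snd (liouville A w) C = (0, snd w c)" if "w \<in> slit A" "fst w \<in> cdom c" for w
        using gam_comp(2)[OF A eta_pb(1)[OF that(1)] c(1)] eta_pb(2,3)[OF that(1)] that c(2)
        by (simp add: liouville_def)
      have "((\<lambda>z::'e \<times> 'e. (0::'e, snd z)) has_derivative (\<lambda>a. (0, snd a))) (at ?z)"
        by (auto intro!: derivative_eq_intros)
      then have 1: "(field_coord A c (liouville A) has_derivative (\<lambda>a. (0, snd a))) (at ?z)"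
      proof (rule has_derivative_transform_open[OF _ W z])
        fix z assume "z \<in> slit_image c"
        then obtain w where w: "w \<in> slit A" "fst w \<in> cdom c" "z = cmap (tchart A c) w" "cinv (tchart A c) z = w"
          by (rule slit_imageE[OF A c(1)])
        show "(0, snd z) = field_coord A c (liouville A) z"
          unfolding field_coord_def w(4) using lc[OF w(1,2)] c(2) w(3) by simp
      qed
      have "((\<lambda>z::'e \<times> 'e. (snd z, spray_coeff c z)) has_derivative (\<lambda>a. (snd a, fd (spray_coeff c) ?z a))) (at ?z)"
        using Ck_on_infty_differentiable[OF spray_coeff_smooth[OF c(1)] z]
        by (auto intro!: has_derivative_Pair has_derivative_snd has_derivative_ident simp: frechet_derivative_works)
      then have 2: "(field_coord A c S_ext has_derivative (\<lambda>a. (snd a, fd (spray_coeff c) ?z a))) (at ?z)"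
      proof (rule has_derivative_transform_open[OF _ W z])
        fix z assume "z \<in> slit_image c"
        then obtain w where w: "w \<in> slit A" "fst w \<in> cdom c" "z = cmap (tchart A c) w" "cinv (tchart A c) z = w"
          by (rule slit_imageE[OF A c(1)])
        show "(snd z, spray_coeff c z) = field_coord A c S_ext z"
          unfolding field_coord_def w(4) S_ext_coord[OF slit_TB[OF w(1)] c(1) w(2)] by (simp add: w(3))
      qed
      have Su: "snd (S_ext u) C = (snd u c, spray_coeff c ?z)"
        unfolding c(2) by (rule S_ext_coord[OF uTB c(1) uc])
      have "snd (lie_bracket (tatlas A) (liouville A) S_ext u) C =
          fd (field_coord A c S_ext) ?z (snd (liouville A u) C) -
          fd (field_coord A c (liouville A)) ?z (snd (S_ext u) C)"
        unfolding c(2) by (rule lie_bracket_coord[OF A c(1) uTB uc])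
      also have "\<dots> = (snd u c, fd (spray_coeff c) ?z (0, snd u c)) - (0, spray_coeff c ?z)"
        unfolding fd_eq[OF 1] fd_eq[OF 2] lc[OF u uc] Su by simp
      also have "fd (spray_coeff c) ?z (0, snd u c) = 2 *\<^sub>R spray_coeff c ?z"
        using spray_coeff_euler[OF c(1) z] c(2) by simp
      finally show ?thesis unfolding Su by (simp add: scaleR_2)
    qed
  qed
qed

lemma S_ext_spray: "is_spray A S_ext"
  unfolding is_spray_def is_semispray_def restrict_S_ext
proof (intro conjI ballI)
  show "rho A (S_ext u) = eta A u" if "u \<in> slit A" for u
    using horizontal_lift(2)[OF eta that] that S_ext_slit[OF that] by (simp add: assoc_semispray_def)
qed (rule S_ext_C1 S_field bracket_liouville; assumption)+

end

theorem corollary3p5: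
  fixes A :: "('m, 'e::euclidean_space) chart set"
    and L :: "('m, 'e) tangent \<Rightarrow> real"
    and D :: "('m, 'e) vfield \<Rightarrow> ('m, 'e) pbsection \<Rightarrow> ('m, 'e) pbsection"
  assumes "finsler_manifold A L"
    and "regular_connection A D"
    and "metric_connection A L D"
    and "\<forall>s\<in>pb_sections A. \<forall>t\<in>pb_sections A. \<forall>u\<in>slit A. hor_torsion A D s t u = pzero u"
    and "\<forall>r\<in>pb_sections A. \<forall>s\<in>pb_sections A. \<forall>t\<in>pb_sections A. \<forall>u\<in>slit A.
      fmetric L (mixed_torsion A D r s u) (t u) = fmetric L (mixed_torsion A D r t u) (s u)"
  shows "(\<exists>S. is_spray A S \<and> restrict S (slit A) = assoc_semispray A D) \<and>
    (\<forall>G. is_canonical_spray A L G \<longleftrightarrow> G = assoc_semispray A D)"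
proof -
  interpret hor_torsion_free_connection A L D
    by unfold_locales (use assms in auto)
  have "is_canonical_spray A L S"
    unfolding is_canonical_spray_def using S_field S_canonical by blast
  then show ?thesis using S_ext_spray restrict_S_ext canonical_unique by blast
qed

end
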